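(* Let $G$ be a group which is the semidirect product of a normal subgroup $N$ and a subgroup $T$, and let $M$ be a $G$-module (with not necessarily trivial $G$-action). Then the sequence of abelian groups $$H^1(T,M) \xrightarrow{\ \partial^0_{N*}\ } H^1(T,\mathrm{Der}(N,M)) \xrightarrow{\ \tau\ } H^2(G,M) \xrightarrow{\ \mathrm{res}\ } H^2(N,M)^T\times H^2(T,M) \xrightarrow{\ \phi\ } H^2(T,\mathrm{Der}(N,M))$$ is exact (at the three intermediate terms), where the maps are defined as follows. The map $\partial^0_{N*}$ is induced by the $T$-module homomorphism $\partial^0_N\colon M\to \mathrm{Der}(N,M)$, $\partial^0_N(m)(n)=nm-m$. For a derivation $d\in \mathrm{Der}(T,\mathrm{Der}(N,M))$, the class $\tau[d]$ is represented by the 2-cocycle $\beta_d\colon G\times G\to M$, $$\beta_d(nt,n't') = n\cdot\big(d(t)({}^tn')\big),\qquad n,n'\in N,\ t,t'\in T.$$ The map $\mathrm{res}$ is the simultaneous restriction map $\mathrm{res}=(\mathrm{res}^G_N,\mathrm{res}^G_T)$. The map $\phi$ is $\phi=(\omega^0_T(\hat\partial^1_N),\,\partial^0_{N*}{}')$, that is, $\phi(z,w)=\omega^0_T(\hat\partial^1_N)(z)+\partial^0_{N*}{}'(w)$ for $z\in H^2(N,M)^T$, $w\in H^2(T,M)$, where $\partial^0_{N*}{}'\colon H^2(T,M)\to H^2(T,\mathrm{Der}(N,M))$ is induced by $\partial^0_N$ on coefficients and $\omega^0_T(\hat\partial^1_N)\colon H^2(N,M)^T\to H^2(T,\mathrm{Der}(N,M))$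 is the composite of connecting homomorphisms defined in the context.
   Context: Cohomology is computed with normalized cochains: for a group $\Gamma$ and a $\Gamma$-module $A$, $C^n(\Gamma,A)$ is the abelian group of functions $\beta\colon\Gamma^{n}\to A$ vanishing on any tuple having some entry equal to $1$, with differential $$\partial^n_\Gamma(\beta)(g_1,\dots,g_{n+1}) = g_1\beta(g_2,\dots,g_{n+1})+\sum_{i=1}^n(-1)^i\beta(g_1,\dots,g_ig_{i+1},\dots,g_{n+1})+(-1)^{n+1}\beta(g_1,\dots,g_n),$$ $Z^n(\Gamma,A)=\ker\partial^n_\Gamma$, and $H^n(\Gamma,A)$ is the cohomology of this complex. $\mathrm{Der}(\Gamma,A)=Z^1(\Gamma,A)$ is the group of derivations, i.e. maps $d\colon\Gamma\to A$ with $d(gg')=g\,d(g')+d(g)$. $M$ is regarded as an $N$-module and a $T$-module by restriction. The group $T$ acts on $N$ by conjugation, ${}^tn=tnt^{-1}$, and on the complex $C^*(N,M)$ by $(t\beta)(n_1,\dots,n_k)=t\,\beta({}^{t^{-1}}n_1,\dots,{}^{t^{-1}}n_k)$. This makes $C^k(N,M)$, $Z^k(N,M)$, $\mathrm{Der}(N,M)=Z^1(N,M)$ and $H^k(N,M)$ into $T$-modules; $H^2(N,M)^T$ denotes the $T$-invariants. For a group $\Gamma$ and a homomorphism of $\Gamma$-modules $f\colon A\to A'$, let $$\omega^n_\Gamma(f)\colon H^n(\Gamma,\mathrm{coker}(f))\xrightarrow{\omega_n}H^{n+1}(\Gamma,\mathrm{Im}(f))\xrightarrow{\omega_{n+1}}H^{n+2}(\Gamma,\ker(f)),$$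 where $\omega_n,\omega_{n+1}$ are the connecting homomorphisms of the short exact sequences $0\to\mathrm{Im}(f)\to A'\to\mathrm{coker}(f)\to0$ and $0\to\ker(f)\to A\to\mathrm{Im}(f)\to0$. Apply this with $\Gamma=T$, $n=0$ and $f=\hat\partial^1_N\colon C^1(N,M)\to Z^2(N,M)$ given by $\partial^1_N$, whose kernel is $\mathrm{Der}(N,M)$ and whose cokernel is $H^2(N,M)$; this gives $\omega^0_T(\hat\partial^1_N)\colon H^2(N,M)^T\to H^2(T,\mathrm{Der}(N,M))$. Explicitly, if $z\in H^2(N,M)^T$ is represented by a 2-cocycle $\beta$, and for $t\in T$ one chooses $\gamma(t)\in C^1(N,M)$ with $t\beta-\beta=\partial^1_N(\gamma(t))$ (and $\gamma(1)=0$), then $\partial^1_T(\gamma)$ takes values in $\mathrm{Der}(N,M)$ and $\omega^0_T(\hat\partial^1_N)(z)$ is its class. *)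

theory Defs
  imports "HOL-Algebra.Bij" "HOL-Algebra.FiniteProduct" "HOL-Algebra.Product_Groups"
begin

text \<open>
  Abelian groups are instances of \<^locale>\<open>comm_group\<close>, hence written multiplicatively;
  a \<open>\<Gamma>\<close>-module is an abelian group \<open>A\<close> together with a homomorphism from \<open>\<Gamma>\<close> to
  \<^term>\<open>AutoGroup A\<close>.  A subgroup \<open>H\<close> of \<open>G\<close> is regarded as a group as
  \<^term>\<open>G\<lparr>carrier := H\<rparr>\<close>, and a \<open>G\<close>-module is an \<open>H\<close>-module through the same action.
\<close>

section \<open>Normalized cochains and cohomology\<close>

definition tuples :: "('g, 'x) monoid_scheme \<Rightarrow> nat \<Rightarrow> 'g list set"
  where "tuples \<Gamma> n = {gs. set gs \<subseteq> carrier \<Gamma> \<and> length gs = n}"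

definition cochain_group :: "nat \<Rightarrow> ('g, 'x) monoid_scheme \<Rightarrow> ('a, 'y) monoid_scheme \<Rightarrow> ('g list \<Rightarrow> 'a) monoid"
  where "cochain_group n \<Gamma> A =
    product_group (tuples \<Gamma> n) (\<lambda>_. A)
      \<lparr>carrier := {\<beta> \<in> tuples \<Gamma> n \<rightarrow>\<^sub>E carrier A.
                     \<forall>gs \<in> tuples \<Gamma> n. \<one>\<^bsub>\<Gamma>\<^esub> \<in> set gs \<longrightarrow> \<beta> gs = \<one>\<^bsub>A\<^esub>}\<rparr>"

text \<open>The tuple \<open>(g\<^sub>1, \<dots>, g\<^sub>i g\<^sub>i\<^sub>+\<^sub>1, \<dots>, g\<^sub>n\<^sub>+\<^sub>1)\<close>; entries are counted from 1, list positions from 0.\<close>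
definition merge_at :: "('g, 'x) monoid_scheme \<Rightarrow> nat \<Rightarrow> 'g list \<Rightarrow> 'g list"
  where "merge_at \<Gamma> i gs = take (i - 1) gs @ [gs ! (i - 1) \<otimes>\<^bsub>\<Gamma>\<^esub> gs ! i] @ drop (i + 1) gs"

definition differential ::
    "nat \<Rightarrow> ('g, 'x) monoid_scheme \<Rightarrow> ('a, 'y) monoid_scheme \<Rightarrow> ('g \<Rightarrow> 'a \<Rightarrow> 'a) \<Rightarrow> ('g list \<Rightarrow> 'a) \<Rightarrow> 'g list \<Rightarrow> 'a"
  where "differential n \<Gamma> A act \<beta> =
    (\<lambda>gs \<in> tuples \<Gamma> (n + 1).
       act (hd gs) (\<beta> (tl gs))
       \<otimes>\<^bsub>A\<^esub> (\<Otimes>\<^bsub>A\<^esub>i\<in>{1..n}. \<beta> (merge_at \<Gamma> i gs) [^]\<^bsub>A\<^esub> ((- 1) ^ i :: int))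
       \<otimes>\<^bsub>A\<^esub> \<beta> (butlast gs) [^]\<^bsub>A\<^esub> ((- 1) ^ (n + 1) :: int))"

definition cocycle_group ::
    "nat \<Rightarrow> ('g, 'x) monoid_scheme \<Rightarrow> ('a, 'y) monoid_scheme \<Rightarrow> ('g \<Rightarrow> 'a \<Rightarrow> 'a) \<Rightarrow> ('g list \<Rightarrow> 'a) monoid"
  where "cocycle_group n \<Gamma> A act =
    cochain_group n \<Gamma> A
      \<lparr>carrier := kernel (cochain_group n \<Gamma> A) (cochain_group (n + 1) \<Gamma> A) (differential n \<Gamma> A act)\<rparr>"

definition coboundaries ::
    "nat \<Rightarrow> ('g, 'x) monoid_scheme \<Rightarrow> ('a, 'y) monoid_scheme \<Rightarrow> ('g \<Rightarrow> 'a \<Rightarrow> 'a) \<Rightarrow> ('g list \<Rightarrow> 'a) set"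
  where "coboundaries n \<Gamma> A act =
    (if n = 0 then {\<one>\<^bsub>cochain_group 0 \<Gamma> A\<^esub>}
     else differential (n - 1) \<Gamma> A act ` carrier (cochain_group (n - 1) \<Gamma> A))"

definition cohomology ::
    "nat \<Rightarrow> ('g, 'x) monoid_scheme \<Rightarrow> ('a, 'y) monoid_scheme \<Rightarrow> ('g \<Rightarrow> 'a \<Rightarrow> 'a) \<Rightarrow> ('g list \<Rightarrow> 'a) set monoid"
  where "cohomology n \<Gamma> A act = cocycle_group n \<Gamma> A act Mod coboundaries n \<Gamma> A act"

definition cohomology_class ::
    "nat \<Rightarrow> ('g, 'x) monoid_scheme \<Rightarrow> ('a, 'y) monoid_scheme \<Rightarrow> ('g \<Rightarrow> 'a \<Rightarrow> 'a) \<Rightarrow> ('g list \<Rightarrow> 'a) \<Rightarrow> ('g list \<Rightarrow> 'a) set"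
  where "cohomology_class n \<Gamma> A act \<beta> = coboundaries n \<Gamma> A act #>\<^bsub>cocycle_group n \<Gamma> A act\<^esub> \<beta>"

text \<open>As in \<open>Der(\<Gamma>,A) = Z\<^sup>1(\<Gamma>,A)\<close>, a derivation is a function of one-element lists.\<close>
abbreviation Der ::
    "('g, 'x) monoid_scheme \<Rightarrow> ('a, 'y) monoid_scheme \<Rightarrow> ('g \<Rightarrow> 'a \<Rightarrow> 'a) \<Rightarrow> ('g list \<Rightarrow> 'a) monoid"
  where "Der \<equiv> cocycle_group 1"

section \<open>Maps between cohomology groups\<close>

text \<open>
  A map \<open>F\<close> of cocycles sends a class \<open>X\<close>, which is a coset, to the union of the classes of the
  \<open>F \<beta>\<close> with \<open>\<beta> \<in> X\<close>.  When \<open>F\<close> is compatible with coboundaries these classes all coincide and the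
  union is the class of \<open>F \<beta>\<close> for any representative \<open>\<beta>\<close>.
\<close>
definition class_map ::
    "nat \<Rightarrow> ('g, 'x) monoid_scheme \<Rightarrow> ('a, 'y) monoid_scheme \<Rightarrow> ('g \<Rightarrow> 'a \<Rightarrow> 'a) \<Rightarrow>
     ('c \<Rightarrow> 'g list \<Rightarrow> 'a) \<Rightarrow> 'c set \<Rightarrow> ('g list \<Rightarrow> 'a) set"
  where "class_map n \<Gamma> A act F X = (\<Union>\<beta>\<in>X. cohomology_class n \<Gamma> A act (F \<beta>))"

definition coeff_map ::
    "nat \<Rightarrow> ('g, 'x) monoid_scheme \<Rightarrow> ('b, 'y) monoid_scheme \<Rightarrow> ('g \<Rightarrow> 'b \<Rightarrow> 'b) \<Rightarrow>
     ('a \<Rightarrow> 'b) \<Rightarrow> ('g list \<Rightarrow> 'a) set \<Rightarrow> ('g list \<Rightarrow> 'b) set"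
  where "coeff_map n \<Gamma> B act f = class_map n \<Gamma> B act (\<lambda>\<beta>. compose (tuples \<Gamma> n) f \<beta>)"

definition restriction_map ::
    "nat \<Rightarrow> ('g, 'x) monoid_scheme \<Rightarrow> ('a, 'y) monoid_scheme \<Rightarrow> ('g \<Rightarrow> 'a \<Rightarrow> 'a) \<Rightarrow>
     ('g list \<Rightarrow> 'a) set \<Rightarrow> ('g list \<Rightarrow> 'a) set"
  where "restriction_map n \<Delta> A act = class_map n \<Delta> A act (\<lambda>\<beta>. restrict \<beta> (tuples \<Delta> n))"

text \<open>
  The connecting homomorphism \<open>H\<^sup>n(\<Gamma>,C) \<rightarrow> H\<^sup>n\<^sup>+\<^sup>1(\<Gamma>,A)\<close> of a short exact sequence
  \<open>0 \<rightarrow> A \<rightarrow> B \<rightarrow> C \<rightarrow> 0\<close> of \<open>\<Gamma>\<close>-modules whose first map is the inclusion of \<open>A = ker p\<close>.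
  As the lift \<open>\<beta>\<close> ranges over all cochains for which \<open>p \<circ> \<beta>\<close> is a representative of \<open>X\<close>, the
  differential \<open>\<partial>\<beta>\<close> ranges over exactly one class with coefficients in \<open>A\<close>.
\<close>
definition connecting ::
    "nat \<Rightarrow> ('g, 'x) monoid_scheme \<Rightarrow> ('b, 'y) monoid_scheme \<Rightarrow> ('g \<Rightarrow> 'b \<Rightarrow> 'b) \<Rightarrow>
     ('b \<Rightarrow> 'c) \<Rightarrow> ('g list \<Rightarrow> 'c) set \<Rightarrow> ('g list \<Rightarrow> 'b) set"
  where "connecting n \<Gamma> B act p X =
    {differential n \<Gamma> B act \<beta> | \<beta>. \<beta> \<in> carrier (cochain_group n \<Gamma> B) \<and> compose (tuples \<Gamma> n) p \<beta> \<in> X}"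

text \<open>
  \<open>\<omega>\<^sup>n\<^sub>\<Gamma>(f) : H\<^sup>n(\<Gamma>, coker f) \<rightarrow> H\<^sup>n\<^sup>+\<^sup>2(\<Gamma>, ker f)\<close> for \<open>f : A \<rightarrow> A'\<close>, where \<open>coker f\<close> is
  \<^term>\<open>A' Mod (f ` carrier A)\<close>.
\<close>
definition omega ::
    "nat \<Rightarrow> ('g, 'x) monoid_scheme \<Rightarrow> ('a, 'y) monoid_scheme \<Rightarrow> ('g \<Rightarrow> 'a \<Rightarrow> 'a) \<Rightarrow>
     ('b, 'z) monoid_scheme \<Rightarrow> ('g \<Rightarrow> 'b \<Rightarrow> 'b) \<Rightarrow> ('a \<Rightarrow> 'b) \<Rightarrow>
     ('g list \<Rightarrow> 'b set) set \<Rightarrow> ('g list \<Rightarrow> 'a) set"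
  where "omega n \<Gamma> A act A' act' f =
    connecting (n + 1) \<Gamma> A act f \<circ> connecting n \<Gamma> A' act' (\<lambda>a. (f ` carrier A) #>\<^bsub>A'\<^esub> a)"

section \<open>Semidirect products\<close>

text \<open>The action of \<open>t \<in> T\<close> on \<open>C\<^sup>k(N,M)\<close>, which restricts to \<open>Z\<^sup>k(N,M)\<close> and to \<open>Der(N,M)\<close>.\<close>
definition conj_act ::
    "nat \<Rightarrow> ('g, 'x) monoid_scheme \<Rightarrow> 'g set \<Rightarrow> ('g \<Rightarrow> 'a \<Rightarrow> 'a) \<Rightarrow> 'g \<Rightarrow> ('g list \<Rightarrow> 'a) \<Rightarrow> 'g list \<Rightarrow> 'a"
  where "conj_act k G N act t \<beta> =
    (\<lambda>ns \<in> tuples (G\<lparr>carrier := N\<rparr>) k. act t (\<beta> (map (\<lambda>n. inv\<^bsub>G\<^esub> t \<otimes>\<^bsub>G\<^esub> n \<otimes>\<^bsub>G\<^esub> t) ns)))"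

text \<open>\<open>H\<^sup>k(N,M)\<^sup>T\<close>; the action on a class is the elementwise action on the coset.\<close>
definition invariant_cohomology ::
    "nat \<Rightarrow> ('g, 'x) monoid_scheme \<Rightarrow> 'g set \<Rightarrow> 'g set \<Rightarrow> ('a, 'y) monoid_scheme \<Rightarrow> ('g \<Rightarrow> 'a \<Rightarrow> 'a) \<Rightarrow>
     ('g list \<Rightarrow> 'a) set monoid"
  where "invariant_cohomology k G N T M act =
    cohomology k (G\<lparr>carrier := N\<rparr>) M act
      \<lparr>carrier := {X \<in> carrier (cohomology k (G\<lparr>carrier := N\<rparr>) M act).
                     \<forall>t \<in> T. conj_act k G N act t ` X = X}\<rparr>"

text \<open>The map \<open>\<partial>\<^sup>0\<^sub>N : M \<rightarrow> Der(N,M)\<close>.\<close>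
definition principal_der ::
    "('g, 'x) monoid_scheme \<Rightarrow> ('a, 'y) monoid_scheme \<Rightarrow> ('g \<Rightarrow> 'a \<Rightarrow> 'a) \<Rightarrow> 'a \<Rightarrow> 'g list \<Rightarrow> 'a"
  where "principal_der \<Gamma> A act m = (\<lambda>gs \<in> tuples \<Gamma> 1. act (hd gs) m \<otimes>\<^bsub>A\<^esub> inv\<^bsub>A\<^esub> m)"

definition principal_der_map ::
    "nat \<Rightarrow> ('g, 'x) monoid_scheme \<Rightarrow> 'g set \<Rightarrow> 'g set \<Rightarrow> ('a, 'y) monoid_scheme \<Rightarrow> ('g \<Rightarrow> 'a \<Rightarrow> 'a) \<Rightarrow>
     ('g list \<Rightarrow> 'a) set \<Rightarrow> ('g list \<Rightarrow> 'g list \<Rightarrow> 'a) set"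
  where "principal_der_map n G N T M act =
    coeff_map n (G\<lparr>carrier := T\<rparr>) (Der (G\<lparr>carrier := N\<rparr>) M act) (conj_act 1 G N act)
      (principal_der (G\<lparr>carrier := N\<rparr>) M act)"

definition tau_cocycle ::
    "('g, 'x) monoid_scheme \<Rightarrow> 'g set \<Rightarrow> 'g set \<Rightarrow> ('g \<Rightarrow> 'a \<Rightarrow> 'a) \<Rightarrow>
     ('g list \<Rightarrow> 'g list \<Rightarrow> 'a) \<Rightarrow> 'g list \<Rightarrow> 'a"
  where "tau_cocycle G N T act d =
    (\<lambda>gs \<in> tuples G 2.
       THE m. \<exists>n \<in> N. \<exists>t \<in> T. \<exists>n' \<in> N. \<exists>t' \<in> T.
         gs = [n \<otimes>\<^bsub>G\<^esub> t, n' \<otimes>\<^bsub>G\<^esub> t'] \<and> m = act n (d [t] [t \<otimes>\<^bsub>G\<^esub> n' \<otimes>\<^bsub>G\<^esub> inv\<^bsub>G\<^esub> t]))"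

definition tau ::
    "('g, 'x) monoid_scheme \<Rightarrow> 'g set \<Rightarrow> 'g set \<Rightarrow> ('a, 'y) monoid_scheme \<Rightarrow> ('g \<Rightarrow> 'a \<Rightarrow> 'a) \<Rightarrow>
     ('g list \<Rightarrow> 'g list \<Rightarrow> 'a) set \<Rightarrow> ('g list \<Rightarrow> 'a) set"
  where "tau G N T M act = class_map 2 G M act (tau_cocycle G N T act)"

definition res ::
    "('g, 'x) monoid_scheme \<Rightarrow> 'g set \<Rightarrow> 'g set \<Rightarrow> ('a, 'y) monoid_scheme \<Rightarrow> ('g \<Rightarrow> 'a \<Rightarrow> 'a) \<Rightarrow>
     ('g list \<Rightarrow> 'a) set \<Rightarrow> ('g list \<Rightarrow> 'a) set \<times> ('g list \<Rightarrow> 'a) set"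
  where "res G N T M act X =
    (restriction_map 2 (G\<lparr>carrier := N\<rparr>) M act X, restriction_map 2 (G\<lparr>carrier := T\<rparr>) M act X)"

text \<open>
  \<open>\<omega>\<^sup>0\<^sub>T\<close> of \<open>\<partial>\<^sup>1\<^sub>N : C\<^sup>1(N,M) \<rightarrow> Z\<^sup>2(N,M)\<close> on \<open>H\<^sup>2(N,M)\<^sup>T\<close>, where an invariant \<open>z\<close> is identified
  with the class in \<open>H\<^sup>0(T, H\<^sup>2(N,M))\<close> of the 0-cochain with value \<open>z\<close>.
\<close>
definition omega_N ::
    "('g, 'x) monoid_scheme \<Rightarrow> 'g set \<Rightarrow> 'g set \<Rightarrow> ('a, 'y) monoid_scheme \<Rightarrow> ('g \<Rightarrow> 'a \<Rightarrow> 'a) \<Rightarrow>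
     ('g list \<Rightarrow> 'a) set \<Rightarrow> ('g list \<Rightarrow> 'g list \<Rightarrow> 'a) set"
  where "omega_N G N T M act z =
    omega 0 (G\<lparr>carrier := T\<rparr>)
      (cochain_group 1 (G\<lparr>carrier := N\<rparr>) M) (conj_act 1 G N act)
      (cocycle_group 2 (G\<lparr>carrier := N\<rparr>) M act) (conj_act 2 G N act)
      (differential 1 (G\<lparr>carrier := N\<rparr>) M act)
      (cohomology_class 0 (G\<lparr>carrier := T\<rparr>) (cohomology 2 (G\<lparr>carrier := N\<rparr>) M act)
         (\<lambda>t X. conj_act 2 G N act t ` X) (\<lambda>_ \<in> tuples (G\<lparr>carrier := T\<rparr>) 0. z))"

definition phi ::
    "('g, 'x) monoid_scheme \<Rightarrow> 'g set \<Rightarrow> 'g set \<Rightarrow> ('a, 'y) monoid_scheme \<Rightarrow> ('g \<Rightarrow> 'a \<Rightarrow> 'a) \<Rightarrow>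
     ('g list \<Rightarrow> 'a) set \<times> ('g list \<Rightarrow> 'a) set \<Rightarrow> ('g list \<Rightarrow> 'g list \<Rightarrow> 'a) set"
  where "phi G N T M act = (\<lambda>(z, w).
    omega_N G N T M act z
    \<otimes>\<^bsub>cohomology 2 (G\<lparr>carrier := T\<rparr>) (Der (G\<lparr>carrier := N\<rparr>) M act) (conj_act 1 G N act)\<^esub>
    principal_der_map 2 G N T M act w)"

end

theory Submission
  imports Defs
begin

text \<open>
  Write everything additively and put \<open>\<^sup>tn = t n t\<^sup>-\<^sup>1\<close>.  The proof rests on a normal form for 2-cocycles of
  \<open>G = N T\<close>.  A cocycle \<open>\<beta>\<close> gives a cocycle \<open>b\<close> on \<open>N\<close> and a cocycle \<open>c\<close> on \<open>T\<close> by restriction,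
  together with the functions \<open>\<gamma>\<^sub>t(n) = \<beta>(t, t\<^sup>-\<^sup>1nt) - \<beta>(n, t)\<close> on \<open>N\<close>.  The cocycle identity yields
    \<^item> (1) \<open>t b - b = \<partial>\<^sub>N(\<gamma>\<^sub>t)\<close> for all \<open>t \<in> T\<close>, and
    \<^item> (2) \<open>\<partial>\<^sub>T\<gamma> + \<partial>\<^sup>0\<^sub>N \<circ> c = 0\<close>,
  and adding to \<open>\<beta>\<close> the coboundary of \<open>h(nt) = \<beta>(n, t)\<close> makes \<open>\<beta>\<close> vanish on \<open>N \<times> T\<close>, after which it
  is given by
    \<^item> (3) \<open>(nt, n't') \<mapsto> n \<gamma>\<^sub>t(\<^sup>tn') + n \<^sup>tn' c(t, t') + b(n, \<^sup>tn')\<close>.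
  Conversely, for cocycles \<open>b\<close> and \<open>c\<close> and a normalized \<open>\<gamma>\<close> subject to (1) and (2), formula (3)
  defines a 2-cocycle of \<open>G\<close> that restricts to \<open>b\<close> and \<open>c\<close>.  These facts are
  \<open>cocycle_gluing_data\<close>, \<open>cocycle_cohomologous_to_glue\<close> and \<open>glue_cocycle\<close>.

  Condition (1) says that the class of \<open>b\<close> is \<open>T\<close>-invariant and that \<open>\<gamma>\<close> is a cochain from
  which \<open>\<omega>\<^sup>0\<^sub>T\<close> may be computed, so that \<open>\<partial>\<^sub>T\<gamma>\<close> represents the image of that class
  (\<open>omega_N_class\<close>); the left-hand side of (2) then represents \<open>\<phi>([b], [c])\<close>.

  Exactness at the product: (1) and (2) for a cocycle of \<open>G\<close> give \<open>\<phi> \<circ> res = 0\<close>.  If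
  \<open>\<phi>([b], [c]) = 0\<close>, then the left-hand side of (2) is \<open>\<partial>\<^sub>Te\<close> with \<open>e\<close> taking values in
  \<open>Der(N, M)\<close>; replacing \<open>\<gamma>\<close> by \<open>\<gamma> - e\<close> preserves (1) and achieves (2), and (3) is a preimage.

  Exactness at \<open>H\<^sup>2(G, M)\<close>: a class with trivial restrictions has a representative with \<open>b = 0\<close> and
  \<open>c = 0\<close>.  Then (1) says that each \<open>\<gamma>\<^sub>t\<close> is a derivation of \<open>N\<close>, (2) says that \<open>\<gamma>\<close> is a
  derivation of \<open>T\<close>, and (3) is the cocycle \<open>\<beta>\<^sub>d\<close> of \<open>d = \<gamma>\<close>.

  Exactness at \<open>H\<^sup>1(T, Der(N, M))\<close>: if \<open>\<beta>\<^sub>d = \<partial>h\<close>, evaluation on pairs from \<open>N\<close> and \<open>T\<close> shows that the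
  restrictions \<open>e\<close> and \<open>- w\<close> of \<open>h\<close> to \<open>N\<close> and \<open>T\<close> are derivations, that
  \<open>h(nt) = e(n) - n w(t)\<close>, and that \<open>d(t) = (t e - e) + \<partial>\<^sup>0\<^sub>N(w(t))\<close>; the computation can be
  read backwards (\<open>tau_cocycle_coboundary_iff\<close>).
\<close>

section \<open>Equations in groups\<close>

text \<open>The degrees of the cochains in use are the numerals 0 to 3, and rules stated for degree 1 would not
  apply to \<^term>\<open>Suc 0\<close>.\<close>
declare One_nat_def [simp del] add_2_eq_Suc [simp del] add_2_eq_Suc' [simp del]

lemma (in group) mult_inv_cancel:
  assumes "x \<in> carrier G" "y \<in> carrier G"
  shows "inv x \<otimes> (x \<otimes> y) = y" and "x \<otimes> (inv x \<otimes> y) = y"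
  using assms by (simp_all add: m_assoc [symmetric])

text \<open>
  Together with the unit laws, a rewrite system that decides equality of words: products are nested
  to the right, inverses pushed to the letters, and neighbouring inverse letters cancelled.
\<close>
lemmas (in group) word_simps =
  m_assoc inv_mult_group inv_inv l_inv r_inv inv_one mult_inv_cancel

text \<open>
  Sorting the factors of a product does not bring \<open>x\<close> next to \<open>inv x\<close>, so ordered rewriting
  alone does not cancel them.  Equations between products in an abelian group are therefore decided by
  writing both sides as fractions, multiplying out the denominators and sorting the two resulting
  products, which contain no inverses.
\<close>
definition frac :: "('a, 'b) monoid_scheme \<Rightarrow> 'a \<Rightarrow> 'a \<Rightarrow> 'a"
  where "frac G x y = x \<otimes>\<^bsub>G\<^esub> inv\<^bsub>G\<^esub> y"

context comm_group
begin

lemma frac_closed: "x \<in> carrier G \<Longrightarrow> y \<in> carrier G \<Longrightarrow> frac G x y \<in> carrier G"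
  by (simp add: frac_def)

lemma inv_eq_frac: "x \<in> carrier G \<Longrightarrow> inv x = frac G \<one> x"
  by (simp add: frac_def)

lemma inv_frac: "x \<in> carrier G \<Longrightarrow> y \<in> carrier G \<Longrightarrow> inv (frac G x y) = frac G y x"
  by (simp add: frac_def inv_mult_group)

lemma mult_frac:
  "x \<in> carrier G \<Longrightarrow> y \<in> carrier G \<Longrightarrow> z \<in> carrier G \<Longrightarrow> frac G x y \<otimes> z = frac G (x \<otimes> z) y"
  "x \<in> carrier G \<Longrightarrow> y \<in> carrier G \<Longrightarrow> z \<in> carrier G \<Longrightarrow> z \<otimes> frac G x y = frac G (z \<otimes> x) y"
  by (simp_all add: frac_def m_ac)

lemma frac_frac:
  "x \<in> carrier G \<Longrightarrow> y \<in> carrier G \<Longrightarrow> z \<in> carrier G \<Longrightarrow> frac G (frac G x y) z = frac G x (y \<otimes> z)"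
  "x \<in> carrier G \<Longrightarrow> y \<in> carrier G \<Longrightarrow> z \<in> carrier G \<Longrightarrow> frac G x (frac G y z) = frac G (x \<otimes> z) y"
  by (simp_all add: frac_def inv_mult m_ac)

lemma frac_eq:
  assumes "x \<in> carrier G" "y \<in> carrier G" "z \<in> carrier G"
  shows "frac G x y = z \<longleftrightarrow> x = z \<otimes> y" and "z = frac G x y \<longleftrightarrow> z \<otimes> y = x"
  using assms inv_solve_right [of z x y] inv_solve_right' [of z x y] by (auto simp: frac_def)

lemmas frac_simps = frac_closed inv_eq_frac inv_frac mult_frac frac_frac frac_eq
  m_closed one_closed l_one r_one m_assoc m_comm m_lcomm

end

lemma (in comm_group) comm_group_subgroup:
  assumes "subgroup H G" shows "comm_group (G\<lparr>carrier := H\<rparr>)"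
proof -
  interpret H: group "G\<lparr>carrier := H\<rparr>" using assms by (rule subgroup_imp_group)
  show ?thesis
    using subgroup.subset [OF assms] by (intro H.group_comm_groupI) (auto intro: m_comm)
qed

section \<open>Tuples and cochains\<close>

lemma tuples_iff [simp]:
  "[] \<in> tuples \<Gamma> n \<longleftrightarrow> n = 0"
  "[g] \<in> tuples \<Gamma> n \<longleftrightarrow> n = 1 \<and> g \<in> carrier \<Gamma>"
  "[g, h] \<in> tuples \<Gamma> n \<longleftrightarrow> n = 2 \<and> g \<in> carrier \<Gamma> \<and> h \<in> carrier \<Gamma>"
  "[g, h, k] \<in> tuples \<Gamma> n \<longleftrightarrow> n = 3 \<and> g \<in> carrier \<Gamma> \<and> h \<in> carrier \<Gamma> \<and> k \<in> carrier \<Gamma>"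
  by (auto simp: tuples_def)

lemma tuples_0: "tuples \<Gamma> 0 = {[]}"
  by (auto simp: tuples_def)

lemma ball_tuples:
  "(\<forall>gs \<in> tuples \<Gamma> 0. P gs) \<longleftrightarrow> P []"
  "(\<forall>gs \<in> tuples \<Gamma> 1. P gs) \<longleftrightarrow> (\<forall>g \<in> carrier \<Gamma>. P [g])"
  "(\<forall>gs \<in> tuples \<Gamma> 2. P gs) \<longleftrightarrow> (\<forall>g \<in> carrier \<Gamma>. \<forall>h \<in> carrier \<Gamma>. P [g, h])"
  "(\<forall>gs \<in> tuples \<Gamma> 3. P gs) \<longleftrightarrow>
     (\<forall>g \<in> carrier \<Gamma>. \<forall>h \<in> carrier \<Gamma>. \<forall>k \<in> carrier \<Gamma>. P [g, h, k])"
  by (auto simp: tuples_def eval_nat_numeral length_Suc_conv One_nat_def)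

lemma extensional_tuples_eqI:
  assumes "f \<in> extensional (tuples \<Gamma> n)" "f' \<in> extensional (tuples \<Gamma> n)"
    and "\<forall>gs \<in> tuples \<Gamma> n. f gs = f' gs"
  shows "f = f'"
  using assms by (auto intro: extensionalityI)

lemma cochain_group_mult [simp]:
  "x \<otimes>\<^bsub>cochain_group n \<Gamma> A\<^esub> y = (\<lambda>gs \<in> tuples \<Gamma> n. x gs \<otimes>\<^bsub>A\<^esub> y gs)"
  by (simp add: cochain_group_def)

lemma cochain_group_one [simp]: "\<one>\<^bsub>cochain_group n \<Gamma> A\<^esub> = (\<lambda>gs \<in> tuples \<Gamma> n. \<one>\<^bsub>A\<^esub>)"
  by (simp add: cochain_group_def)

lemma cocycle_group_mult [simp]:
  "x \<otimes>\<^bsub>cocycle_group n \<Gamma> A act\<^esub> y = (\<lambda>gs \<in> tuples \<Gamma> n. x gs \<otimes>\<^bsub>A\<^esub> y gs)"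
  by (simp add: cocycle_group_def)

lemma cocycle_group_one [simp]:
  "\<one>\<^bsub>cocycle_group n \<Gamma> A act\<^esub> = (\<lambda>gs \<in> tuples \<Gamma> n. \<one>\<^bsub>A\<^esub>)"
  by (simp add: cocycle_group_def)

lemma cochain_iff:
  "\<beta> \<in> carrier (cochain_group n \<Gamma> A) \<longleftrightarrow>
     \<beta> \<in> extensional (tuples \<Gamma> n) \<and>
     (\<forall>gs \<in> tuples \<Gamma> n. \<beta> gs \<in> carrier A \<and> (\<one>\<^bsub>\<Gamma>\<^esub> \<in> set gs \<longrightarrow> \<beta> gs = \<one>\<^bsub>A\<^esub>))"
  by (auto simp: cochain_group_def PiE_iff)

lemma cochain_closed: "\<beta> \<in> carrier (cochain_group n \<Gamma> A) \<Longrightarrow> gs \<in> tuples \<Gamma> n \<Longrightarrow> \<beta> gs \<in> carrier A"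
  by (simp add: cochain_iff)

lemma cochain_eqI:
  assumes "\<beta> \<in> carrier (cochain_group n \<Gamma> A)" "\<beta>' \<in> carrier (cochain_group n \<Gamma> A')"
    and "\<forall>gs \<in> tuples \<Gamma> n. \<beta> gs = \<beta>' gs"
  shows "\<beta> = \<beta>'"
  using assms by (auto simp: cochain_iff intro: extensional_tuples_eqI)

lemma cochain1_iff:
  "\<beta> \<in> carrier (cochain_group 1 \<Gamma> A) \<longleftrightarrow>
     \<beta> \<in> extensional (tuples \<Gamma> 1) \<and> (\<forall>g \<in> carrier \<Gamma>. \<beta> [g] \<in> carrier A) \<and>
     (\<one>\<^bsub>\<Gamma>\<^esub> \<in> carrier \<Gamma> \<longrightarrow> \<beta> [\<one>\<^bsub>\<Gamma>\<^esub>] = \<one>\<^bsub>A\<^esub>)"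
  by (auto simp: cochain_iff ball_tuples)

lemma cochain2_iff:
  "\<beta> \<in> carrier (cochain_group 2 \<Gamma> A) \<longleftrightarrow>
     \<beta> \<in> extensional (tuples \<Gamma> 2) \<and>
     (\<forall>g \<in> carrier \<Gamma>. \<forall>h \<in> carrier \<Gamma>. \<beta> [g, h] \<in> carrier A) \<and>
     (\<one>\<^bsub>\<Gamma>\<^esub> \<in> carrier \<Gamma> \<longrightarrow>
       (\<forall>g \<in> carrier \<Gamma>. \<beta> [\<one>\<^bsub>\<Gamma>\<^esub>, g] = \<one>\<^bsub>A\<^esub> \<and> \<beta> [g, \<one>\<^bsub>\<Gamma>\<^esub>] = \<one>\<^bsub>A\<^esub>))"
  by (auto simp: cochain_iff ball_tuples)

lemma subgroup_cochains:
  assumes "comm_group A"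
  shows "subgroup {\<beta> \<in> tuples \<Gamma> n \<rightarrow>\<^sub>E carrier A.
            \<forall>gs \<in> tuples \<Gamma> n. \<one>\<^bsub>\<Gamma>\<^esub> \<in> set gs \<longrightarrow> \<beta> gs = \<one>\<^bsub>A\<^esub>} (product_group (tuples \<Gamma> n) (\<lambda>_. A))"
proof -
  interpret A: comm_group A by fact
  interpret P: group "product_group (tuples \<Gamma> n) (\<lambda>_. A)" by simp
  show ?thesis
    by (rule P.subgroupI) (force simp: PiE_iff)+
qed

lemma comm_group_cochain_group:
  assumes "comm_group A"
  shows "comm_group (cochain_group n \<Gamma> A)"
proof -
  interpret A: comm_group A by fact
  interpret P: group "product_group (tuples \<Gamma> n) (\<lambda>_. A)" by simp
  interpret C: group "cochain_group n \<Gamma> A"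
    unfolding cochain_group_def
    by (rule subgroup.subgroup_is_group [OF subgroup_cochains [OF assms]]) (rule P.is_group)
  show ?thesis
    by (rule C.group_comm_groupI) (auto simp: cochain_iff A.m_comm intro!: restrict_ext)
qed

lemma cochain_group_inv:
  assumes "comm_group A" "\<beta> \<in> carrier (cochain_group n \<Gamma> A)"
  shows "inv\<^bsub>cochain_group n \<Gamma> A\<^esub> \<beta> = (\<lambda>gs \<in> tuples \<Gamma> n. inv\<^bsub>A\<^esub> \<beta> gs)"
proof -
  interpret A: comm_group A by fact
  interpret C: comm_group "cochain_group n \<Gamma> A" by (rule comm_group_cochain_group) fact
  show ?thesis
    using assms by (intro C.inv_equality) (auto simp: cochain_iff intro!: restrict_ext)
qed

section \<open>Modules and cohomology in low degree\<close>

text \<open>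
  An action is a family of maps here, not a homomorphism to the automorphism group: the
  conjugation action on cochains is defined for all functions on lists and is not extensional in
  its argument.
\<close>
locale group_module = \<Gamma>: group \<Gamma> + A: comm_group A
  for \<Gamma> :: "('g, 'x) monoid_scheme" and A :: "('a, 'y) monoid_scheme" +
  fixes act :: "'g \<Rightarrow> 'a \<Rightarrow> 'a"
  assumes act_closed [simp, intro]: "g \<in> carrier \<Gamma> \<Longrightarrow> a \<in> carrier A \<Longrightarrow> act g a \<in> carrier A"
    and act_mult [simp]: "g \<in> carrier \<Gamma> \<Longrightarrow> a \<in> carrier A \<Longrightarrow> b \<in> carrier A \<Longrightarrow>
      act g (a \<otimes>\<^bsub>A\<^esub> b) = act g a \<otimes>\<^bsub>A\<^esub> act g b"
    and act_act: "g \<in> carrier \<Gamma> \<Longrightarrow> h \<in> carrier \<Gamma> \<Longrightarrow> a \<in> carrier A \<Longrightarrow>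
      act g (act h a) = act (g \<otimes>\<^bsub>\<Gamma>\<^esub> h) a"
    and act_one_left [simp]: "a \<in> carrier A \<Longrightarrow> act \<one>\<^bsub>\<Gamma>\<^esub> a = a"
begin

abbreviation "cochains n \<equiv> cochain_group n \<Gamma> A"
abbreviation "cocycles n \<equiv> cocycle_group n \<Gamma> A act"
abbreviation "cobounds n \<equiv> coboundaries n \<Gamma> A act"
abbreviation "diff n \<equiv> differential n \<Gamma> A act"
abbreviation "cls n \<equiv> cohomology_class n \<Gamma> A act"

lemma act_one_right [simp]:
  assumes "g \<in> carrier \<Gamma>" shows "act g \<one>\<^bsub>A\<^esub> = \<one>\<^bsub>A\<^esub>"
proof -
  have "act g \<one>\<^bsub>A\<^esub> \<otimes>\<^bsub>A\<^esub> act g \<one>\<^bsub>A\<^esub> = act g \<one>\<^bsub>A\<^esub>"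
    using assms by (simp flip: act_mult)
  then show ?thesis
    using assms by simp
qed

lemma act_inv [simp]:
  assumes "g \<in> carrier \<Gamma>" "a \<in> carrier A" shows "act g (inv\<^bsub>A\<^esub> a) = inv\<^bsub>A\<^esub> act g a"
  using assms by (intro A.inv_equality [symmetric]) (simp_all flip: act_mult)

lemma act_frac:
  assumes "g \<in> carrier \<Gamma>" "a \<in> carrier A" "b \<in> carrier A"
  shows "act g (frac A a b) = frac A (act g a) (act g b)"
  using assms by (simp add: frac_def)

lemmas module_simps =
  A.frac_simps act_closed act_mult act_frac act_one_right \<Gamma>.m_closed

text \<open>
  The following explicit formulas reduce every later statement about differentials, which occur in
  degrees 0, 1 and 2 only, to equations between values.
\<close>
lemma differential_0:
  assumes "\<beta> \<in> carrier (cochains 0)" "g \<in> carrier \<Gamma>"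
  shows "diff 0 \<beta> [g] = act g (\<beta> []) \<otimes>\<^bsub>A\<^esub> inv\<^bsub>A\<^esub> (\<beta> [])"
  using assms cochain_closed [of \<beta> 0 \<Gamma> A "[]"] by (simp add: differential_def A.int_pow_neg)

lemma differential_1:
  assumes "\<beta> \<in> carrier (cochains 1)" "g \<in> carrier \<Gamma>" "h \<in> carrier \<Gamma>"
  shows "diff 1 \<beta> [g, h] =
    act g (\<beta> [h]) \<otimes>\<^bsub>A\<^esub> inv\<^bsub>A\<^esub> (\<beta> [g \<otimes>\<^bsub>\<Gamma>\<^esub> h]) \<otimes>\<^bsub>A\<^esub> \<beta> [g]"
proof -
  have "\<beta> [g \<otimes>\<^bsub>\<Gamma>\<^esub> h] \<in> carrier A" "\<beta> [g] \<in> carrier A"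
    using assms by (simp_all add: cochain_closed)
  then show ?thesis
    using assms by (simp add: differential_def merge_at_def A.int_pow_neg)
qed

lemma differential_2:
  assumes "\<beta> \<in> carrier (cochains 2)" "g \<in> carrier \<Gamma>" "h \<in> carrier \<Gamma>" "k \<in> carrier \<Gamma>"
  shows "diff 2 \<beta> [g, h, k] =
    act g (\<beta> [h, k]) \<otimes>\<^bsub>A\<^esub> inv\<^bsub>A\<^esub> (\<beta> [g \<otimes>\<^bsub>\<Gamma>\<^esub> h, k]) \<otimes>\<^bsub>A\<^esub> \<beta> [g, h \<otimes>\<^bsub>\<Gamma>\<^esub> k] \<otimes>\<^bsub>A\<^esub> inv\<^bsub>A\<^esub> (\<beta> [g, h])"
proof -
  have *: "\<beta> [g, h \<otimes>\<^bsub>\<Gamma>\<^esub> k] \<in> carrier A" "\<beta> [g \<otimes>\<^bsub>\<Gamma>\<^esub> h, k] \<in> carrier A" "\<beta> [g, h] \<in> carrier A"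
    "\<beta> [h, k] \<in> carrier A"
    using assms by (simp_all add: cochain_closed)
  have "{1..2} = {1, 2::nat}" by auto
  with * show ?thesis
    using assms by (simp add: differential_def merge_at_def A.int_pow_neg A.m_assoc)
qed

lemma differential_extensional: "diff n \<beta> \<in> extensional (tuples \<Gamma> (n + 1))"
  by (simp add: differential_def)

lemma differential_closed:
  assumes n: "n \<le> 2" and \<beta>: "\<beta> \<in> carrier (cochains n)"
  shows "diff n \<beta> \<in> carrier (cochains (n + 1))"
proof -
  consider "n = 0" | "n = 1" | "n = 2" using n by linarith
  then show ?thesis
  proof cases
    case 1
    then have "\<beta> [] \<in> carrier A" using \<beta> by (simp add: cochain_closed)
    then show ?thesis
      using \<beta> differential_extensional [of 0 \<beta>] by (simp add: 1 cochain1_iff differential_0)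
  next
    case 2
    \<comment> \<open>The second step treats the tuples with an entry 1: there the remaining terms cancel in pairs.\<close>
    then show ?thesis
      using \<beta> differential_extensional [of 1 \<beta>]
      by (auto simp: cochain2_iff differential_1 cochain_closed) (auto simp: cochain1_iff)
  next
    case 3
    then have \<beta>2: "\<beta> \<in> carrier (cochains 2)" using \<beta> by simp
    show ?thesis
      using differential_extensional [of 2 \<beta>] \<beta>2
      by (auto simp: 3 cochain_iff [where n = 3] ball_tuples differential_2 cochain_closed)
        (auto simp: cochain2_iff)
  qed
qed

lemma differential_mult:
  assumes n: "n \<le> 2" and \<beta>: "\<beta> \<in> carrier (cochains n)" "\<beta>' \<in> carrier (cochains n)"
  shows "diff n (\<beta> \<otimes>\<^bsub>cochains n\<^esub> \<beta>') =
    diff n \<beta> \<otimes>\<^bsub>cochains (n + 1)\<^esub> diff n \<beta>'"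
proof -
  interpret C: comm_group "cochains n"
    by (rule comm_group_cochain_group) (rule A.comm_group_axioms)
  interpret C': comm_group "cochains (n + 1)"
    by (rule comm_group_cochain_group) (rule A.comm_group_axioms)
  have prod: "\<beta> \<otimes>\<^bsub>cochains n\<^esub> \<beta>' \<in> carrier (cochains n)"
    using \<beta> by (rule C.m_closed)
  have cl: "\<beta> gs \<in> carrier A" "\<beta>' gs \<in> carrier A" if "gs \<in> tuples \<Gamma> n" for gs
    using \<beta> that by (auto intro: cochain_closed)
  show ?thesis
  proof (rule cochain_eqI)
    show "diff n (\<beta> \<otimes>\<^bsub>cochains n\<^esub> \<beta>') \<in> carrier (cochains (n + 1))"
      using n prod by (rule differential_closed)
    show "diff n \<beta> \<otimes>\<^bsub>cochains (n + 1)\<^esub> diff n \<beta>'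
        \<in> carrier (cochains (n + 1))"
      using n \<beta> by (intro C'.m_closed differential_closed)
    consider "n = 0" | "n = 1" | "n = 2" using n by linarith
    then show "\<forall>gs \<in> tuples \<Gamma> (n + 1). diff n (\<beta> \<otimes>\<^bsub>cochains n\<^esub> \<beta>') gs =
        (diff n \<beta> \<otimes>\<^bsub>cochains (n + 1)\<^esub> diff n \<beta>') gs"
    proof cases
      case 1
      note c = cl [unfolded 1]
      have "diff 0 (\<beta> \<otimes>\<^bsub>cochains 0\<^esub> \<beta>') [g] =
        diff 0 \<beta> [g] \<otimes>\<^bsub>A\<^esub> diff 0 \<beta>' [g]" if g: "g \<in> carrier \<Gamma>" for g
      proof -
        have "\<beta> [] \<in> carrier A" "\<beta>' [] \<in> carrier A"
          using c by simp_all
        then show ?thesis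
          unfolding differential_0 [OF prod [unfolded 1] g] differential_0 [OF \<beta>(1) [unfolded 1] g]
             differential_0 [OF \<beta>(2) [unfolded 1] g]
          using g by simp (simp only: module_simps)
      qed
      then show ?thesis by (simp add: 1 ball_tuples)
    next
      case 2
      note c = cl [unfolded 2]
      have "diff 1 (\<beta> \<otimes>\<^bsub>cochains 1\<^esub> \<beta>') [g, h] =
        diff 1 \<beta> [g, h] \<otimes>\<^bsub>A\<^esub> diff 1 \<beta>' [g, h]"
        if g: "g \<in> carrier \<Gamma>" "h \<in> carrier \<Gamma>" for g h
      proof -
        have "\<beta> [g] \<in> carrier A" "\<beta>' [g] \<in> carrier A" "\<beta> [h] \<in> carrier A" "\<beta>' [h] \<in> carrier A"
          "\<beta> [g \<otimes>\<^bsub>\<Gamma>\<^esub> h] \<in> carrier A" "\<beta>' [g \<otimes>\<^bsub>\<Gamma>\<^esub> h] \<in> carrier A"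
          using c g by simp_all
        then show ?thesis
          unfolding differential_1 [OF prod [unfolded 2] g] differential_1 [OF \<beta>(1) [unfolded 2] g]
             differential_1 [OF \<beta>(2) [unfolded 2] g]
          using g by simp (simp only: module_simps)
      qed
      then show ?thesis by (simp add: 2 ball_tuples)
    next
      case 3
      note c = cl [unfolded 3]
      have "diff 2 (\<beta> \<otimes>\<^bsub>cochains 2\<^esub> \<beta>') [g, h, k] =
        diff 2 \<beta> [g, h, k] \<otimes>\<^bsub>A\<^esub> diff 2 \<beta>' [g, h, k]"
        if g: "g \<in> carrier \<Gamma>" "h \<in> carrier \<Gamma>" "k \<in> carrier \<Gamma>" for g h k
      proof -
        have "\<beta> [h, k] \<in> carrier A" "\<beta>' [h, k] \<in> carrier A" "\<beta> [g, h] \<in> carrier A" "\<beta>' [g, h] \<in> carrier A"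
          "\<beta> [g \<otimes>\<^bsub>\<Gamma>\<^esub> h, k] \<in> carrier A" "\<beta>' [g \<otimes>\<^bsub>\<Gamma>\<^esub> h, k] \<in> carrier A"
          "\<beta> [g, h \<otimes>\<^bsub>\<Gamma>\<^esub> k] \<in> carrier A" "\<beta>' [g, h \<otimes>\<^bsub>\<Gamma>\<^esub> k] \<in> carrier A"
          using c g by simp_all
        then show ?thesis
          unfolding differential_2 [OF prod [unfolded 3] g] differential_2 [OF \<beta>(1) [unfolded 3] g]
             differential_2 [OF \<beta>(2) [unfolded 3] g]
          using g by simp (simp only: module_simps)
      qed
      then show ?thesis by (simp add: 3 ball_tuples)
    qed
  qed
qed

lemma differential_differential:
  assumes n: "n \<le> 1" and \<beta>: "\<beta> \<in> carrier (cochains n)"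
  shows "diff (n + 1) (diff n \<beta>) = \<one>\<^bsub>cochains (n + 2)\<^esub>"
proof (rule extensional_tuples_eqI)
  show "diff (n + 1) (diff n \<beta>) \<in> extensional (tuples \<Gamma> (n + 2))"
    using differential_extensional [of "n + 1"] by (simp add: add.assoc)
  have d: "diff n \<beta> \<in> carrier (cochains (n + 1))"
    using n \<beta> by (simp add: differential_closed)
  consider "n = 0" | "n = 1" using n by linarith
  then show "\<forall>gs\<in>tuples \<Gamma> (n + 2). diff (n + 1) (diff n \<beta>) gs =
       \<one>\<^bsub>cochains (n + 2)\<^esub> gs"
  proof cases
    case 1
    have "diff 1 (diff 0 \<beta>) [g, h] = \<one>\<^bsub>A\<^esub>"
      if g: "g \<in> carrier \<Gamma>" "h \<in> carrier \<Gamma>" for g h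
    proof -
      have "\<beta> [] \<in> carrier A" using \<beta> by (simp add: 1 cochain_closed)
      then show ?thesis
        using g \<beta> d by (simp add: 1 differential_0 differential_1 act_act) (simp only: module_simps)
    qed
    then show ?thesis by (simp add: 1 ball_tuples)
  next
    case 2
    have "diff 2 (diff 1 \<beta>) [g, h, k] = \<one>\<^bsub>A\<^esub>"
      if g: "g \<in> carrier \<Gamma>" "h \<in> carrier \<Gamma>" "k \<in> carrier \<Gamma>" for g h k
    proof -
      have "\<beta> [g] \<in> carrier A" "\<beta> [h] \<in> carrier A" "\<beta> [k] \<in> carrier A" "\<beta> [g \<otimes>\<^bsub>\<Gamma>\<^esub> h] \<in> carrier A"
        "\<beta> [h \<otimes>\<^bsub>\<Gamma>\<^esub> k] \<in> carrier A" "\<beta> [g \<otimes>\<^bsub>\<Gamma>\<^esub> (h \<otimes>\<^bsub>\<Gamma>\<^esub> k)] \<in> carrier A"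
        using \<beta> g by (simp_all add: 2 cochain_closed)
      then show ?thesis
        using g \<beta> d by (simp add: 2 differential_1 differential_2 act_act \<Gamma>.m_assoc) (simp only: module_simps)
    qed
    then show ?thesis by (simp add: 2 ball_tuples)
  qed
qed simp

lemma differential_hom:
  assumes "n \<le> 2"
  shows "diff n \<in> hom (cochains n) (cochains (n + 1))"
  using assms by (intro homI differential_closed differential_mult)

lemma comm_group_cochains: "comm_group (cochains n)"
  by (rule comm_group_cochain_group) (rule A.comm_group_axioms)

lemma differential_group_hom:
  assumes "n \<le> 2"
  shows "group_hom (cochains n) (cochains (n + 1)) (diff n)"
  using assms comm_group_cochains differential_hom
  by (intro group_hom.intro group_hom_axioms.intro) (auto simp: comm_group_def)

lemma subgroup_cocycles:
  assumes "n \<le> 2"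
  shows "subgroup (carrier (cocycles n)) (cochains n)"
  using group_hom.subgroup_kernel [OF differential_group_hom [OF assms]]
  by (simp add: cocycle_group_def)

lemma comm_group_cocycle_group:
  assumes "n \<le> 2"
  shows "comm_group (cocycles n)"
  using comm_group.comm_group_subgroup [OF comm_group_cochains subgroup_cocycles [OF assms]]
  by (simp add: cocycle_group_def)

lemma cocycle_iff:
  "\<beta> \<in> carrier (cocycles n) \<longleftrightarrow>
     \<beta> \<in> carrier (cochains n) \<and> (\<forall>gs \<in> tuples \<Gamma> (n + 1). diff n \<beta> gs = \<one>\<^bsub>A\<^esub>)"
  (is "?l \<longleftrightarrow> ?r")
proof
  assume ?r
  then have "diff n \<beta> = \<one>\<^bsub>cochains (n + 1)\<^esub>"
    using differential_extensional [of n \<beta>] by (auto intro: extensional_tuples_eqI)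
  with \<open>?r\<close> show ?l
    by (simp add: cocycle_group_def kernel_def)
qed (auto simp: cocycle_group_def kernel_def)

lemma cocycle_cochain:
  "\<beta> \<in> carrier (cocycles n) \<Longrightarrow> \<beta> \<in> carrier (cochains n)"
  by (simp add: cocycle_iff)

lemma cocycle1_iff:
  "\<beta> \<in> carrier (cocycles 1) \<longleftrightarrow>
     \<beta> \<in> carrier (cochains 1) \<and>
     (\<forall>g \<in> carrier \<Gamma>. \<forall>h \<in> carrier \<Gamma>. \<beta> [g \<otimes>\<^bsub>\<Gamma>\<^esub> h] = \<beta> [g] \<otimes>\<^bsub>A\<^esub> act g (\<beta> [h]))"
proof -
  have "diff 1 \<beta> [g, h] = \<one>\<^bsub>A\<^esub> \<longleftrightarrow> \<beta> [g \<otimes>\<^bsub>\<Gamma>\<^esub> h] = \<beta> [g] \<otimes>\<^bsub>A\<^esub> act g (\<beta> [h])"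
    if \<beta>: "\<beta> \<in> carrier (cochains 1)" and g: "g \<in> carrier \<Gamma>" "h \<in> carrier \<Gamma>" for g h
  proof -
    have *: "\<beta> [g] \<in> carrier A" "\<beta> [h] \<in> carrier A" "\<beta> [g \<otimes>\<^bsub>\<Gamma>\<^esub> h] \<in> carrier A" "act g (\<beta> [h]) \<in> carrier A"
      using \<beta> g by (simp_all add: cochain_closed)
    have "diff 1 \<beta> [g, h] = (\<beta> [g] \<otimes>\<^bsub>A\<^esub> act g (\<beta> [h])) \<otimes>\<^bsub>A\<^esub> inv\<^bsub>A\<^esub> \<beta> [g \<otimes>\<^bsub>\<Gamma>\<^esub> h]"
      unfolding differential_1 [OF that] using * by (simp only: module_simps)
    then show ?thesis
      using * by (metis A.inv_solve_right A.l_one A.m_closed A.one_closed)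
  qed
  then show ?thesis
    unfolding cocycle_iff by (auto simp: ball_tuples)
qed

lemma cocycle2_iff:
  "\<beta> \<in> carrier (cocycles 2) \<longleftrightarrow>
     \<beta> \<in> carrier (cochains 2) \<and>
     (\<forall>g \<in> carrier \<Gamma>. \<forall>h \<in> carrier \<Gamma>. \<forall>k \<in> carrier \<Gamma>.
       act g (\<beta> [h, k]) \<otimes>\<^bsub>A\<^esub> \<beta> [g, h \<otimes>\<^bsub>\<Gamma>\<^esub> k] = \<beta> [g \<otimes>\<^bsub>\<Gamma>\<^esub> h, k] \<otimes>\<^bsub>A\<^esub> \<beta> [g, h])"
proof -
  have "diff 2 \<beta> [g, h, k] = \<one>\<^bsub>A\<^esub> \<longleftrightarrow>
      act g (\<beta> [h, k]) \<otimes>\<^bsub>A\<^esub> \<beta> [g, h \<otimes>\<^bsub>\<Gamma>\<^esub> k] = \<beta> [g \<otimes>\<^bsub>\<Gamma>\<^esub> h, k] \<otimes>\<^bsub>A\<^esub> \<beta> [g, h]"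
    if \<beta>: "\<beta> \<in> carrier (cochains 2)" and g: "g \<in> carrier \<Gamma>" "h \<in> carrier \<Gamma>" "k \<in> carrier \<Gamma>"
    for g h k
  proof -
    have *: "\<beta> [h, k] \<in> carrier A" "\<beta> [g, h] \<in> carrier A" "\<beta> [g \<otimes>\<^bsub>\<Gamma>\<^esub> h, k] \<in> carrier A"
      "\<beta> [g, h \<otimes>\<^bsub>\<Gamma>\<^esub> k] \<in> carrier A" "act g (\<beta> [h, k]) \<in> carrier A"
      using \<beta> g by (simp_all add: cochain_closed)
    have "diff 2 \<beta> [g, h, k] =
      (act g (\<beta> [h, k]) \<otimes>\<^bsub>A\<^esub> \<beta> [g, h \<otimes>\<^bsub>\<Gamma>\<^esub> k]) \<otimes>\<^bsub>A\<^esub> inv\<^bsub>A\<^esub> (\<beta> [g \<otimes>\<^bsub>\<Gamma>\<^esub> h, k] \<otimes>\<^bsub>A\<^esub> \<beta> [g, h])"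
      unfolding differential_2 [OF that] using * by (simp only: module_simps)
    then show ?thesis
      using * by (metis A.inv_solve_right A.l_one A.m_closed A.one_closed)
  qed
  then show ?thesis
    unfolding cocycle_iff by (auto simp: ball_tuples)
qed

lemma coboundaries_subset:
  assumes "1 \<le> n" "n \<le> 2"
  shows "cobounds n \<subseteq> carrier (cocycles n)"
proof -
  obtain m where m: "n = m + 1" "m \<le> 1"
    using assms by (metis add_le_cancel_right le_add_diff_inverse2 one_add_one)
  show ?thesis
    using m differential_closed [of m] differential_differential [of m]
    by (auto simp: coboundaries_def cocycle_group_def kernel_def add.assoc)
qed

lemma subgroup_coboundaries:
  assumes "1 \<le> n" "n \<le> 2"
  shows "subgroup (cobounds n) (cocycles n)"
proof -
  obtain m where m: "n = m + 1" "m \<le> 2"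
    using assms by (metis add_leD1 le_add_diff_inverse2)
  interpret group_hom "cochains m" "cochains n" "diff m"
    using differential_group_hom [of m] m by simp
  have "subgroup (cobounds n) (cochains n)"
    using img_is_subgroup by (simp add: m coboundaries_def)
  then show ?thesis
    using group.subgroup_incl [OF _ _ subgroup_cocycles [of n] coboundaries_subset [of n]] assms
    by (simp add: cocycle_group_def)
qed

lemma comm_group_cohomology:
  assumes "1 \<le> n" "n \<le> 2"
  shows "comm_group (cohomology n \<Gamma> A act)"
  unfolding cohomology_def using assms
  by (intro comm_group.abelian_FactGroup comm_group_cocycle_group subgroup_coboundaries)

lemma carrier_cohomology:
  "carrier (cohomology n \<Gamma> A act) = cls n ` carrier (cocycles n)"
  by (simp add: cohomology_def cohomology_class_def [abs_def] carrier_FactGroup)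

lemma cohomology_one: "\<one>\<^bsub>cohomology n \<Gamma> A act\<^esub> = cobounds n"
  by (simp add: cohomology_def)

lemma cohomology_class_mult:
  assumes "1 \<le> n" "n \<le> 2"
    and "\<beta> \<in> carrier (cocycles n)" "\<beta>' \<in> carrier (cocycles n)"
  shows "cls n \<beta> \<otimes>\<^bsub>cohomology n \<Gamma> A act\<^esub> cls n \<beta>' =
    cls n (\<beta> \<otimes>\<^bsub>cocycles n\<^esub> \<beta>')"
proof -
  interpret normal "cobounds n" "cocycles n"
    using assms by (intro comm_group.subgroup_imp_normal comm_group_cocycle_group subgroup_coboundaries)
  show ?thesis
    unfolding cohomology_def cohomology_class_def mult_FactGroup using assms by (intro rcos_sum)
qed

text \<open>The coboundary stands on the left because a class is defined as a right coset.\<close>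
lemma cohomology_class_eq_iff:
  assumes n: "1 \<le> n" "n \<le> 2"
    and \<beta>: "\<beta> \<in> carrier (cocycles n)" "\<beta>' \<in> carrier (cocycles n)"
  shows "cls n \<beta> = cls n \<beta>' \<longleftrightarrow>
    (\<exists>\<sigma> \<in> cobounds n. \<beta>' = \<sigma> \<otimes>\<^bsub>cocycles n\<^esub> \<beta>)"
proof -
  interpret Z: comm_group "cocycles n" using n by (intro comm_group_cocycle_group)
  interpret B: subgroup "cobounds n" "cocycles n"
    using n by (intro subgroup_coboundaries)
  have "cls n \<beta> = cls n \<beta>' \<longleftrightarrow>
    \<beta>' \<in> cls n \<beta>"
    unfolding cohomology_class_def
    using \<beta> B.subgroup_axioms Z.repr_independence Z.rcos_self by metis
  then show ?thesis
    by (auto simp: cohomology_class_def r_coset_def)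
qed

lemma cohomology_class_eq_one_iff:
  assumes n: "1 \<le> n" "n \<le> 2" and \<beta>: "\<beta> \<in> carrier (cocycles n)"
  shows "cls n \<beta> = \<one>\<^bsub>cohomology n \<Gamma> A act\<^esub> \<longleftrightarrow> \<beta> \<in> cobounds n"
proof -
  interpret Z: comm_group "cocycles n" using n by (intro comm_group_cocycle_group)
  interpret B: subgroup "cobounds n" "cocycles n"
    using n by (intro subgroup_coboundaries)
  show ?thesis
    unfolding cohomology_one cohomology_class_def
    using \<beta> B.subgroup_axioms Z.coset_join1 Z.coset_join2 B.subset by blast
qed

lemma cohomology_class_self:
  assumes n: "1 \<le> n" "n \<le> 2" and \<beta>: "\<beta> \<in> carrier (cocycles n)"
  shows "\<beta> \<in> cls n \<beta>"
  unfolding cohomology_class_def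
  using assms by (intro group.rcos_self comm_group.axioms(2) comm_group_cocycle_group subgroup_coboundaries)

lemma coboundary1_iff:
  "\<beta> \<in> cobounds 1 \<longleftrightarrow>
     \<beta> \<in> extensional (tuples \<Gamma> 1) \<and>
     (\<exists>a \<in> carrier A. \<forall>g \<in> carrier \<Gamma>. \<beta> [g] = act g a \<otimes>\<^bsub>A\<^esub> inv\<^bsub>A\<^esub> a)" (is "?l \<longleftrightarrow> ?r")
proof
  assume ?l
  then obtain \<alpha> where "\<alpha> \<in> carrier (cochains 0)" "\<beta> = diff 0 \<alpha>"
    by (auto simp: coboundaries_def)
  then show ?r
    using differential_extensional [of 0 \<alpha>] cochain_closed [of \<alpha> 0 \<Gamma> A "[]"]
    by (auto simp: differential_0 intro!: bexI [of _ "\<alpha> []"])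
next
  assume ?r
  then obtain a where a: "a \<in> carrier A" "\<forall>g \<in> carrier \<Gamma>. \<beta> [g] = act g a \<otimes>\<^bsub>A\<^esub> inv\<^bsub>A\<^esub> a"
    and \<beta>: "\<beta> \<in> extensional (tuples \<Gamma> 1)" by auto
  define \<alpha> where "\<alpha> = (\<lambda>_ \<in> tuples \<Gamma> 0. a)"
  have \<alpha>: "\<alpha> \<in> carrier (cochains 0)"
    using a by (simp add: \<alpha>_def cochain_iff tuples_0)
  have "\<beta> = diff 0 \<alpha>"
    using \<beta> differential_extensional [of 0 \<alpha>] \<alpha> a
    by (intro extensional_tuples_eqI [of _ \<Gamma> 1]) (auto simp: ball_tuples differential_0 \<alpha>_def)
  with \<alpha> show ?l by (simp add: coboundaries_def)
qed

lemma coboundary2_iff: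
  "\<beta> \<in> cobounds 2 \<longleftrightarrow>
     (\<exists>\<gamma> \<in> carrier (cochains 1). \<beta> = diff 1 \<gamma>)"
  by (auto simp: coboundaries_def One_nat_def)

end

text \<open>Cocycles as a subgroup of the cochains, in the shape needed by the results on submodules below.\<close>
lemma cocycle_group_eq_submodule:
  "cocycle_group n \<Gamma> A act = cochain_group n \<Gamma> A\<lparr>carrier := carrier (cocycle_group n \<Gamma> A act)\<rparr>"
  by (simp add: cocycle_group_def)

section \<open>Maps induced on cohomology\<close>

text \<open>
  The classes of all \<open>F \<beta>'\<close> with \<open>\<beta>'\<close> cohomologous to \<open>\<beta>\<close> coincide, so their union is a
  single class.  The degrees may differ since the map \<open>\<tau>\<close> raises the degree by one.
\<close>
lemma class_map_cohomology_class:
  assumes "group_module \<Gamma> A act" "group_module \<Gamma>' A' act'"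
    and n: "1 \<le> n" "n \<le> 2" and n': "1 \<le> n'" "n' \<le> 2"
    and F: "F \<in> hom (cocycle_group n \<Gamma> A act) (cocycle_group n' \<Gamma>' A' act')"
    and FB: "\<And>\<sigma>. \<sigma> \<in> coboundaries n \<Gamma> A act \<Longrightarrow> F \<sigma> \<in> coboundaries n' \<Gamma>' A' act'"
    and \<beta>: "\<beta> \<in> carrier (cocycle_group n \<Gamma> A act)"
  shows "class_map n' \<Gamma>' A' act' F (cohomology_class n \<Gamma> A act \<beta>) = cohomology_class n' \<Gamma>' A' act' (F \<beta>)"
proof -
  interpret A: group_module \<Gamma> A act by fact
  interpret A': group_module \<Gamma>' A' act' by fact
  have "cohomology_class n' \<Gamma>' A' act' (F \<beta>') = cohomology_class n' \<Gamma>' A' act' (F \<beta>)"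
    if "\<beta>' \<in> cohomology_class n \<Gamma> A act \<beta>" for \<beta>'
  proof -
    from that obtain \<sigma> where \<sigma>: "\<sigma> \<in> coboundaries n \<Gamma> A act"
      and \<beta>': "\<beta>' = \<sigma> \<otimes>\<^bsub>cocycle_group n \<Gamma> A act\<^esub> \<beta>"
      by (auto simp: cohomology_class_def r_coset_def)
    have \<sigma>Z: "\<sigma> \<in> carrier (cocycle_group n \<Gamma> A act)"
      using \<sigma> A.coboundaries_subset n by blast
    have F\<beta>': "F \<beta>' = F \<sigma> \<otimes>\<^bsub>cocycle_group n' \<Gamma>' A' act'\<^esub> F \<beta>"
      unfolding \<beta>' by (rule hom_mult [OF F \<sigma>Z \<beta>])
    have "F \<sigma> \<in> carrier (cocycle_group n' \<Gamma>' A' act')" "F \<beta> \<in> carrier (cocycle_group n' \<Gamma>' A' act')"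
      using hom_in_carrier [OF F] \<sigma>Z \<beta> by blast+
    moreover from this have "F \<beta>' \<in> carrier (cocycle_group n' \<Gamma>' A' act')"
      unfolding F\<beta>' using A'.comm_group_cocycle_group [OF n'(2)]
      by (intro monoid.m_closed) (auto simp: comm_group_def group_def)
    ultimately show ?thesis
      using A'.cohomology_class_eq_iff [OF n', of "F \<beta>" "F \<beta>'"] FB [OF \<sigma>] F\<beta>' by auto
  qed
  moreover have "\<beta> \<in> cohomology_class n \<Gamma> A act \<beta>"
    using n \<beta> by (rule A.cohomology_class_self)
  ultimately show ?thesis
    unfolding class_map_def by blast
qed

lemma class_map_hom:
  assumes "group_module \<Gamma> A act" "group_module \<Gamma>' A' act'"
    and n: "1 \<le> n" "n \<le> 2" and n': "1 \<le> n'" "n' \<le> 2"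
    and F: "F \<in> hom (cocycle_group n \<Gamma> A act) (cocycle_group n' \<Gamma>' A' act')"
    and FB: "\<And>\<sigma>. \<sigma> \<in> coboundaries n \<Gamma> A act \<Longrightarrow> F \<sigma> \<in> coboundaries n' \<Gamma>' A' act'"
  shows "class_map n' \<Gamma>' A' act' F \<in> hom (cohomology n \<Gamma> A act) (cohomology n' \<Gamma>' A' act')"
proof -
  interpret A: group_module \<Gamma> A act by fact
  interpret A': group_module \<Gamma>' A' act' by fact
  interpret Z: comm_group "cocycle_group n \<Gamma> A act" using n by (intro A.comm_group_cocycle_group)
  have cl: "class_map n' \<Gamma>' A' act' F (cohomology_class n \<Gamma> A act \<beta>) = cohomology_class n' \<Gamma>' A' act' (F \<beta>)"
    if "\<beta> \<in> carrier (cocycle_group n \<Gamma> A act)" for \<beta>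
    using assms that by (rule class_map_cohomology_class)
  have FZ: "F \<beta> \<in> carrier (cocycle_group n' \<Gamma>' A' act')"
    if "\<beta> \<in> carrier (cocycle_group n \<Gamma> A act)" for \<beta>
    using hom_in_carrier [OF F that] .
  show ?thesis
  proof (rule homI)
    show "class_map n' \<Gamma>' A' act' F X \<in> carrier (cohomology n' \<Gamma>' A' act')"
      if "X \<in> carrier (cohomology n \<Gamma> A act)" for X
      using that by (auto simp: A.carrier_cohomology A'.carrier_cohomology cl FZ)
    show "class_map n' \<Gamma>' A' act' F (X \<otimes>\<^bsub>cohomology n \<Gamma> A act\<^esub> Y) =
      class_map n' \<Gamma>' A' act' F X \<otimes>\<^bsub>cohomology n' \<Gamma>' A' act'\<^esub> class_map n' \<Gamma>' A' act' F Y"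
      if XY: "X \<in> carrier (cohomology n \<Gamma> A act)" "Y \<in> carrier (cohomology n \<Gamma> A act)" for X Y
    proof -
      obtain \<beta> where X: "X = cohomology_class n \<Gamma> A act \<beta>" "\<beta> \<in> carrier (cocycle_group n \<Gamma> A act)"
        using XY(1) unfolding A.carrier_cohomology by (rule imageE)
      obtain \<beta>' where Y: "Y = cohomology_class n \<Gamma> A act \<beta>'" "\<beta>' \<in> carrier (cocycle_group n \<Gamma> A act)"
        using XY(2) unfolding A.carrier_cohomology by (rule imageE)
      note \<beta> = X(2) Y(2)
      show ?thesis
        unfolding X(1) Y(1) A.cohomology_class_mult [OF n \<beta>] cl [OF \<beta>(1)] cl [OF \<beta>(2)]
          cl [OF Z.m_closed [OF \<beta>]] A'.cohomology_class_mult [OF n' FZ [OF \<beta>(1)] FZ [OF \<beta>(2)]]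
          hom_mult [OF F \<beta>] ..
    qed
  qed
qed

text \<open>
  Restriction to a subgroup, a homomorphism of coefficients and conjugation by an element of \<open>T\<close> all
  commute with the differential, and all their effects on cohomology follow from this.  The bound 3 is
  the degree of the differential of a 2-cochain.
\<close>
locale cochain_map = dom: group_module \<Gamma> A act + cod: group_module \<Gamma>' A' act'
  for \<Gamma> :: "('g, 'x) monoid_scheme" and A :: "('a, 'y) monoid_scheme" and act
    and \<Gamma>' :: "('g2, 'x2) monoid_scheme" and A' :: "('a2, 'y2) monoid_scheme" and act' +
  fixes F :: "nat \<Rightarrow> ('g list \<Rightarrow> 'a) \<Rightarrow> 'g2 list \<Rightarrow> 'a2"
  assumes map_hom: "k \<le> 3 \<Longrightarrow> F k \<in> hom (cochain_group k \<Gamma> A) (cochain_group k \<Gamma>' A')"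
    and map_differential: "k \<le> 2 \<Longrightarrow> \<beta> \<in> carrier (cochain_group k \<Gamma> A) \<Longrightarrow>
      differential k \<Gamma>' A' act' (F k \<beta>) = F (k + 1) (differential k \<Gamma> A act \<beta>)"
begin

lemma map_cochain:
  "k \<le> 3 \<Longrightarrow> \<beta> \<in> carrier (cochain_group k \<Gamma> A) \<Longrightarrow> F k \<beta> \<in> carrier (cochain_group k \<Gamma>' A')"
  using hom_in_carrier [OF map_hom] .

lemma map_cocycle:
  assumes n: "n \<le> 2" and \<beta>: "\<beta> \<in> carrier (cocycle_group n \<Gamma> A act)"
  shows "F n \<beta> \<in> carrier (cocycle_group n \<Gamma>' A' act')"
proof -
  have "F (n + 1) \<one>\<^bsub>cochain_group (n + 1) \<Gamma> A\<^esub> = \<one>\<^bsub>cochain_group (n + 1) \<Gamma>' A'\<^esub>"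
    using n dom.comm_group_cochains cod.comm_group_cochains
    by (intro hom_one [OF map_hom]) (auto simp: comm_group_def)
  then show ?thesis
    using n \<beta> map_differential [of n \<beta>] map_cochain [of n \<beta>] by (simp add: cocycle_group_def kernel_def)
qed

lemma map_cocycle_hom:
  assumes n: "n \<le> 2"
  shows "F n \<in> hom (cocycle_group n \<Gamma> A act) (cocycle_group n \<Gamma>' A' act')"
proof (rule homI)
  show "F n \<beta> \<in> carrier (cocycle_group n \<Gamma>' A' act')" if "\<beta> \<in> carrier (cocycle_group n \<Gamma> A act)" for \<beta>
    using n that by (rule map_cocycle)
  show "F n (\<beta> \<otimes>\<^bsub>cocycle_group n \<Gamma> A act\<^esub> \<beta>') = F n \<beta> \<otimes>\<^bsub>cocycle_group n \<Gamma>' A' act'\<^esub> F n \<beta>'"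
    if "\<beta> \<in> carrier (cocycle_group n \<Gamma> A act)" "\<beta>' \<in> carrier (cocycle_group n \<Gamma> A act)" for \<beta> \<beta>'
    using hom_mult [OF map_hom, of n \<beta> \<beta>'] n that by (simp add: dom.cocycle_cochain)
qed

lemma map_coboundary:
  assumes n: "1 \<le> n" "n \<le> 2" and \<sigma>: "\<sigma> \<in> coboundaries n \<Gamma> A act"
  shows "F n \<sigma> \<in> coboundaries n \<Gamma>' A' act'"
proof -
  obtain m where m: "n = m + 1" "m \<le> 2"
    using n by (metis add_leD1 le_add_diff_inverse2)
  with \<sigma> obtain \<alpha> where "\<alpha> \<in> carrier (cochain_group m \<Gamma> A)" "\<sigma> = differential m \<Gamma> A act \<alpha>"
    by (auto simp: coboundaries_def)
  with m show ?thesis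
    by (auto simp: coboundaries_def map_cochain map_differential [symmetric])
qed

lemma class_map_eq:
  assumes "1 \<le> n" "n \<le> 2" "\<beta> \<in> carrier (cocycle_group n \<Gamma> A act)"
  shows "class_map n \<Gamma>' A' act' (F n) (cohomology_class n \<Gamma> A act \<beta>) = cohomology_class n \<Gamma>' A' act' (F n \<beta>)"
  using assms map_cocycle_hom map_coboundary dom.group_module_axioms cod.group_module_axioms
  by (intro class_map_cohomology_class) auto

lemma class_map_in_hom:
  assumes "1 \<le> n" "n \<le> 2"
  shows "class_map n \<Gamma>' A' act' (F n) \<in> hom (cohomology n \<Gamma> A act) (cohomology n \<Gamma>' A' act')"
  using assms map_cocycle_hom map_coboundary dom.group_module_axioms cod.group_module_axioms
  by (intro class_map_hom) auto

end

text \<open>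
  Characterizes the differential by its three explicit formulas, so that a proof of compatibility with
  differentials needs no case distinction on the degree.
\<close>
lemma differential_eqI:
  assumes A: "group_module \<Gamma> A act" and n: "n \<le> 2" and \<beta>: "\<beta> \<in> carrier (cochain_group n \<Gamma> A)"
    and ext: "\<delta> \<in> extensional (tuples \<Gamma> (n + 1))"
    and 0: "\<And>g. n = 0 \<Longrightarrow> g \<in> carrier \<Gamma> \<Longrightarrow> \<delta> [g] = act g (\<beta> []) \<otimes>\<^bsub>A\<^esub> inv\<^bsub>A\<^esub> (\<beta> [])"
    and 1: "\<And>g h. n = 1 \<Longrightarrow> g \<in> carrier \<Gamma> \<Longrightarrow> h \<in> carrier \<Gamma> \<Longrightarrow>
      \<delta> [g, h] = act g (\<beta> [h]) \<otimes>\<^bsub>A\<^esub> inv\<^bsub>A\<^esub> (\<beta> [g \<otimes>\<^bsub>\<Gamma>\<^esub> h]) \<otimes>\<^bsub>A\<^esub> \<beta> [g]"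
    and 2: "\<And>g h k. n = 2 \<Longrightarrow> g \<in> carrier \<Gamma> \<Longrightarrow> h \<in> carrier \<Gamma> \<Longrightarrow> k \<in> carrier \<Gamma> \<Longrightarrow>
      \<delta> [g, h, k] = act g (\<beta> [h, k]) \<otimes>\<^bsub>A\<^esub> inv\<^bsub>A\<^esub> (\<beta> [g \<otimes>\<^bsub>\<Gamma>\<^esub> h, k]) \<otimes>\<^bsub>A\<^esub>
        \<beta> [g, h \<otimes>\<^bsub>\<Gamma>\<^esub> k] \<otimes>\<^bsub>A\<^esub> inv\<^bsub>A\<^esub> (\<beta> [g, h])"
  shows "differential n \<Gamma> A act \<beta> = \<delta>"
proof (rule extensional_tuples_eqI)
  interpret group_module \<Gamma> A act by fact
  show "differential n \<Gamma> A act \<beta> \<in> extensional (tuples \<Gamma> (n + 1))" "\<delta> \<in> extensional (tuples \<Gamma> (n + 1))"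
    by (rule differential_extensional) (rule ext)
  consider "n = 0" | "n = 1" | "n = 2" using n by linarith
  then show "\<forall>gs\<in>tuples \<Gamma> (n + 1). differential n \<Gamma> A act \<beta> gs = \<delta> gs"
    using \<beta> 0 1 2
    by cases (simp_all add: ball_tuples differential_0 differential_1 differential_2)
qed

context group_module
begin

lemma restrict_group:
  assumes "subgroup H \<Gamma>"
  shows "group_module (\<Gamma>\<lparr>carrier := H\<rparr>) A act"
proof -
  interpret H: subgroup H \<Gamma> by fact
  interpret H': group "\<Gamma>\<lparr>carrier := H\<rparr>" by (rule H.subgroup_is_group) (rule \<Gamma>.is_group)
  show ?thesis
    by unfold_locales (auto simp: act_act)
qed

lemma restriction_cochain_map:
  assumes H: "subgroup H \<Gamma>"
  shows "cochain_map \<Gamma> A act (\<Gamma>\<lparr>carrier := H\<rparr>) A act (\<lambda>k \<beta>. restrict \<beta> (tuples (\<Gamma>\<lparr>carrier := H\<rparr>) k))"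
proof -
  interpret H: group_module "\<Gamma>\<lparr>carrier := H\<rparr>" A act using H by (rule restrict_group)
  have sub: "tuples (\<Gamma>\<lparr>carrier := H\<rparr>) k \<subseteq> tuples \<Gamma> k" for k
    using subgroup.subset [OF H] by (auto simp: tuples_def)
  have cl: "restrict \<beta> (tuples (\<Gamma>\<lparr>carrier := H\<rparr>) k) \<in> carrier (cochain_group k (\<Gamma>\<lparr>carrier := H\<rparr>) A)"
    if "\<beta> \<in> carrier (cochains k)" for \<beta> k
    using that sub [of k] by (auto simp: cochain_iff)
  show ?thesis
  proof unfold_locales
    show "(\<lambda>\<beta>. restrict \<beta> (tuples (\<Gamma>\<lparr>carrier := H\<rparr>) k)) \<in>
        hom (cochains k) (cochain_group k (\<Gamma>\<lparr>carrier := H\<rparr>) A)" if "k \<le> 3" for k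
      using sub [of k] by (intro homI cl ext) (simp_all add: restrict_def subset_iff)
    show "differential k (\<Gamma>\<lparr>carrier := H\<rparr>) A act (restrict \<beta> (tuples (\<Gamma>\<lparr>carrier := H\<rparr>) k)) =
        restrict (diff k \<beta>) (tuples (\<Gamma>\<lparr>carrier := H\<rparr>) (k + 1))"
      if k: "k \<le> 2" and \<beta>: "\<beta> \<in> carrier (cochains k)" for k \<beta>
      using H.group_module_axioms k cl [OF \<beta>] subgroup.subset [OF H] \<beta> subgroup.m_closed [OF H]
      by (intro differential_eqI)
        (simp_all add: subset_iff differential_0 differential_1 differential_2)
  qed
qed

lemma submodule:
  assumes B: "subgroup B A" and stable: "\<And>g b. g \<in> carrier \<Gamma> \<Longrightarrow> b \<in> B \<Longrightarrow> act g b \<in> B"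
  shows "group_module \<Gamma> (A\<lparr>carrier := B\<rparr>) act"
proof -
  interpret B: comm_group "A\<lparr>carrier := B\<rparr>" using B by (rule A.comm_group_subgroup)
  show ?thesis
    using subgroup.mem_carrier [OF B] stable by unfold_locales (simp_all add: act_act)
qed

lemma submodule_cochain:
  assumes B: "subgroup B A"
    and \<beta>: "\<beta> \<in> carrier (cochain_group n \<Gamma> (A\<lparr>carrier := B\<rparr>))"
  shows "\<beta> \<in> carrier (cochains n)"
  using \<beta> subgroup.subset [OF B] by (auto simp: cochain_iff)

text \<open>
  The product and the inverses in a subgroup of \<open>A\<close> are those of \<open>A\<close>.  This lets
  cochains with values in \<open>Der(N, M)\<close> be treated as cochains with values in \<open>C\<^sup>1(N, M)\<close>.
\<close>
lemma submodule_differential: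
  assumes B: "subgroup B A" and stable: "\<And>g b. g \<in> carrier \<Gamma> \<Longrightarrow> b \<in> B \<Longrightarrow> act g b \<in> B"
    and n: "n \<le> 2" and \<beta>: "\<beta> \<in> carrier (cochain_group n \<Gamma> (A\<lparr>carrier := B\<rparr>))"
  shows "differential n \<Gamma> (A\<lparr>carrier := B\<rparr>) act \<beta> = diff n \<beta>"
proof -
  have \<beta>A: "\<beta> \<in> carrier (cochains n)"
    using B \<beta> by (rule submodule_cochain)
  have "\<beta> gs \<in> B" if "gs \<in> tuples \<Gamma> n" for gs
    using cochain_closed [OF \<beta> that] by simp
  then have "inv\<^bsub>A\<lparr>carrier := B\<rparr>\<^esub> \<beta> gs = inv\<^bsub>A\<^esub> \<beta> gs" if "gs \<in> tuples \<Gamma> n" for gs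
    using that A.m_inv_consistent [OF B] by blast
  then show ?thesis
    using n \<beta> \<beta>A differential_extensional [of n \<beta>]
    by (intro differential_eqI submodule [OF B stable])
      (simp_all add: differential_0 differential_1 differential_2)
qed

end

lemma coefficient_cochain_map:
  assumes A: "group_module \<Gamma> A act" and A': "group_module \<Gamma> A' act'"
    and f: "f \<in> hom A A'" and eq: "\<And>g a. g \<in> carrier \<Gamma> \<Longrightarrow> a \<in> carrier A \<Longrightarrow> f (act g a) = act' g (f a)"
  shows "cochain_map \<Gamma> A act \<Gamma> A' act' (\<lambda>k \<beta>. compose (tuples \<Gamma> k) f \<beta>)"
proof -
  interpret A: group_module \<Gamma> A act by fact
  interpret A': group_module \<Gamma> A' act' by fact
  interpret f: group_hom A A' f
    using f by (intro group_hom.intro group_hom_axioms.intro) auto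
  have cl: "compose (tuples \<Gamma> k) f \<beta> \<in> carrier (cochain_group k \<Gamma> A')"
    if "\<beta> \<in> carrier (cochain_group k \<Gamma> A)" for \<beta> k
    using that by (auto simp: cochain_iff compose_def)
  show ?thesis
  proof unfold_locales
    show "compose (tuples \<Gamma> k) f \<in> hom (cochain_group k \<Gamma> A) (cochain_group k \<Gamma> A')" if "k \<le> 3" for k
      by (intro homI cl) (auto simp: compose_def cochain_closed intro!: restrict_ext)
    show "differential k \<Gamma> A' act' (compose (tuples \<Gamma> k) f \<beta>) =
        compose (tuples \<Gamma> (k + 1)) f (differential k \<Gamma> A act \<beta>)"
      if k: "k \<le> 2" and \<beta>: "\<beta> \<in> carrier (cochain_group k \<Gamma> A)" for k \<beta>
    proof -
      have "\<beta> gs \<in> carrier A" if "gs \<in> tuples \<Gamma> k" for gs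
        using \<beta> that by (rule cochain_closed)
      then show ?thesis
        using A' k cl [OF \<beta>] \<beta>
        by (intro differential_eqI)
          (simp_all add: compose_def A.differential_0 A.differential_1 A.differential_2 eq)
    qed
  qed
qed

section \<open>Semidirect products\<close>

lemma set_mult_decompose:
  assumes "g \<in> H <#>\<^bsub>G\<^esub> K"
  obtains h k where "h \<in> H" "k \<in> K" "g = h \<otimes>\<^bsub>G\<^esub> k"
  using assms by (auto simp: set_mult_def)

locale semidirect_module = group_module G M act
  for G :: "('g, 'x) monoid_scheme" (structure) and M :: "('a, 'y) monoid_scheme" and act +
  fixes N T :: "'g set"
  assumes N_normal: "N \<lhd> G" and T_subgroup: "subgroup T G"
    and generate: "N <#>\<^bsub>G\<^esub> T = carrier G" and disjoint: "N \<inter> T = {\<one>}"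
begin

abbreviation "NG \<equiv> G\<lparr>carrier := N\<rparr>"
abbreviation "TG \<equiv> G\<lparr>carrier := T\<rparr>"

text \<open>
  The letters \<open>N\<close> and \<open>T\<close> in the following names refer to the groups on which cochains are defined.
  \<open>K1\<close> and \<open>K2\<close> contain the cochains on \<open>T\<close> with values in \<open>C\<^sup>1(N, M)\<close>, among them \<open>\<gamma>\<close> and
  \<open>\<partial>\<^sub>T\<gamma>\<close>.  \<open>P1\<close> and \<open>P2\<close> apply \<open>\<partial>\<^sup>0\<^sub>N\<close> to the values of a cochain on \<open>T\<close>.
\<close>
abbreviation "C1N \<equiv> cochain_group 1 NG M"
abbreviation "C2N \<equiv> cochain_group 2 NG M"
abbreviation "Z2N \<equiv> cocycle_group 2 NG M act"
abbreviation "DerN \<equiv> cocycle_group 1 NG M act"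
abbreviation "conj1 \<equiv> conj_act 1 G N act"
abbreviation "conj2 \<equiv> conj_act 2 G N act"
abbreviation "dN \<equiv> differential 1 NG M act"
abbreviation "K1 \<equiv> cochain_group 1 TG C1N"
abbreviation "K2 \<equiv> cochain_group 2 TG C1N"
abbreviation "dT \<equiv> differential 1 TG C1N conj1"
abbreviation "P1 \<equiv> compose (tuples TG 1) (principal_der NG M act)"
abbreviation "P2 \<equiv> compose (tuples TG 2) (principal_der NG M act)"
abbreviation "Z2T \<equiv> cocycle_group 2 TG M act"
abbreviation "Z1TD \<equiv> cocycle_group 1 TG DerN conj1"
abbreviation "Z2TD \<equiv> cocycle_group 2 TG DerN conj1"
abbreviation "H2G \<equiv> cohomology 2 G M act"
abbreviation "H2NT \<equiv> invariant_cohomology 2 G N T M act"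
abbreviation "H2T \<equiv> cohomology 2 TG M act"
abbreviation "H1TD \<equiv> cohomology 1 TG DerN conj1"
abbreviation "H2TD \<equiv> cohomology 2 TG DerN conj1"
abbreviation "clsN \<equiv> cohomology_class 2 NG M act"
abbreviation "clsT \<equiv> cohomology_class 2 TG M act"
abbreviation "cls1TD \<equiv> cohomology_class 1 TG DerN conj1"
abbreviation "clsTD \<equiv> cohomology_class 2 TG DerN conj1"

text \<open>
  Conjugation is kept as a constant: rewriting with its algebraic rules retains the information that a
  conjugate of an element of \<open>N\<close> lies in \<open>N\<close>, which multiplying out destroys.
\<close>
definition cj :: "'g \<Rightarrow> 'g \<Rightarrow> 'g"
  where "cj g n = g \<otimes> n \<otimes> inv g"

lemma N_subgroup: "subgroup N G"
  using N_normal by (rule normal_imp_subgroup)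

lemma N_mem [simp]: "n \<in> N \<Longrightarrow> n \<in> carrier G"
  using N_subgroup by (rule subgroup.mem_carrier)

lemma T_mem [simp]: "t \<in> T \<Longrightarrow> t \<in> carrier G"
  using T_subgroup by (rule subgroup.mem_carrier)

lemmas NT_closed [simp] =
  subgroup.m_closed [OF N_subgroup] subgroup.m_closed [OF T_subgroup]
  subgroup.m_inv_closed [OF N_subgroup] subgroup.m_inv_closed [OF T_subgroup]
  subgroup.one_closed [OF N_subgroup] subgroup.one_closed [OF T_subgroup]

lemmas sd_simps = module_simps N_mem T_mem NT_closed(1,2)

lemma cj_N [simp]: "g \<in> carrier G \<Longrightarrow> n \<in> N \<Longrightarrow> cj g n \<in> N"
  unfolding cj_def by (rule normal.inv_op_closed2 [OF N_normal])

lemma cj_mult [simp]: "g \<in> carrier G \<Longrightarrow> n \<in> N \<Longrightarrow> n' \<in> N \<Longrightarrow>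
    cj g (n \<otimes> n') = cj g n \<otimes> cj g n'"
  by (simp add: cj_def \<Gamma>.word_simps)

lemma cj_cj: "g \<in> carrier G \<Longrightarrow> h \<in> carrier G \<Longrightarrow> n \<in> N \<Longrightarrow> cj g (cj h n) = cj (g \<otimes> h) n"
  by (simp add: cj_def \<Gamma>.word_simps)

lemma cj_inv [simp]:
  "g \<in> carrier G \<Longrightarrow> n \<in> N \<Longrightarrow> cj (inv g) (cj g n) = n"
  "g \<in> carrier G \<Longrightarrow> n \<in> N \<Longrightarrow> cj g (cj (inv g) n) = n"
  by (simp_all add: cj_def \<Gamma>.word_simps)

lemma cj_one [simp]: "g \<in> carrier G \<Longrightarrow> cj g \<one> = \<one>" "n \<in> N \<Longrightarrow> cj \<one> n = n"
  by (simp_all add: cj_def)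

lemma move_past: "g \<in> carrier G \<Longrightarrow> n \<in> N \<Longrightarrow> g \<otimes> n = cj g n \<otimes> g"
  by (simp add: cj_def \<Gamma>.word_simps)

lemma semidirect_mult:
  assumes "n \<in> N" "t \<in> T" "n' \<in> N" "t' \<in> T"
  shows "(n \<otimes> t) \<otimes> (n' \<otimes> t') = (n \<otimes> cj t n') \<otimes> (t \<otimes> t')"
  using assms by (simp add: cj_def \<Gamma>.word_simps)

lemma factors_unique:
  assumes "n \<in> N" "t \<in> T" "n' \<in> N" "t' \<in> T" and eq: "n \<otimes> t = n' \<otimes> t'"
  shows "n = n'" "t = t'"
proof -
  have "inv n' \<otimes> n = inv n' \<otimes> (n \<otimes> t) \<otimes> inv t"
    using assms(1-4) by (simp add: \<Gamma>.word_simps)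
  also have "\<dots> = t' \<otimes> inv t"
    unfolding eq using assms(1-4) by (simp add: \<Gamma>.word_simps)
  finally have e: "inv n' \<otimes> n = t' \<otimes> inv t" .
  moreover have "inv n' \<otimes> n \<in> N" "t' \<otimes> inv t \<in> T"
    using assms(1-4) by simp_all
  ultimately have "inv n' \<otimes> n = \<one>" "t' \<otimes> inv t = \<one>"
    using disjoint by auto
  then show "n = n'" "t = t'"
    using assms(1-4) \<Gamma>.inv_solve_left \<Gamma>.inv_solve_right by (metis N_mem \<Gamma>.one_closed \<Gamma>.r_one, metis T_mem \<Gamma>.one_closed \<Gamma>.l_one)
qed

lemma ball_semidirect: "(\<forall>g \<in> carrier G. P g) \<longleftrightarrow> (\<forall>n \<in> N. \<forall>t \<in> T. P (n \<otimes> t))"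
proof
  assume r: "\<forall>n \<in> N. \<forall>t \<in> T. P (n \<otimes> t)"
  show "\<forall>g \<in> carrier G. P g"
    unfolding generate [symmetric] using r by (auto elim!: set_mult_decompose)
qed simp

definition npart :: "'g \<Rightarrow> 'g" where "npart g = (THE n. n \<in> N \<and> (\<exists>t \<in> T. g = n \<otimes> t))"
definition tpart :: "'g \<Rightarrow> 'g" where "tpart g = (THE t. t \<in> T \<and> (\<exists>n \<in> N. g = n \<otimes> t))"

lemma npart_tpart [simp]:
  assumes "n \<in> N" "t \<in> T" shows "npart (n \<otimes> t) = n" "tpart (n \<otimes> t) = t"
  unfolding npart_def tpart_def using assms factors_unique by (auto intro!: the_equality)

lemma parts_N [simp]: "n \<in> N \<Longrightarrow> npart n = n" "n \<in> N \<Longrightarrow> tpart n = \<one>"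
  using npart_tpart [of n "\<one>"] by simp_all

lemma parts_T [simp]: "t \<in> T \<Longrightarrow> npart t = \<one>" "t \<in> T \<Longrightarrow> tpart t = t"
  using npart_tpart [of "\<one>" t] by simp_all

definition cochain1 :: "('g \<Rightarrow> 'g \<Rightarrow> 'a) \<Rightarrow> 'g list \<Rightarrow> 'a"
  where "cochain1 f = (\<lambda>gs \<in> tuples G 1. f (npart (hd gs)) (tpart (hd gs)))"

lemma cochain1_apply [simp]: "n \<in> N \<Longrightarrow> t \<in> T \<Longrightarrow> cochain1 f [n \<otimes> t] = f n t"
  by (simp add: cochain1_def)

lemma cochain1_apply_N [simp]: "n \<in> N \<Longrightarrow> cochain1 f [n] = f n \<one>"
  by (simp add: cochain1_def)

lemma cochain1_apply_T [simp]: "t \<in> T \<Longrightarrow> cochain1 f [t] = f \<one> t"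
  by (simp add: cochain1_def)

lemma cochain1_cochain:
  assumes "\<And>n t. n \<in> N \<Longrightarrow> t \<in> T \<Longrightarrow> f n t \<in> carrier M" "f \<one> \<one> = \<one>\<^bsub>M\<^esub>"
  shows "cochain1 f \<in> carrier (cochains 1)"
proof -
  have "cochain1 f \<in> extensional (tuples G 1)" by (simp add: cochain1_def)
  then show ?thesis
    using assms by (simp add: cochain1_iff ball_semidirect)
qed

section \<open>The normal form of 2-cocycles\<close>

text \<open>The cocycle of formula (3).  For \<open>b = 0\<close> and \<open>c = 0\<close> it is the cocycle \<open>\<beta>\<^sub>d\<close> with \<open>d = \<gamma>\<close>.\<close>
definition glue :: "('g list \<Rightarrow> 'a) \<Rightarrow> ('g list \<Rightarrow> 'g list \<Rightarrow> 'a) \<Rightarrow> ('g list \<Rightarrow> 'a) \<Rightarrow> 'g list \<Rightarrow> 'a"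
  where "glue b \<gamma> c = (\<lambda>gs \<in> tuples G 2.
    let n = npart (gs ! 0); t = tpart (gs ! 0); p = cj t (npart (gs ! 1)); t' = tpart (gs ! 1)
    in act n (\<gamma> [t] [p]) \<otimes>\<^bsub>M\<^esub> act (n \<otimes> p) (c [t, t']) \<otimes>\<^bsub>M\<^esub> b [n, p])"

lemma glue_apply:
  assumes "n \<in> N" "t \<in> T" "n' \<in> N" "t' \<in> T"
  shows "glue b \<gamma> c [n \<otimes> t, n' \<otimes> t'] =
    act n (\<gamma> [t] [cj t n']) \<otimes>\<^bsub>M\<^esub> act (n \<otimes> cj t n') (c [t, t']) \<otimes>\<^bsub>M\<^esub> b [n, cj t n']"
  using assms by (simp add: glue_def Let_def)

lemma glue_extensional: "glue b \<gamma> c \<in> extensional (tuples G 2)"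
  by (simp add: glue_def)

lemma cochain_T_cochain_N_iff:
  "\<gamma> \<in> carrier K1 \<longleftrightarrow>
     \<gamma> \<in> extensional (tuples TG 1) \<and>
     (\<forall>t \<in> T. \<gamma> [t] \<in> extensional (tuples NG 1) \<and> \<gamma> [t] [\<one>] = \<one>\<^bsub>M\<^esub> \<and>
        (\<forall>n \<in> N. \<gamma> [t] [n] \<in> carrier M)) \<and>
     (\<forall>n \<in> N. \<gamma> [\<one>] [n] = \<one>\<^bsub>M\<^esub>)"
proof -
  have "\<delta> = (\<lambda>gs\<in>tuples NG 1. \<one>\<^bsub>M\<^esub>) \<longleftrightarrow> (\<forall>n \<in> N. \<delta> [n] = \<one>\<^bsub>M\<^esub>)"
    if "\<delta> \<in> extensional (tuples NG 1)" for \<delta>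
  proof
    assume "\<forall>n\<in>N. \<delta> [n] = \<one>\<^bsub>M\<^esub>"
    with that show "\<delta> = (\<lambda>gs\<in>tuples NG 1. \<one>\<^bsub>M\<^esub>)"
      by (intro extensional_tuples_eqI [of _ NG 1]) (simp_all add: ball_tuples)
  qed simp
  then show ?thesis
    by (auto simp: cochain1_iff)
qed

text \<open>
  Conditions (1) and (2), multiplied out to avoid inverses and evaluated at conjugates \<open>\<^sup>tn\<close> so that
  no \<open>t\<^sup>-\<^sup>1\<close> appears.
\<close>
definition gluing_data :: "('g list \<Rightarrow> 'a) \<Rightarrow> ('g list \<Rightarrow> 'g list \<Rightarrow> 'a) \<Rightarrow> ('g list \<Rightarrow> 'a) \<Rightarrow> bool"
  where "gluing_data b \<gamma> c \<longleftrightarrow>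
    (\<forall>t \<in> T. \<forall>n \<in> N. \<forall>n' \<in> N.
       act t (b [n, n']) \<otimes>\<^bsub>M\<^esub> \<gamma> [t] [cj t n \<otimes> cj t n'] =
       b [cj t n, cj t n'] \<otimes>\<^bsub>M\<^esub> \<gamma> [t] [cj t n] \<otimes>\<^bsub>M\<^esub> act (cj t n) (\<gamma> [t] [cj t n'])) \<and>
    (\<forall>t \<in> T. \<forall>t' \<in> T. \<forall>n \<in> N.
       act t (\<gamma> [t'] [n]) \<otimes>\<^bsub>M\<^esub> \<gamma> [t] [cj t n] \<otimes>\<^bsub>M\<^esub> act (cj t n) (c [t, t']) =
       \<gamma> [t \<otimes> t'] [cj t n] \<otimes>\<^bsub>M\<^esub> c [t, t'])"

lemma glue_cochain:
  assumes b: "b \<in> carrier C2N" and c: "c \<in> carrier (cochain_group 2 TG M)"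
    and \<gamma>: "\<gamma> \<in> carrier K1"
  shows "glue b \<gamma> c \<in> carrier (cochains 2)"
proof -
  note v = b [unfolded cochain2_iff] c [unfolded cochain2_iff] \<gamma> [unfolded cochain_T_cochain_N_iff]
  have closed: "glue b \<gamma> c [g, h] \<in> carrier M" if "g \<in> carrier G" "h \<in> carrier G" for g h
  proof -
    have "\<forall>g \<in> carrier G. \<forall>h \<in> carrier G. glue b \<gamma> c [g, h] \<in> carrier M"
      unfolding ball_semidirect using v by (simp add: glue_apply)
    with that show ?thesis by blast
  qed
  have "\<forall>g \<in> carrier G. glue b \<gamma> c [\<one>, g] = \<one>\<^bsub>M\<^esub> \<and> glue b \<gamma> c [g, \<one>] = \<one>\<^bsub>M\<^esub>"
    unfolding ball_semidirect
  proof (intro ballI)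
    fix n t assume "n \<in> N" "t \<in> T"
    then show "glue b \<gamma> c [\<one>, n \<otimes> t] = \<one>\<^bsub>M\<^esub> \<and> glue b \<gamma> c [n \<otimes> t, \<one>] = \<one>\<^bsub>M\<^esub>"
      using v glue_apply [of "\<one>" "\<one>" n t b \<gamma> c] glue_apply [of n t "\<one>" "\<one>" b \<gamma> c] by simp
  qed
  with closed glue_extensional show ?thesis
    by (simp add: cochain2_iff)
qed

text \<open>
  In the cocycle identity for (3), conditions (1) and (2) eliminate \<open>t\<^sub>1 b\<close> and \<open>t\<^sub>1 \<gamma>\<^sub>t\<^sub>2\<close>, and the
  cocycle identities of \<open>c\<close> and \<open>b\<close> eliminate \<open>t\<^sub>1 c(t\<^sub>2, t\<^sub>3)\<close> and \<open>n\<^sub>1 b\<close>; everything then cancels.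
\<close>
lemma glue_cocycle:
  assumes b: "b \<in> carrier Z2N" and c: "c \<in> carrier Z2T"
    and \<gamma>: "\<gamma> \<in> carrier K1" and tw: "gluing_data b \<gamma> c"
  shows "glue b \<gamma> c \<in> carrier (cocycles 2)"
proof -
  interpret N: group_module NG M act using N_subgroup by (rule restrict_group)
  interpret T: group_module TG M act using T_subgroup by (rule restrict_group)
  have bC: "b [n, n'] \<in> carrier M" if "n \<in> N" "n' \<in> N" for n n'
    using b that by (simp add: N.cocycle2_iff cochain2_iff)
  have cC: "c [t, t'] \<in> carrier M" if "t \<in> T" "t' \<in> T" for t t'
    using c that by (simp add: T.cocycle2_iff cochain2_iff)
  have \<gamma>C: "\<gamma> [t] [n] \<in> carrier M" if "t \<in> T" "n \<in> N" for t n
    using \<gamma> that by (simp add: cochain_T_cochain_N_iff)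
  have "\<forall>g1\<in>carrier G. \<forall>g2\<in>carrier G. \<forall>g3\<in>carrier G.
      act g1 (glue b \<gamma> c [g2, g3]) \<otimes>\<^bsub>M\<^esub> glue b \<gamma> c [g1, g2 \<otimes> g3] =
      glue b \<gamma> c [g1 \<otimes> g2, g3] \<otimes>\<^bsub>M\<^esub> glue b \<gamma> c [g1, g2]"
    unfolding ball_semidirect
  proof (intro ballI)
    fix n1 t1 n2 t2 n3 t3
    assume nt: "n1 \<in> N" "t1 \<in> T" "n2 \<in> N" "t2 \<in> T" "n3 \<in> N" "t3 \<in> T"
    \<comment> \<open>The elements of \<open>N\<close> obtained by moving \<open>t1\<close> and \<open>t2\<close> to the right past \<open>n2\<close> and \<open>n3\<close>.\<close>
    define p2 q3 p3 where "p2 = cj t1 n2" and "q3 = cj t2 n3" and "p3 = cj t1 q3"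
    have pq: "p2 \<in> N" "q3 \<in> N" "p3 \<in> N" "cj (t1 \<otimes> t2) n3 = p3"
      using nt by (simp_all add: p2_def q3_def p3_def cj_cj)
    have b_eq: "act t1 (b [n2, q3]) = b [p2, p3] \<otimes>\<^bsub>M\<^esub> \<gamma> [t1] [p2] \<otimes>\<^bsub>M\<^esub> act p2 (\<gamma> [t1] [p3])
        \<otimes>\<^bsub>M\<^esub> inv\<^bsub>M\<^esub> \<gamma> [t1] [p2 \<otimes> p3]"
    proof -
      have "act t1 (b [n2, q3]) \<otimes>\<^bsub>M\<^esub> \<gamma> [t1] [p2 \<otimes> p3] =
        b [p2, p3] \<otimes>\<^bsub>M\<^esub> \<gamma> [t1] [p2] \<otimes>\<^bsub>M\<^esub> act p2 (\<gamma> [t1] [p3])"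
        using tw nt pq unfolding gluing_data_def p2_def p3_def by blast
      then show ?thesis
        using nt pq bC \<gamma>C by (subst A.inv_solve_right) simp_all
    qed
    have \<gamma>_eq: "act t1 (\<gamma> [t2] [q3]) = \<gamma> [t1 \<otimes> t2] [p3] \<otimes>\<^bsub>M\<^esub> c [t1, t2] \<otimes>\<^bsub>M\<^esub>
        inv\<^bsub>M\<^esub> (\<gamma> [t1] [p3] \<otimes>\<^bsub>M\<^esub> act p3 (c [t1, t2]))"
    proof -
      have "act t1 (\<gamma> [t2] [q3]) \<otimes>\<^bsub>M\<^esub> \<gamma> [t1] [p3] \<otimes>\<^bsub>M\<^esub> act p3 (c [t1, t2]) =
        \<gamma> [t1 \<otimes> t2] [p3] \<otimes>\<^bsub>M\<^esub> c [t1, t2]"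
        using tw nt pq unfolding gluing_data_def p3_def by blast
      then show ?thesis
        using nt pq cC \<gamma>C by (subst A.inv_solve_right) (simp_all add: A.m_assoc)
    qed
    have c_eq: "act t1 (c [t2, t3]) = c [t1 \<otimes> t2, t3] \<otimes>\<^bsub>M\<^esub> c [t1, t2] \<otimes>\<^bsub>M\<^esub> inv\<^bsub>M\<^esub> c [t1, t2 \<otimes> t3]"
      using c nt cC by (subst A.inv_solve_right) (simp_all add: T.cocycle2_iff)
    have bb_eq: "act n1 (b [p2, p3]) = b [n1 \<otimes> p2, p3] \<otimes>\<^bsub>M\<^esub> b [n1, p2] \<otimes>\<^bsub>M\<^esub> inv\<^bsub>M\<^esub> b [n1, p2 \<otimes> p3]"
      using b nt pq bC by (subst A.inv_solve_right) (simp_all add: N.cocycle2_iff)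
    have v: "n1 \<in> N" "t1 \<in> T" "p2 \<in> N" "p3 \<in> N" "q3 \<in> N" "n2 \<in> N"
      "b [n2, q3] \<in> carrier M" "b [p2, p3] \<in> carrier M" "b [n1 \<otimes> p2, p3] \<in> carrier M" "b [n1, p2] \<in> carrier M"
      "b [n1, p2 \<otimes> p3] \<in> carrier M" "\<gamma> [t1] [p2] \<in> carrier M" "\<gamma> [t1] [p3] \<in> carrier M"
      "\<gamma> [t2] [q3] \<in> carrier M" "\<gamma> [t1] [p2 \<otimes> p3] \<in> carrier M" "\<gamma> [t1 \<otimes> t2] [p3] \<in> carrier M"
      "c [t1, t2] \<in> carrier M" "c [t2, t3] \<in> carrier M" "c [t1 \<otimes> t2, t3] \<in> carrier M"
      "c [t1, t2 \<otimes> t3] \<in> carrier M"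
      using nt pq bC cC \<gamma>C by simp_all
    have m: "n2 \<otimes> q3 \<in> N" "n1 \<otimes> p2 \<in> N" "t2 \<otimes> t3 \<in> T" "t1 \<otimes> t2 \<in> T"
      "cj t1 (n2 \<otimes> q3) = p2 \<otimes> p3" "n1 \<otimes> (p2 \<otimes> p3) = n1 \<otimes> p2 \<otimes> p3"
      using nt pq(1-3) by (simp_all add: p2_def p3_def \<Gamma>.m_assoc)
    note g = semidirect_mult [OF nt(1-4), folded p2_def] semidirect_mult [OF nt(3-6), folded q3_def]
      glue_apply [OF nt(3-6), folded q3_def] glue_apply [OF nt(1-4), folded p2_def]
      glue_apply [OF nt(1,2) m(1,3), unfolded m(5,6)] glue_apply [OF m(2,4) nt(5,6), unfolded pq(4)]
    have acts: "act (n1 \<otimes> t1) (act n2 (\<gamma> [t2] [q3]) \<otimes>\<^bsub>M\<^esub> act (n2 \<otimes> q3) (c [t2, t3]) \<otimes>\<^bsub>M\<^esub> b [n2, q3]) =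
        act (n1 \<otimes> p2) (act t1 (\<gamma> [t2] [q3])) \<otimes>\<^bsub>M\<^esub> act (n1 \<otimes> p2 \<otimes> p3) (act t1 (c [t2, t3]))
          \<otimes>\<^bsub>M\<^esub> act n1 (act t1 (b [n2, q3]))"
      using nt pq(2) v by (simp add: act_act p2_def p3_def cj_def \<Gamma>.word_simps)
    have move: "act n1 (act p2 (\<gamma> [t1] [p3])) = act (n1 \<otimes> p2) (\<gamma> [t1] [p3])"
      "act (n1 \<otimes> p2) (act p3 (c [t1, t2])) = act (n1 \<otimes> p2 \<otimes> p3) (c [t1, t2])"
      using v by (simp_all add: act_act)
    show "act (n1 \<otimes> t1) (glue b \<gamma> c [n2 \<otimes> t2, n3 \<otimes> t3]) \<otimes>\<^bsub>M\<^esub>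
        glue b \<gamma> c [n1 \<otimes> t1, n2 \<otimes> t2 \<otimes> (n3 \<otimes> t3)] =
        glue b \<gamma> c [n1 \<otimes> t1 \<otimes> (n2 \<otimes> t2), n3 \<otimes> t3] \<otimes>\<^bsub>M\<^esub>
        glue b \<gamma> c [n1 \<otimes> t1, n2 \<otimes> t2]"
      unfolding g acts using v by (simp only: sd_simps b_eq \<gamma>_eq c_eq bb_eq move)
  qed
  then show ?thesis
    using b c \<gamma> by (simp add: cocycle2_iff glue_cochain N.cocycle_cochain T.cocycle_cochain)
qed

definition transgress :: "('g list \<Rightarrow> 'a) \<Rightarrow> 'g list \<Rightarrow> 'g list \<Rightarrow> 'a"
  where "transgress \<beta> = (\<lambda>ts \<in> tuples TG 1. \<lambda>ns \<in> tuples NG 1.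
    \<beta> [hd ts, cj (inv hd ts) (hd ns)] \<otimes>\<^bsub>M\<^esub> inv\<^bsub>M\<^esub> \<beta> [hd ns, hd ts])"

lemma transgress_apply:
  assumes "t \<in> T" "n \<in> N"
  shows "transgress \<beta> [t] [n] = \<beta> [t, cj (inv t) n] \<otimes>\<^bsub>M\<^esub> inv\<^bsub>M\<^esub> \<beta> [n, t]"
  using assms by (simp add: transgress_def)

lemma transgress_cochain:
  assumes "\<beta> \<in> carrier (cochains 2)"
  shows "transgress \<beta> \<in> carrier K1"
proof -
  have "transgress \<beta> \<in> extensional (tuples TG 1)" "\<forall>t\<in>T. transgress \<beta> [t] \<in> extensional (tuples NG 1)"
    by (simp_all add: transgress_def)
  then show ?thesis
    using assms by (simp add: cochain_T_cochain_N_iff transgress_apply cochain2_iff)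
qed

text \<open>
  Each of (1) and (2) is a combination of three instances of the cocycle identity, at
  \<open>(t, n, n')\<close>, \<open>(p, t, n')\<close>, \<open>(p, p', t)\<close> and at \<open>(t, t', m)\<close>, \<open>(t, n, t')\<close>, \<open>(p, t, t')\<close>
  respectively, where \<open>p = \<^sup>tn\<close>, \<open>p' = \<^sup>tn'\<close> and \<open>\<^sup>t'm = n\<close>.
\<close>
lemma cocycle_gluing_data:
  assumes \<beta>: "\<beta> \<in> carrier (cocycles 2)"
  shows "gluing_data (restrict \<beta> (tuples NG 2)) (transgress \<beta>) (restrict \<beta> (tuples TG 2))"
proof -
  have cl: "\<beta> [g, h] \<in> carrier M" if "g \<in> carrier G" "h \<in> carrier G" for g h
    using \<beta> that by (simp add: cocycle2_iff cochain2_iff)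
  have solve: "act g (\<beta> [h, k]) = \<beta> [g \<otimes> h, k] \<otimes>\<^bsub>M\<^esub> \<beta> [g, h] \<otimes>\<^bsub>M\<^esub> inv\<^bsub>M\<^esub> \<beta> [g, h \<otimes> k]"
    if "g \<in> carrier G" "h \<in> carrier G" "k \<in> carrier G" for g h k
    using \<beta> that cl by (subst A.inv_solve_right) (simp_all add: cocycle2_iff)
  have 1: "act t (\<beta> [n, n']) \<otimes>\<^bsub>M\<^esub> transgress \<beta> [t] [cj t n \<otimes> cj t n'] =
      \<beta> [cj t n, cj t n'] \<otimes>\<^bsub>M\<^esub> transgress \<beta> [t] [cj t n] \<otimes>\<^bsub>M\<^esub> act (cj t n) (transgress \<beta> [t] [cj t n'])"
    if t: "t \<in> T" and n: "n \<in> N" "n' \<in> N" for t n n'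
  proof -
    define p p' where "p = cj t n" and "p' = cj t n'"
    have p: "p \<in> N" "p' \<in> N" "t \<otimes> n = p \<otimes> t" "t \<otimes> n' = p' \<otimes> t"
      using t n by (simp_all add: p_def p'_def move_past [of t])
    have tr: "transgress \<beta> [t] [p] = \<beta> [t, n] \<otimes>\<^bsub>M\<^esub> inv\<^bsub>M\<^esub> \<beta> [p, t]"
      "transgress \<beta> [t] [p'] = \<beta> [t, n'] \<otimes>\<^bsub>M\<^esub> inv\<^bsub>M\<^esub> \<beta> [p', t]"
      "transgress \<beta> [t] [p \<otimes> p'] = \<beta> [t, n \<otimes> n'] \<otimes>\<^bsub>M\<^esub> inv\<^bsub>M\<^esub> \<beta> [p \<otimes> p', t]"
      using t n by (simp_all add: transgress_apply p_def p'_def)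
    have eqs: "act t (\<beta> [n, n']) = \<beta> [p \<otimes> t, n'] \<otimes>\<^bsub>M\<^esub> \<beta> [t, n] \<otimes>\<^bsub>M\<^esub> inv\<^bsub>M\<^esub> \<beta> [t, n \<otimes> n']"
      "act p (\<beta> [t, n']) = \<beta> [p \<otimes> t, n'] \<otimes>\<^bsub>M\<^esub> \<beta> [p, t] \<otimes>\<^bsub>M\<^esub> inv\<^bsub>M\<^esub> \<beta> [p, p' \<otimes> t]"
      "act p (\<beta> [p', t]) = \<beta> [p \<otimes> p', t] \<otimes>\<^bsub>M\<^esub> \<beta> [p, p'] \<otimes>\<^bsub>M\<^esub> inv\<^bsub>M\<^esub> \<beta> [p, p' \<otimes> t]"
      using t n p by (simp_all add: solve)
    have v: "p \<in> N" "t \<in> T" "\<beta> [n, n'] \<in> carrier M" "\<beta> [t, n'] \<in> carrier M" "\<beta> [p', t] \<in> carrier M"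
      "\<beta> [p \<otimes> t, n'] \<in> carrier M" "\<beta> [t, n] \<in> carrier M" "\<beta> [t, n \<otimes> n'] \<in> carrier M" "\<beta> [p, t] \<in> carrier M"
      "\<beta> [p, p' \<otimes> t] \<in> carrier M" "\<beta> [p \<otimes> p', t] \<in> carrier M" "\<beta> [p, p'] \<in> carrier M"
      using t n p(1,2) cl by simp_all
    show ?thesis
      unfolding p_def [symmetric] p'_def [symmetric] tr using v by (simp only: sd_simps eqs)
  qed
  have 2: "act t (transgress \<beta> [t'] [n]) \<otimes>\<^bsub>M\<^esub> transgress \<beta> [t] [cj t n] \<otimes>\<^bsub>M\<^esub> act (cj t n) (\<beta> [t, t']) =
      transgress \<beta> [t \<otimes> t'] [cj t n] \<otimes>\<^bsub>M\<^esub> \<beta> [t, t']"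
    if t: "t \<in> T" "t' \<in> T" and n: "n \<in> N" for t t' n
  proof -
    define p m where "p = cj t n" and "m = cj (inv t') n"
    have p: "p \<in> N" "m \<in> N" "t \<otimes> n = p \<otimes> t" "t' \<otimes> m = n \<otimes> t'"
      "cj (inv (t \<otimes> t')) p = m"
      using t n move_past [of t' m] move_past [of t n] by (simp_all add: p_def m_def cj_cj \<Gamma>.inv_mult_group \<Gamma>.m_assoc move_past [of t] move_past [of t'])
    have tr: "transgress \<beta> [t'] [n] = \<beta> [t', m] \<otimes>\<^bsub>M\<^esub> inv\<^bsub>M\<^esub> \<beta> [n, t']"
      "transgress \<beta> [t] [p] = \<beta> [t, n] \<otimes>\<^bsub>M\<^esub> inv\<^bsub>M\<^esub> \<beta> [p, t]"
      "transgress \<beta> [t \<otimes> t'] [p] = \<beta> [t \<otimes> t', m] \<otimes>\<^bsub>M\<^esub> inv\<^bsub>M\<^esub> \<beta> [p, t \<otimes> t']"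
      using t n p by (simp_all add: transgress_apply) (simp_all add: p_def m_def)
    have eqs: "act t (\<beta> [t', m]) = \<beta> [t \<otimes> t', m] \<otimes>\<^bsub>M\<^esub> \<beta> [t, t'] \<otimes>\<^bsub>M\<^esub> inv\<^bsub>M\<^esub> \<beta> [t, n \<otimes> t']"
      "act t (\<beta> [n, t']) = \<beta> [p \<otimes> t, t'] \<otimes>\<^bsub>M\<^esub> \<beta> [t, n] \<otimes>\<^bsub>M\<^esub> inv\<^bsub>M\<^esub> \<beta> [t, n \<otimes> t']"
      "act p (\<beta> [t, t']) = \<beta> [p \<otimes> t, t'] \<otimes>\<^bsub>M\<^esub> \<beta> [p, t] \<otimes>\<^bsub>M\<^esub> inv\<^bsub>M\<^esub> \<beta> [p, t \<otimes> t']"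
      using t n p by (simp_all add: solve)
    have v: "p \<in> N" "t \<in> T" "\<beta> [t', m] \<in> carrier M" "\<beta> [n, t'] \<in> carrier M" "\<beta> [t, t'] \<in> carrier M"
      "\<beta> [t \<otimes> t', m] \<in> carrier M" "\<beta> [t, n \<otimes> t'] \<in> carrier M" "\<beta> [p \<otimes> t, t'] \<in> carrier M"
      "\<beta> [t, n] \<in> carrier M" "\<beta> [p, t] \<in> carrier M" "\<beta> [p, t \<otimes> t'] \<in> carrier M"
      using t n p(1,2) cl by simp_all
    show ?thesis
      unfolding p_def [symmetric] tr using v by (simp only: sd_simps eqs)
  qed
  show ?thesis
    unfolding gluing_data_def using 1 2 by simp
qed

text \<open>
  The cocycle identity at \<open>(n, t, g)\<close> reduces the first argument to \<open>t\<close>, those at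
  \<open>(t, n', t')\<close> and \<open>(p, t, t')\<close> separate the second argument, and the one at \<open>(n, p, tt')\<close>
  removes \<open>T\<close> from the remaining term on \<open>N \<times> G\<close>.
\<close>
lemma cocycle_vanishing_on_N_T:
  assumes \<beta>: "\<beta> \<in> carrier (cocycles 2)"
    and vanish: "\<And>n t. n \<in> N \<Longrightarrow> t \<in> T \<Longrightarrow> \<beta> [n, t] = \<one>\<^bsub>M\<^esub>"
  shows "\<beta> = glue \<beta> (transgress \<beta>) \<beta>"
proof -
  have cl: "\<beta> [g, h] \<in> carrier M" if "g \<in> carrier G" "h \<in> carrier G" for g h
    using \<beta> that by (simp add: cocycle2_iff cochain2_iff)
  have coc: "act g (\<beta> [h, k]) \<otimes>\<^bsub>M\<^esub> \<beta> [g, h \<otimes> k] = \<beta> [g \<otimes> h, k] \<otimes>\<^bsub>M\<^esub> \<beta> [g, h]"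
    if "g \<in> carrier G" "h \<in> carrier G" "k \<in> carrier G" for g h k
    using \<beta> that by (simp add: cocycle2_iff)
  have "\<forall>g \<in> carrier G. \<forall>h \<in> carrier G. \<beta> [g, h] = glue \<beta> (transgress \<beta>) \<beta> [g, h]"
    unfolding ball_semidirect
  proof (intro ballI)
    fix n t n' t' assume nt: "n \<in> N" "t \<in> T" "n' \<in> N" "t' \<in> T"
    define p where "p = cj t n'"
    have p: "p \<in> N" "t \<otimes> n' = p \<otimes> t" "t \<otimes> (n' \<otimes> t') = p \<otimes> (t \<otimes> t')"
      using nt by (simp add: p_def, simp_all add: p_def cj_def \<Gamma>.word_simps)
    have "act n (\<beta> [t, n' \<otimes> t']) \<otimes>\<^bsub>M\<^esub> \<beta> [n, p \<otimes> (t \<otimes> t')] = \<beta> [n \<otimes> t, n' \<otimes> t']"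
      using coc [of n t "n' \<otimes> t'"] nt cl p vanish by simp
    moreover have "\<beta> [n, p \<otimes> (t \<otimes> t')] = \<beta> [n, p]"
      using coc [of n p "t \<otimes> t'"] nt cl p vanish by simp
    moreover have "\<beta> [t, n' \<otimes> t'] = \<beta> [p \<otimes> t, t'] \<otimes>\<^bsub>M\<^esub> \<beta> [t, n']"
      using coc [of t n' t'] nt cl p vanish by simp
    moreover have "act p (\<beta> [t, t']) = \<beta> [p \<otimes> t, t']"
      using coc [of p t t'] nt cl p vanish by simp
    moreover have "transgress \<beta> [t] [p] = \<beta> [t, n']"
      using nt cl vanish by (simp add: transgress_apply p_def)
    ultimately have "\<beta> [n \<otimes> t, n' \<otimes> t'] =
        act n (act p (\<beta> [t, t']) \<otimes>\<^bsub>M\<^esub> transgress \<beta> [t] [p]) \<otimes>\<^bsub>M\<^esub> \<beta> [n, p]"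
      by simp
    also have "\<dots> = glue \<beta> (transgress \<beta>) \<beta> [n \<otimes> t, n' \<otimes> t']"
      using nt p(1) cl unfolding glue_apply [OF nt] p_def [symmetric]
      by (simp add: \<open>transgress \<beta> [t] [p] = \<beta> [t, n']\<close> act_act A.m_ac)
    finally show "\<beta> [n \<otimes> t, n' \<otimes> t'] = glue \<beta> (transgress \<beta>) \<beta> [n \<otimes> t, n' \<otimes> t']" .
  qed
  then show ?thesis
    using \<beta> glue_extensional
    by (intro extensional_tuples_eqI [of _ G 2]) (simp_all add: ball_tuples cocycle2_iff cochain2_iff)
qed

lemma glue_cong:
  assumes "\<And>n n'. n \<in> N \<Longrightarrow> n' \<in> N \<Longrightarrow> b [n, n'] = b' [n, n']"
    and "\<And>t n. t \<in> T \<Longrightarrow> n \<in> N \<Longrightarrow> \<gamma> [t] [n] = \<gamma>' [t] [n]"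
    and "\<And>t t'. t \<in> T \<Longrightarrow> t' \<in> T \<Longrightarrow> c [t, t'] = c' [t, t']"
  shows "glue b \<gamma> c = glue b' \<gamma>' c'"
proof (rule extensional_tuples_eqI [OF glue_extensional glue_extensional])
  show "\<forall>gs\<in>tuples G 2. glue b \<gamma> c gs = glue b' \<gamma>' c' gs"
    unfolding ball_tuples ball_semidirect using assms by (simp add: glue_apply)
qed

text \<open>
  Adding the coboundary of \<open>h(nt) = \<beta>(n, t)\<close> makes \<open>\<beta>\<close> vanish on \<open>N \<times> T\<close>.  As \<open>h\<close> vanishes on \<open>N\<close> and on
  \<open>T\<close>, it changes neither restriction, and it does not change \<open>\<gamma>\<close> since \<open>t (t\<^sup>-\<^sup>1nt) = n t\<close>.
\<close>
lemma cocycle_cohomologous_to_glue: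
  assumes \<beta>: "\<beta> \<in> carrier (cocycles 2)"
  shows "\<exists>\<sigma> \<in> cobounds 2.
    glue (restrict \<beta> (tuples NG 2)) (transgress \<beta>) (restrict \<beta> (tuples TG 2)) =
    \<sigma> \<otimes>\<^bsub>cocycles 2\<^esub> \<beta>"
proof -
  interpret Z: comm_group "cocycles 2" by (rule comm_group_cocycle_group) simp
  have cl: "\<beta> [g, h] \<in> carrier M" if "g \<in> carrier G" "h \<in> carrier G" for g h
    using \<beta> that by (simp add: cocycle2_iff cochain2_iff)
  have nm: "\<beta> [\<one>, g] = \<one>\<^bsub>M\<^esub>" "\<beta> [g, \<one>] = \<one>\<^bsub>M\<^esub>" if "g \<in> carrier G" for g
    using \<beta> that by (simp_all add: cocycle2_iff cochain2_iff)
  define h where "h = cochain1 (\<lambda>n t. \<beta> [n, t])"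
  define \<sigma> where "\<sigma> = diff 1 h"
  define \<beta>' where "\<beta>' = \<sigma> \<otimes>\<^bsub>cocycles 2\<^esub> \<beta>"
  have h: "h \<in> carrier (cochains 1)"
    unfolding h_def using cl nm by (intro cochain1_cochain) auto
  have \<sigma>B: "\<sigma> \<in> cobounds 2"
    using h by (auto simp: \<sigma>_def coboundary2_iff)
  then have \<sigma>: "\<sigma> \<in> carrier (cocycles 2)"
    using coboundaries_subset [of 2] by auto
  have \<beta>'Z: "\<beta>' \<in> carrier (cocycles 2)"
    unfolding \<beta>'_def using \<sigma> \<beta> by (rule Z.m_closed)
  have \<beta>'_apply: "\<beta>' [g, g'] = \<sigma> [g, g'] \<otimes>\<^bsub>M\<^esub> \<beta> [g, g']" if "g \<in> carrier G" "g' \<in> carrier G" for g g'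
    using that by (simp add: \<beta>'_def)
  have hN: "h [n] = \<one>\<^bsub>M\<^esub>" if "n \<in> N" for n
    using that nm by (simp add: h_def)
  have hT: "h [t] = \<one>\<^bsub>M\<^esub>" if "t \<in> T" for t
    using that nm by (simp add: h_def)
  have hNT: "h [n \<otimes> t] = \<beta> [n, t]" if "n \<in> N" "t \<in> T" for n t
    using that by (simp add: h_def)
  have \<sigma>_apply: "\<sigma> [g, g'] = act g (h [g']) \<otimes>\<^bsub>M\<^esub> inv\<^bsub>M\<^esub> (h [g \<otimes> g']) \<otimes>\<^bsub>M\<^esub> h [g]"
    if "g \<in> carrier G" "g' \<in> carrier G" for g g'
    unfolding \<sigma>_def using h that by (rule differential_1)
  have NN: "\<beta>' [n, n'] = \<beta> [n, n']" if "n \<in> N" "n' \<in> N" for n n'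
    using that cl by (simp add: \<beta>'_apply \<sigma>_apply hN)
  have TT: "\<beta>' [t, t'] = \<beta> [t, t']" if "t \<in> T" "t' \<in> T" for t t'
    using that cl by (simp add: \<beta>'_apply \<sigma>_apply hT)
  have NT: "\<beta>' [n, t] = \<one>\<^bsub>M\<^esub>" if "n \<in> N" "t \<in> T" for n t
    using that cl by (simp add: \<beta>'_apply \<sigma>_apply hT hN hNT)
  have TN: "transgress \<beta>' [t] [n] = transgress \<beta> [t] [n]" if "t \<in> T" "n \<in> N" for t n
    using that cl NT move_past [of t "cj (inv t) n"] by (simp add: \<beta>'_apply \<sigma>_apply hT hN hNT transgress_apply A.m_comm)
  have "glue (restrict \<beta> (tuples NG 2)) (transgress \<beta>) (restrict \<beta> (tuples TG 2)) =
      glue \<beta>' (transgress \<beta>') \<beta>'"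
    by (rule glue_cong) (simp_all add: NN TT TN)
  also have "\<dots> = \<beta>'"
    using cocycle_vanishing_on_N_T [OF \<beta>'Z NT] by simp
  finally show ?thesis
    using \<sigma>B unfolding \<beta>'_def by blast
qed

lemma restrict_glue:
  assumes b: "b \<in> carrier C2N" and c: "c \<in> carrier (cochain_group 2 TG M)"
    and \<gamma>: "\<gamma> \<in> carrier K1"
  shows "restrict (glue b \<gamma> c) (tuples NG 2) = b" "restrict (glue b \<gamma> c) (tuples TG 2) = c"
proof -
  note v = b [unfolded cochain2_iff] c [unfolded cochain2_iff] \<gamma> [unfolded cochain_T_cochain_N_iff]
  have "glue b \<gamma> c [n, n'] = b [n, n']" if "n \<in> N" "n' \<in> N" for n n'
    using glue_apply [of n "\<one>" n' "\<one>" b \<gamma> c] that v by simp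
  then show "restrict (glue b \<gamma> c) (tuples NG 2) = b"
    using v by (intro extensional_tuples_eqI [of _ NG 2]) (simp_all add: ball_tuples)
  have "glue b \<gamma> c [t, t'] = c [t, t']" if "t \<in> T" "t' \<in> T" for t t'
    using glue_apply [of "\<one>" t "\<one>" t' b \<gamma> c] that v by simp
  then show "restrict (glue b \<gamma> c) (tuples TG 2) = c"
    using v by (intro extensional_tuples_eqI [of _ TG 2]) (simp_all add: ball_tuples)
qed

section \<open>The action of T on the cochains of N\<close>

lemma N_module: "group_module NG M act" using N_subgroup by (rule restrict_group)
lemma T_module: "group_module TG M act" using T_subgroup by (rule restrict_group)

interpretation N: group_module NG M act by (rule N_module)
interpretation T: group_module TG M act by (rule T_module)

lemma map_cj_tuples [simp]:
  assumes "g \<in> carrier G" "ns \<in> tuples NG k" shows "map (cj g) ns \<in> tuples NG k"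
  using assms by (auto simp: tuples_def)

lemma map_cj_map_cj:
  assumes "g \<in> carrier G" "h \<in> carrier G" "ns \<in> tuples NG k"
  shows "map (cj g) (map (cj h) ns) = map (cj (g \<otimes> h)) ns"
  using assms by (auto simp: tuples_def cj_cj)

lemma map_cj_one: "ns \<in> tuples NG k \<Longrightarrow> map (cj \<one>) ns = ns"
  by (auto simp: tuples_def intro!: map_idI)

lemma conj_act_apply:
  assumes "t \<in> T" "ns \<in> tuples NG k"
  shows "conj_act k G N act t \<beta> ns = act t (\<beta> (map (cj (inv t)) ns))"
  using assms by (simp add: conj_act_def cj_def [abs_def])

lemma conj_act_extensional: "conj_act k G N act t \<beta> \<in> extensional (tuples NG k)"
  by (simp add: conj_act_def)

text \<open>This identity is why conjugation commutes with the differential.\<close>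
lemma act_cj:
  assumes "g \<in> carrier G" "n \<in> N" "a \<in> carrier M"
  shows "act g (act (cj (inv g) n) a) = act n (act g a)"
  using assms by (simp add: act_act cj_def \<Gamma>.word_simps)

lemma conj_act_cochain:
  assumes "t \<in> T" "\<beta> \<in> carrier (cochain_group k NG M)"
  shows "conj_act k G N act t \<beta> \<in> carrier (cochain_group k NG M)"
proof -
  have "\<one> \<in> set (map (cj (inv t)) ns)" if "\<one> \<in> set ns" for ns
    using that assms by (auto intro!: image_eqI [of _ _ "\<one>"])
  then show ?thesis
    using assms conj_act_extensional [of k t \<beta>] by (simp add: cochain_iff conj_act_apply)
qed

lemma conj_act_cochain_map:
  assumes t: "t \<in> T"
  shows "cochain_map NG M act NG M act (\<lambda>k. conj_act k G N act t)"
proof unfold_locales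
  show "conj_act k G N act t \<in> hom (cochain_group k NG M) (cochain_group k NG M)" for k
  proof (rule homI)
    fix \<beta> \<beta>' assume \<beta>: "\<beta> \<in> carrier (cochain_group k NG M)" "\<beta>' \<in> carrier (cochain_group k NG M)"
    show "conj_act k G N act t (\<beta> \<otimes>\<^bsub>cochain_group k NG M\<^esub> \<beta>') =
        conj_act k G N act t \<beta> \<otimes>\<^bsub>cochain_group k NG M\<^esub> conj_act k G N act t \<beta>'"
      using t cochain_closed [OF \<beta>(1)] cochain_closed [OF \<beta>(2)] conj_act_extensional
      by (intro extensional_tuples_eqI [of _ NG k]) (simp_all add: conj_act_apply)
  qed (rule conj_act_cochain [OF t])
  show "differential k NG M act (conj_act k G N act t \<beta>) =
      conj_act (k + 1) G N act t (differential k NG M act \<beta>)"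
    if k: "k \<le> 2" and \<beta>: "\<beta> \<in> carrier (cochain_group k NG M)" for k \<beta>
  proof (rule differential_eqI [OF N.group_module_axioms k conj_act_cochain [OF t \<beta>] conj_act_extensional])
    have cl: "\<beta> gs \<in> carrier M" if "gs \<in> tuples NG k" for gs
      using \<beta> that by (rule cochain_closed)
    show "conj_act (k + 1) G N act t (differential k NG M act \<beta>) [g] =
        act g (conj_act k G N act t \<beta> []) \<otimes>\<^bsub>M\<^esub> inv\<^bsub>M\<^esub> conj_act k G N act t \<beta> []"
      if "k = 0" "g \<in> carrier NG" for g
      using that t \<beta> cl by (simp add: conj_act_apply N.differential_0 act_cj)
    show "conj_act (k + 1) G N act t (differential k NG M act \<beta>) [g, h] =
        act g (conj_act k G N act t \<beta> [h]) \<otimes>\<^bsub>M\<^esub> inv\<^bsub>M\<^esub> conj_act k G N act t \<beta> [g \<otimes>\<^bsub>NG\<^esub> h] \<otimes>\<^bsub>M\<^esub>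
        conj_act k G N act t \<beta> [g]"
      if "k = 1" "g \<in> carrier NG" "h \<in> carrier NG" for g h
      using that t \<beta> cl by (simp add: conj_act_apply N.differential_1 act_cj)
    show "conj_act (k + 1) G N act t (differential k NG M act \<beta>) [g, h, l] =
        act g (conj_act k G N act t \<beta> [h, l]) \<otimes>\<^bsub>M\<^esub> inv\<^bsub>M\<^esub> conj_act k G N act t \<beta> [g \<otimes>\<^bsub>NG\<^esub> h, l] \<otimes>\<^bsub>M\<^esub>
        conj_act k G N act t \<beta> [g, h \<otimes>\<^bsub>NG\<^esub> l] \<otimes>\<^bsub>M\<^esub> inv\<^bsub>M\<^esub> conj_act k G N act t \<beta> [g, h]"
      if "k = 2" "g \<in> carrier NG" "h \<in> carrier NG" "l \<in> carrier NG" for g h l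
      using that t \<beta> cl by (simp add: conj_act_apply N.differential_2 act_cj)
  qed
qed

lemma cochains_T_module: "group_module TG (cochain_group k NG M) (conj_act k G N act)"
proof -
  interpret C: comm_group "cochain_group k NG M" by (rule N.comm_group_cochains)
  show ?thesis
  proof unfold_locales
    fix t \<beta> assume t: "t \<in> carrier TG" and \<beta>: "\<beta> \<in> carrier (cochain_group k NG M)"
    then show "conj_act k G N act t \<beta> \<in> carrier (cochain_group k NG M)"
      by (simp add: conj_act_cochain)
    show "conj_act k G N act t (\<beta> \<otimes>\<^bsub>cochain_group k NG M\<^esub> \<beta>') =
        conj_act k G N act t \<beta> \<otimes>\<^bsub>cochain_group k NG M\<^esub> conj_act k G N act t \<beta>'"
      if \<beta>': "\<beta>' \<in> carrier (cochain_group k NG M)" for \<beta>'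
      using t cochain_closed [OF \<beta>] cochain_closed [OF \<beta>'] conj_act_extensional
      by (intro extensional_tuples_eqI [of _ NG k]) (simp_all add: conj_act_apply)
    show "conj_act k G N act t (conj_act k G N act t' \<beta>) = conj_act k G N act (t \<otimes>\<^bsub>TG\<^esub> t') \<beta>"
      if t': "t' \<in> carrier TG" for t'
      using t t' cochain_closed [OF \<beta>] conj_act_extensional
      by (intro extensional_tuples_eqI [of _ NG k])
        (simp_all add: conj_act_apply act_act map_cj_map_cj \<Gamma>.inv_mult_group del: map_map)
  next
    show "conj_act k G N act \<one>\<^bsub>TG\<^esub> \<beta> = \<beta>" if \<beta>: "\<beta> \<in> carrier (cochain_group k NG M)" for \<beta>
      using cochain_closed [OF \<beta>] \<beta> conj_act_extensional
      by (intro extensional_tuples_eqI [of _ NG k]) (simp_all add: conj_act_apply map_cj_one cochain_iff)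
  qed
qed

lemma conj_act_cocycle:
  assumes "n \<le> 2" "t \<in> T" "\<beta> \<in> carrier (cocycle_group n NG M act)"
  shows "conj_act n G N act t \<beta> \<in> carrier (cocycle_group n NG M act)"
  using cochain_map.map_cocycle [OF conj_act_cochain_map] assms by blast

lemma cocycles_T_module:
  assumes "n \<le> 2"
  shows "group_module TG (cocycle_group n NG M act) (conj_act n G N act)"
  using group_module.submodule [OF cochains_T_module N.subgroup_cocycles [OF assms]] assms
  by (simp add: conj_act_cocycle flip: cocycle_group_eq_submodule)

interpretation TC: group_module TG C1N conj1
  by (rule cochains_T_module)
interpretation TD: group_module TG DerN conj1
  by (rule cocycles_T_module) simp
interpretation TZ: group_module TG Z2N conj2
  by (rule cocycles_T_module) simp

lemma Der_cochain_cochain: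
  "\<gamma> \<in> carrier (cochain_group k TG DerN) \<Longrightarrow>
   \<gamma> \<in> carrier (cochain_group k TG C1N)"
  by (auto simp: cochain_iff [where n = k] dest: N.cocycle_cochain)

lemma Der_cochain_iff:
  "\<gamma> \<in> carrier (cochain_group k TG DerN) \<longleftrightarrow>
   \<gamma> \<in> carrier (cochain_group k TG C1N) \<and>
   (\<forall>ts \<in> tuples TG k. \<gamma> ts \<in> carrier DerN)"
  by (auto simp: cochain_iff [where n = k] dest: N.cocycle_cochain)

text \<open>
  Allows the differential on \<open>Der(N, M)\<close>-valued cochains to be computed among the
  \<open>C\<^sup>1(N, M)\<close>-valued ones, where \<open>\<gamma>\<close> lives.
\<close>
lemma Der_differential:
  assumes "n \<le> 2" "\<gamma> \<in> carrier (cochain_group n TG DerN)"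
  shows "differential n TG DerN conj1 \<gamma> = differential n TG C1N conj1 \<gamma>"
proof -
  have "differential n TG (C1N\<lparr>carrier := carrier DerN\<rparr>)
      conj1 \<gamma> = differential n TG C1N conj1 \<gamma>"
    using assms
    by (intro TC.submodule_differential N.subgroup_cocycles conj_act_cocycle)
      (simp_all flip: cocycle_group_eq_submodule)
  then show ?thesis by (simp flip: cocycle_group_eq_submodule)
qed

lemma derivation_iff:
  "d \<in> carrier Z1TD \<longleftrightarrow> d \<in> carrier K1 \<and>
     (\<forall>t \<in> T. \<forall>n \<in> N. \<forall>n' \<in> N. d [t] [n \<otimes> n'] = d [t] [n] \<otimes>\<^bsub>M\<^esub> act n (d [t] [n'])) \<and>
     (\<forall>t \<in> T. \<forall>t' \<in> T. \<forall>n \<in> N.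
        d [t \<otimes> t'] [n] = d [t] [n] \<otimes>\<^bsub>M\<^esub> act t (d [t'] [cj (inv t) n]))" (is "?l \<longleftrightarrow> ?r")
proof -
  have "d [t \<otimes> t'] = d [t] \<otimes>\<^bsub>DerN\<^esub> conj1 t (d [t']) \<longleftrightarrow>
      (\<forall>n \<in> N. d [t \<otimes> t'] [n] = d [t] [n] \<otimes>\<^bsub>M\<^esub> act t (d [t'] [cj (inv t) n]))"
    if "d \<in> carrier K1" "t \<in> T" "t' \<in> T" for t t'
  proof -
    have "d [t \<otimes> t'] \<in> extensional (tuples NG 1)"
      using that by (simp add: cochain_T_cochain_N_iff)
    moreover have "d [t] \<otimes>\<^bsub>DerN\<^esub> conj1 t (d [t']) \<in> extensional (tuples NG 1)"
      by simp
    ultimately have "d [t \<otimes> t'] = d [t] \<otimes>\<^bsub>DerN\<^esub> conj1 t (d [t']) \<longleftrightarrow>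
      (\<forall>ns \<in> tuples NG 1. d [t \<otimes> t'] ns = (d [t] \<otimes>\<^bsub>DerN\<^esub> conj1 t (d [t'])) ns)"
      using extensional_tuples_eqI by metis
    then show ?thesis
      using that by (simp add: ball_tuples conj_act_apply)
  qed
  moreover have "d \<in> carrier (cochain_group 1 TG DerN) \<longleftrightarrow>
      d \<in> carrier K1 \<and>
      (\<forall>t \<in> T. \<forall>n \<in> N. \<forall>n' \<in> N. d [t] [n \<otimes> n'] = d [t] [n] \<otimes>\<^bsub>M\<^esub> act n (d [t] [n']))"
  proof -
    have "d [t] \<in> carrier C1N"
      if "d \<in> carrier K1" "t \<in> T" for t
      using that by (simp add: cochain_closed)
    then show ?thesis
      unfolding Der_cochain_iff [of d 1] by (auto simp: ball_tuples N.cocycle1_iff)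
  qed
  ultimately show ?thesis
    unfolding TD.cocycle1_iff by auto
qed

text \<open>Conjugation permutes \<open>N\<close>, which allows passing between conditions at \<open>n\<close> and at \<open>\<^sup>tn\<close>.\<close>
lemma ball_cj: "t \<in> T \<Longrightarrow> (\<forall>n \<in> N. P (cj t n)) \<longleftrightarrow> (\<forall>n \<in> N. P n)"
  by (metis cj_N cj_inv(2) T_mem \<Gamma>.inv_closed)

lemma ball_ball_cj:
  "t \<in> T \<Longrightarrow> (\<forall>n \<in> N. \<forall>n' \<in> N. P (cj t n) (cj t n')) \<longleftrightarrow> (\<forall>n \<in> N. \<forall>n' \<in> N. P n n')"
  by (metis cj_N cj_inv(2) T_mem \<Gamma>.inv_closed)

text \<open>
  With \<open>b = 0\<close> and \<open>c = 0\<close>, condition (1) says that every \<open>d(t)\<close> is a derivation of \<open>N\<close> and (2) that \<open>d\<close> is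
  a derivation of \<open>T\<close>.
\<close>
lemma gluing_data_one_iff:
  assumes d: "d \<in> carrier K1"
  shows "gluing_data \<one>\<^bsub>Z2N\<^esub> d \<one>\<^bsub>Z2T\<^esub> \<longleftrightarrow>
    d \<in> carrier Z1TD"
proof -
  have cl: "d [t] [n] \<in> carrier M" if "t \<in> T" "n \<in> N" for t n
    using d that by (simp add: cochain_T_cochain_N_iff)
  have "(\<forall>t \<in> T. \<forall>n \<in> N. \<forall>n' \<in> N. d [t] [cj t n \<otimes> cj t n'] = d [t] [cj t n] \<otimes>\<^bsub>M\<^esub> act (cj t n) (d [t] [cj t n']))
    \<longleftrightarrow> (\<forall>t \<in> T. \<forall>n \<in> N. \<forall>n' \<in> N. d [t] [n \<otimes> n'] = d [t] [n] \<otimes>\<^bsub>M\<^esub> act n (d [t] [n']))"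
    by (rule ball_cong [OF refl],
      rule ball_ball_cj [where P = "\<lambda>n n'. d [t] [n \<otimes> n'] = d [t] [n] \<otimes>\<^bsub>M\<^esub> act n (d [t] [n'])" for t])
  moreover have "(\<forall>t \<in> T. \<forall>t' \<in> T. \<forall>n \<in> N. act t (d [t'] [n]) \<otimes>\<^bsub>M\<^esub> d [t] [cj t n] = d [t \<otimes> t'] [cj t n]) \<longleftrightarrow>
     (\<forall>t \<in> T. \<forall>t' \<in> T. \<forall>n \<in> N. d [t \<otimes> t'] [n] = d [t] [n] \<otimes>\<^bsub>M\<^esub> act t (d [t'] [cj (inv t) n]))"
  proof (rule ball_cong [OF refl], rule ball_cong [OF refl])
    fix t t' assume t: "t \<in> T" "t' \<in> T"
    show "(\<forall>n \<in> N. act t (d [t'] [n]) \<otimes>\<^bsub>M\<^esub> d [t] [cj t n] = d [t \<otimes> t'] [cj t n]) \<longleftrightarrow>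
      (\<forall>n \<in> N. d [t \<otimes> t'] [n] = d [t] [n] \<otimes>\<^bsub>M\<^esub> act t (d [t'] [cj (inv t) n]))"
      unfolding ball_cj [OF t(1), of "\<lambda>n. d [t \<otimes> t'] [n] = d [t] [n] \<otimes>\<^bsub>M\<^esub> act t (d [t'] [cj (inv t) n])", symmetric]
      using t cl by (auto simp: A.m_comm)
  qed
  ultimately show ?thesis
    using d cl by (simp add: gluing_data_def derivation_iff)
qed

section \<open>Principal derivations, the map omega and invariant classes\<close>

interpretation TC2: group_module TG C2N conj2
  by (rule cochains_T_module)
interpretation CC: comm_group K1
  by (rule TC.comm_group_cochains)
interpretation CC2: comm_group K2
  by (rule TC.comm_group_cochains)
interpretation dT: group_hom K1 K2 dT
  using TC.differential_group_hom [of 1] by simp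
interpretation dN: group_hom C1N C2N dN
  using N.differential_group_hom [of 1] by simp

lemma principal_der_apply: "n \<in> N \<Longrightarrow> principal_der NG M act m [n] = act n m \<otimes>\<^bsub>M\<^esub> inv\<^bsub>M\<^esub> m"
  by (simp add: principal_der_def)

lemma principal_der_extensional: "principal_der NG M act m \<in> extensional (tuples NG 1)"
  by (simp add: principal_der_def)

lemma principal_der_Der:
  assumes m: "m \<in> carrier M"
  shows "principal_der NG M act m \<in> carrier DerN"
proof -
  have "act (n \<otimes> n') m \<otimes>\<^bsub>M\<^esub> inv\<^bsub>M\<^esub> m =
      (act n m \<otimes>\<^bsub>M\<^esub> inv\<^bsub>M\<^esub> m) \<otimes>\<^bsub>M\<^esub> act n (act n' m \<otimes>\<^bsub>M\<^esub> inv\<^bsub>M\<^esub> m)" if "n \<in> N" "n' \<in> N" for n n'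
    using that m by (simp only: sd_simps act_act)
  then show ?thesis
    using m principal_der_extensional by (simp add: N.cocycle1_iff cochain1_iff principal_der_apply del: act_mult)
qed

lemma principal_der_hom: "principal_der NG M act \<in> hom M DerN"
proof (rule homI)
  fix m m' assume m: "m \<in> carrier M" "m' \<in> carrier M"
  have "act n (m \<otimes>\<^bsub>M\<^esub> m') \<otimes>\<^bsub>M\<^esub> inv\<^bsub>M\<^esub> (m \<otimes>\<^bsub>M\<^esub> m') =
      (act n m \<otimes>\<^bsub>M\<^esub> inv\<^bsub>M\<^esub> m) \<otimes>\<^bsub>M\<^esub> (act n m' \<otimes>\<^bsub>M\<^esub> inv\<^bsub>M\<^esub> m')" if "n \<in> N" for n
    using m that by (simp only: sd_simps)
  then show "principal_der NG M act (m \<otimes>\<^bsub>M\<^esub> m') =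
      principal_der NG M act m \<otimes>\<^bsub>DerN\<^esub> principal_der NG M act m'"
    using principal_der_extensional
    by (intro extensional_tuples_eqI [of _ NG 1]) (simp_all add: ball_tuples principal_der_apply)
qed (rule principal_der_Der)

lemma principal_der_equivariant:
  assumes "t \<in> T" "m \<in> carrier M"
  shows "principal_der NG M act (act t m) = conj1 t (principal_der NG M act m)"
  using assms principal_der_extensional conj_act_extensional
  by (intro extensional_tuples_eqI [of _ NG 1])
    (simp_all add: ball_tuples principal_der_apply conj_act_apply act_cj)

lemma principal_der_cochain_map:
  "cochain_map TG M act TG DerN conj1
     (\<lambda>k \<beta>. compose (tuples TG k) (principal_der NG M act) \<beta>)"
  using T.group_module_axioms TD.group_module_axioms principal_der_hom principal_der_equivariant
  by (intro coefficient_cochain_map) simp_all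

text \<open>
  Condition (1): \<open>\<gamma>\<close> is a lift, along \<open>\<partial>\<^sub>N : C\<^sup>1(N, M) \<rightarrow> Z\<^sup>2(N, M)\<close>, of the 1-cocycle
  \<open>t \<mapsto> t b - b\<close> which the first connecting homomorphism assigns to \<open>b\<close>.  The difference is formed in
  the group of all cochains, where it makes sense for every cochain \<open>b\<close>.
\<close>
definition lift :: "('g list \<Rightarrow> 'a) \<Rightarrow> ('g list \<Rightarrow> 'g list \<Rightarrow> 'a) \<Rightarrow> bool"
  where "lift b \<gamma> \<longleftrightarrow> \<gamma> \<in> carrier K1 \<and>
    (\<forall>t \<in> T. dN (\<gamma> [t]) =
       conj2 t b \<otimes>\<^bsub>C2N\<^esub> inv\<^bsub>C2N\<^esub> b)"

lemma cocycle_inv_eq: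
  assumes "b \<in> carrier Z2N"
  shows "inv\<^bsub>Z2N\<^esub> b = inv\<^bsub>C2N\<^esub> b"
  using group.m_inv_consistent [OF TC2.A.is_group N.subgroup_cocycles [of 2]] assms
  by (simp flip: cocycle_group_eq_submodule)

text \<open>
  A 0-cochain is a single element, so the first connecting homomorphism sends \<open>z\<close> to the
  set of all \<open>t \<mapsto> t b - b\<close> with \<open>b\<close> representing \<open>z\<close>; the second one takes all their lifts.
\<close>
lemma omega_N_eq:
  assumes z: "z \<in> carrier (cohomology 2 NG M act)"
  shows "omega_N G N T M act z = {dT \<gamma> | \<gamma>.
       \<exists>b \<in> carrier Z2N. clsN b = z \<and> lift b \<gamma>}"
proof -
  interpret H: comm_group "cohomology 2 NG M act" by (rule N.comm_group_cohomology) simp_all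
  define const where "const b = (\<lambda>_ \<in> tuples TG 0. b)" for b :: "'g list \<Rightarrow> 'a"
  have class0: "cohomology_class 0 TG (cohomology 2 NG M act) (\<lambda>t X. conj2 t ` X)
      (\<lambda>_ \<in> tuples TG 0. z) = {\<lambda>_ \<in> tuples TG 0. z}"
    using H.l_one [OF z] by (auto simp: cohomology_class_def coboundaries_def r_coset_def cong: restrict_cong)
  have coset: "(\<lambda>b. dN ` carrier C1N #>\<^bsub>Z2N\<^esub> b) = clsN"
    by (simp add: fun_eq_iff cohomology_class_def coboundaries_def One_nat_def)
  have const: "const b \<in> carrier (cochain_group 0 TG Z2N)"
    if "b \<in> carrier Z2N" for b
    using that by (simp add: const_def cochain_iff tuples_0)
  have first: "connecting 0 TG Z2N conj2 clsN {\<lambda>_ \<in> tuples TG 0. z} =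
    {differential 0 TG Z2N conj2 (const b) | b.
      b \<in> carrier Z2N \<and> clsN b = z}" (is "?L = ?R")
  proof
    show "?L \<subseteq> ?R"
    proof
      fix x assume "x \<in> ?L"
      then obtain \<beta> where \<beta>: "\<beta> \<in> carrier (cochain_group 0 TG Z2N)"
        and c: "compose (tuples TG 0) clsN \<beta> = (\<lambda>_ \<in> tuples TG 0. z)"
        and x: "x = differential 0 TG Z2N conj2 \<beta>"
        by (auto simp: connecting_def)
      have "\<beta> = const (\<beta> [])"
        using \<beta> by (intro extensional_tuples_eqI [of _ TG 0]) (simp_all add: const_def cochain_iff tuples_0)
      then have "x = differential 0 TG Z2N conj2 (const (\<beta> []))"
        unfolding x by (rule arg_cong)
      moreover have "clsN (\<beta> []) = z"
        using fun_cong [OF c, of "[]"] by (simp add: compose_def)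
      moreover have "\<beta> [] \<in> carrier Z2N"
        using \<beta> by (rule cochain_closed) simp
      ultimately show "x \<in> ?R" by blast
    qed
    show "?R \<subseteq> ?L"
      using const by (fastforce simp: connecting_def compose_def const_def)
  qed
  have second: "compose (tuples TG 1) dN \<gamma> =
      differential 0 TG Z2N conj2 (const b) \<longleftrightarrow>
      (\<forall>t \<in> T. dN (\<gamma> [t]) =
       conj2 t b \<otimes>\<^bsub>C2N\<^esub> inv\<^bsub>C2N\<^esub> b)" (is "?l \<longleftrightarrow> ?r")
    if b: "b \<in> carrier Z2N" for b \<gamma>
  proof -
    have "?l \<longleftrightarrow> (\<forall>ts \<in> tuples TG 1. dN (\<gamma> ts) =
      differential 0 TG Z2N conj2 (const b) ts)"
      using TZ.differential_extensional [of 0 "const b"] extensional_tuples_eqI [of _ TG 1]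
      by (auto simp: compose_def fun_eq_iff extensional_def)
    then show ?thesis
      using b const [OF b] by (simp add: ball_tuples TZ.differential_0 cocycle_inv_eq const_def)
  qed
  show ?thesis
    unfolding omega_N_def omega_def comp_def coset class0 first
    unfolding connecting_def lift_def add_0_left using second by blast
qed

lemma Der_iff: "x \<in> carrier DerN \<longleftrightarrow>
    x \<in> carrier C1N \<and> dN x = \<one>\<^bsub>C2N\<^esub>"
  by (simp add: cocycle_group_def kernel_def)

text \<open>
  By (1), \<open>\<partial>\<^sub>N\<close> maps \<open>(\<partial>\<^sub>T\<gamma>)(t, t')\<close> to \<open>(\<partial>\<^sub>T\<partial>\<^sub>T b)(t, t') = 0\<close>, where \<open>b\<close> is regarded as a 0-cochain on \<open>T\<close>.
  So \<open>\<partial>\<^sub>T\<gamma>\<close> takes values in \<open>Der(N, M)\<close>.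
\<close>
lemma lift_differential:
  assumes b: "b \<in> carrier Z2N" and \<gamma>: "lift b \<gamma>"
  shows "dT \<gamma> \<in> carrier Z2TD" (is "?d \<in> _")
proof -
  have \<gamma>C: "\<gamma> \<in> carrier K1"
    and eq: "\<And>t. t \<in> T \<Longrightarrow> dN (\<gamma> [t]) =
       conj2 t b \<otimes>\<^bsub>C2N\<^esub> inv\<^bsub>C2N\<^esub> b"
    using \<gamma> by (auto simp: lift_def)
  have bC: "b \<in> carrier C2N" using b by (rule N.cocycle_cochain)
  have \<gamma>v: "\<gamma> [t] \<in> carrier C1N" if "t \<in> T" for t
    using \<gamma>C that by (simp add: cochain_closed)
  have "?d [t, t'] \<in> carrier DerN" if t: "t \<in> T" "t' \<in> T" for t t'
  proof -
    have tT: "t \<in> carrier TG" "t' \<in> carrier TG" "t \<otimes>\<^bsub>TG\<^esub> t' \<in> carrier TG" using t by simp_all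
    have v: "\<gamma> [t] \<in> carrier C1N" "\<gamma> [t'] \<in> carrier C1N"
      "\<gamma> [t \<otimes>\<^bsub>TG\<^esub> t'] \<in> carrier C1N"
      "conj1 t (\<gamma> [t']) \<in> carrier C1N"
      using t \<gamma>v by (simp_all add: conj_act_cochain)
    have d: "?d [t, t'] = conj1 t (\<gamma> [t']) \<otimes>\<^bsub>C1N\<^esub>
        inv\<^bsub>C1N\<^esub> (\<gamma> [t \<otimes>\<^bsub>TG\<^esub> t']) \<otimes>\<^bsub>C1N\<^esub> \<gamma> [t]"
      using TC.differential_1 [OF \<gamma>C tT(1,2)] .
    have dt: "dN (conj1 t (\<gamma> [t'])) = conj2 t (dN (\<gamma> [t']))"
      using cochain_map.map_differential [OF conj_act_cochain_map [OF t(1)], of 1] v by simp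
    have eq_mult: "dN (\<gamma> [t \<otimes>\<^bsub>TG\<^esub> t']) =
        conj2 (t \<otimes>\<^bsub>TG\<^esub> t') b \<otimes>\<^bsub>C2N\<^esub> inv\<^bsub>C2N\<^esub> b"
      using t by (intro eq) simp
    have "dN (?d [t, t']) =
        conj2 t (conj2 t' b \<otimes>\<^bsub>C2N\<^esub> inv\<^bsub>C2N\<^esub> b)
        \<otimes>\<^bsub>C2N\<^esub>
        inv\<^bsub>C2N\<^esub> (conj2 (t \<otimes>\<^bsub>TG\<^esub> t') b \<otimes>\<^bsub>C2N\<^esub> inv\<^bsub>C2N\<^esub> b)
        \<otimes>\<^bsub>C2N\<^esub>
        (conj2 t b \<otimes>\<^bsub>C2N\<^esub> inv\<^bsub>C2N\<^esub> b)"
      unfolding d eq [OF t(2), symmetric] eq [OF t(1), symmetric]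
        eq_mult [symmetric] dt [symmetric]
      using v by (simp only: dN.hom_mult dN.hom_inv TC.A.m_closed TC.A.inv_closed)
    also have "\<dots> = \<one>\<^bsub>C2N\<^esub>"
      using tT bC by (simp only: TC2.module_simps TC2.act_act)
    finally show ?thesis
      unfolding Der_iff using v d by (simp only: TC.A.m_closed TC.A.inv_closed)
  qed
  then have dD: "?d \<in> carrier (cochain_group 2 TG DerN)"
    using TC.differential_closed [OF _ \<gamma>C] by (simp add: Der_cochain_iff ball_tuples)
  moreover have "differential 2 TG DerN conj1 ?d = \<one>\<^bsub>cochain_group 3 TG C1N\<^esub>"
    using TC.differential_differential [OF _ \<gamma>C] dD by (simp add: Der_differential)
  ultimately show ?thesis
    by (simp add: TD.cocycle_iff)
qed

lemma cochains_T_apply: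
  assumes "t \<in> T"
  shows "(x \<otimes>\<^bsub>K1\<^esub> y) [t] = x [t] \<otimes>\<^bsub>C1N\<^esub> y [t]"
    and "x \<in> carrier K1 \<Longrightarrow>
      (inv\<^bsub>K1\<^esub> x) [t] = inv\<^bsub>C1N\<^esub> (x [t])"
    and "x \<in> carrier K1 \<Longrightarrow> x [t] \<in> carrier C1N"
  using assms by (simp_all add: cochain_group_inv [OF TC.A.comm_group_axioms] cochain_closed)

lemma lift_mult:
  assumes b: "b \<in> carrier C2N" "b' \<in> carrier C2N"
    and lift: "lift b \<gamma>" "lift b' \<gamma>'"
  shows "lift (b \<otimes>\<^bsub>C2N\<^esub> b') (\<gamma> \<otimes>\<^bsub>K1\<^esub> \<gamma>')"
  unfolding lift_def
proof (intro conjI ballI)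
  note l = lift [unfolded lift_def, THEN conjunct1] lift [unfolded lift_def, THEN conjunct2, rule_format]
  show "\<gamma> \<otimes>\<^bsub>K1\<^esub> \<gamma>' \<in> carrier K1"
    using l(1,2) by (rule CC.m_closed)
  fix t assume t: "t \<in> T"
  have tT: "t \<in> carrier TG" using t by simp
  show "dN ((\<gamma> \<otimes>\<^bsub>K1\<^esub> \<gamma>') [t]) =
      conj2 t (b \<otimes>\<^bsub>C2N\<^esub> b') \<otimes>\<^bsub>C2N\<^esub>
      inv\<^bsub>C2N\<^esub> (b \<otimes>\<^bsub>C2N\<^esub> b')"
    unfolding cochains_T_apply(1) [OF t]
      dN.hom_mult [OF cochains_T_apply(3) [OF t l(1)] cochains_T_apply(3) [OF t l(2)]] l(3,4) [OF t]
    using b tT by (simp only: TC2.module_simps)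
qed

lemma lift_inv:
  assumes b: "b \<in> carrier C2N" and lift: "lift b \<gamma>"
  shows "lift (inv\<^bsub>C2N\<^esub> b) (inv\<^bsub>K1\<^esub> \<gamma>)"
  unfolding lift_def
proof (intro conjI ballI)
  note l = lift [unfolded lift_def, THEN conjunct1] lift [unfolded lift_def, THEN conjunct2, rule_format]
  show "inv\<^bsub>K1\<^esub> \<gamma> \<in> carrier K1"
    using l(1) by (rule CC.inv_closed)
  fix t assume t: "t \<in> T"
  have tT: "t \<in> carrier TG" using t by simp
  show "dN ((inv\<^bsub>K1\<^esub> \<gamma>) [t]) =
      conj2 t (inv\<^bsub>C2N\<^esub> b) \<otimes>\<^bsub>C2N\<^esub>
      inv\<^bsub>C2N\<^esub> (inv\<^bsub>C2N\<^esub> b)"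
    unfolding cochains_T_apply(2) [OF t l(1)]
      dN.hom_inv [OF cochains_T_apply(3) [OF t l(1)]] l(2) [OF t]
    using b tT by (simp only: TC2.module_simps)
qed

text \<open>
  Together with the two preceding lemmas this shows that any two lifts belonging to one \<open>b\<close> differ by one of
  the \<open>Der(N, M)\<close>-valued cochains.
\<close>
lemma lift_one_iff:
  "lift \<one>\<^bsub>C2N\<^esub> e \<longleftrightarrow> e \<in> carrier (cochain_group 1 TG DerN)"
proof -
  have "conj2 t \<one>\<^bsub>C2N\<^esub> \<otimes>\<^bsub>C2N\<^esub>
      inv\<^bsub>C2N\<^esub> \<one>\<^bsub>C2N\<^esub> = \<one>\<^bsub>C2N\<^esub>" if "t \<in> T" for t
  proof -
    have "t \<in> carrier TG" using that by simp
    then show ?thesis by (simp only: TC2.module_simps)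
  qed
  then show ?thesis
    unfolding lift_def Der_cochain_iff ball_tuples Der_iff by (auto simp: cochain_closed simp del: cochain_group_one)
qed

text \<open>If \<open>b = \<partial>\<^sub>N a\<close>, then \<open>t \<mapsto> t a - a\<close> is a lift, and it is a coboundary on \<open>T\<close>.\<close>
lemma lift_coboundary:
  assumes a: "a \<in> carrier C1N"
  shows "\<exists>\<alpha>. lift (dN a) \<alpha> \<and>
    dT \<alpha> = \<one>\<^bsub>K2\<^esub>"
proof -
  define k where "k = (\<lambda>_ \<in> tuples TG 0. a)"
  have k: "k \<in> carrier (cochain_group 0 TG C1N)"
    using a by (simp add: k_def cochain_iff [where n = 0] tuples_0)
  define \<alpha> where "\<alpha> = differential 0 TG C1N conj1 k"
  have \<alpha>: "\<alpha> \<in> carrier K1"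
    using TC.differential_closed [of 0 k] k by (simp add: \<alpha>_def)
  have "dN (\<alpha> [t]) = conj2 t (dN a)
      \<otimes>\<^bsub>C2N\<^esub> inv\<^bsub>C2N\<^esub> dN a" if t: "t \<in> T" for t
  proof -
    have tT: "t \<in> carrier TG" using t by simp
    have v: "\<alpha> [t] = conj1 t a \<otimes>\<^bsub>C1N\<^esub> inv\<^bsub>C1N\<^esub> a"
      unfolding \<alpha>_def TC.differential_0 [OF k tT] by (simp add: k_def)
    have "dN (conj1 t a) = conj2 t (dN a)"
      using cochain_map.map_differential [OF conj_act_cochain_map [OF t], of 1] a by simp
    then show ?thesis
      unfolding v using a conj_act_cochain [OF t a]
      by (simp only: dN.hom_mult dN.hom_inv TC.A.inv_closed)
  qed
  moreover have "dT \<alpha> = \<one>\<^bsub>K2\<^esub>"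
    using TC.differential_differential [of 0 k] k by (simp add: \<alpha>_def)
  ultimately show ?thesis
    using \<alpha> unfolding lift_def by blast
qed

text \<open>
  If \<open>b' = \<partial>\<^sub>N a + b\<close> has the lift \<open>\<gamma>'\<close> and \<open>\<alpha>(t) = t a - a\<close>, then \<open>e = \<gamma>' - \<alpha> - \<gamma>\<close> is a lift belonging to
  0, hence takes values in \<open>Der(N, M)\<close>, and \<open>\<partial>\<^sub>T\<gamma>' = \<partial>\<^sub>Te + \<partial>\<^sub>T\<gamma>\<close>.  So neither the representative
  nor its lift affects the class of \<open>\<partial>\<^sub>T\<gamma>\<close>.
\<close>
lemma omega_N_class:
  assumes b: "b \<in> carrier Z2N" and \<gamma>: "lift b \<gamma>"
  shows "omega_N G N T M act (clsN b) = clsTD (dT \<gamma>)" (is "?L = ?R")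
proof -
  have bC: "b \<in> carrier C2N" using b by (rule N.cocycle_cochain)
  have \<gamma>K: "\<gamma> \<in> carrier K1" using \<gamma> by (simp add: lift_def)
  have "b \<in> carrier Z2N \<Longrightarrow>
    clsN b \<in> carrier (cohomology 2 NG M act)" for b
    by (simp add: N.carrier_cohomology)
  note L = omega_N_eq [OF this [OF b]]
  have mult: "\<sigma> \<otimes>\<^bsub>Z2TD\<^esub> \<tau> = \<sigma> \<otimes>\<^bsub>K2\<^esub> \<tau>" for \<sigma> \<tau>
    by simp
  have R: "x \<in> ?R \<longleftrightarrow> (\<exists>e \<in> carrier (cochain_group 1 TG DerN). x = dT e \<otimes>\<^bsub>K2\<^esub> dT \<gamma>)" for x
  proof -
    have "coboundaries 2 TG DerN conj1 = dT ` carrier (cochain_group 1 TG DerN)"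
      by (rule Set.set_eqI) (auto simp: TD.coboundary2_iff Der_differential image_iff)
    then show ?thesis
      unfolding cohomology_class_def r_coset_def mult
      by (simp del: cochain_group_mult)
  qed
  show ?thesis
  proof (rule Set.set_eqI, rule iffI)
    fix x assume "x \<in> ?L"
    then obtain \<gamma>' b' where x: "x = dT \<gamma>'" and b': "b' \<in> carrier Z2N"
      and eq: "clsN b' = clsN b" and \<gamma>': "lift b' \<gamma>'"
      unfolding L by blast
    obtain a where a: "a \<in> carrier C1N"
      and b'_eq: "b' = dN a \<otimes>\<^bsub>C2N\<^esub> b"
      using N.cohomology_class_eq_iff [of 2 b b'] b b' eq by (auto simp: N.coboundary2_iff)
    obtain \<alpha> where \<alpha>: "lift (dN a) \<alpha>" and d\<alpha>: "dT \<alpha> = \<one>\<^bsub>K2\<^esub>"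
      using lift_coboundary [OF a] by blast
    have daC: "dN a \<in> carrier C2N" using a by simp
    have b'C: "b' \<in> carrier C2N" using b' by (rule N.cocycle_cochain)
    have K: "\<gamma>' \<in> carrier K1" "\<alpha> \<in> carrier K1" using \<gamma>' \<alpha> by (simp_all add: lift_def)
    define e where "e = \<gamma>' \<otimes>\<^bsub>K1\<^esub> inv\<^bsub>K1\<^esub> (\<alpha> \<otimes>\<^bsub>K1\<^esub> \<gamma>)"
    have "lift (b' \<otimes>\<^bsub>C2N\<^esub> inv\<^bsub>C2N\<^esub> b') e"
      unfolding e_def using lift_mult [OF daC bC \<alpha> \<gamma>] b'C \<gamma>' unfolding b'_eq [symmetric]
      by (intro lift_mult lift_inv TC2.A.inv_closed)
    then have "e \<in> carrier (cochain_group 1 TG DerN)"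
      unfolding TC2.A.r_inv [OF b'C] lift_one_iff .
    moreover have "x = dT e \<otimes>\<^bsub>K2\<^esub> dT \<gamma>"
    proof -
      have "dT e = dT \<gamma>' \<otimes>\<^bsub>K2\<^esub> inv\<^bsub>K2\<^esub> (\<one>\<^bsub>K2\<^esub> \<otimes>\<^bsub>K2\<^esub> dT \<gamma>)"
        unfolding e_def d\<alpha> [symmetric] using K \<gamma>K
        by (simp only: dT.hom_mult dT.hom_inv CC.inv_closed CC.m_closed)
      then show ?thesis
        unfolding x using dT.hom_closed [OF K(1)] dT.hom_closed [OF \<gamma>K] by (simp only: CC2.frac_simps)
    qed
    ultimately show "x \<in> ?R" unfolding R by blast
  next
    fix x assume "x \<in> ?R"
    then obtain e where e: "e \<in> carrier (cochain_group 1 TG DerN)" and x: "x = dT e \<otimes>\<^bsub>K2\<^esub> dT \<gamma>"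
      unfolding R by blast
    have "lift (\<one>\<^bsub>C2N\<^esub> \<otimes>\<^bsub>C2N\<^esub> b) (e \<otimes>\<^bsub>K1\<^esub> \<gamma>)"
      using e \<gamma> bC by (intro lift_mult TC2.A.one_closed) (simp_all only: lift_one_iff)
    then have "lift b (e \<otimes>\<^bsub>K1\<^esub> \<gamma>)"
      unfolding TC2.A.l_one [OF bC] .
    moreover have "x = dT (e \<otimes>\<^bsub>K1\<^esub> \<gamma>)"
      unfolding x using dT.hom_mult [OF Der_cochain_cochain [OF e] \<gamma>K] by simp
    ultimately show "x \<in> ?L"
      unfolding L using b by blast
  qed
qed

interpretation P: cochain_map TG M act TG DerN conj1
    "\<lambda>k \<beta>. compose (tuples TG k) (principal_der NG M act) \<beta>"
  by (rule principal_der_cochain_map)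
interpretation rN: cochain_map G M act NG M act "\<lambda>k \<beta>. restrict \<beta> (tuples NG k)"
  using N_subgroup by (rule restriction_cochain_map)
interpretation rT: cochain_map G M act TG M act "\<lambda>k \<beta>. restrict \<beta> (tuples TG k)"
  using T_subgroup by (rule restriction_cochain_map)

text \<open>
  Conditions (1) and (2) as equations between cochains.  Through this form the normal form of
  cocycles meets the definition of \<open>\<phi>\<close>.
\<close>
lemma gluing_data_iff:
  assumes b: "b \<in> carrier C2N" and c: "c \<in> carrier (cochain_group 2 TG M)"
    and \<gamma>: "\<gamma> \<in> carrier K1"
  shows "gluing_data b \<gamma> c \<longleftrightarrow> lift b \<gamma> \<and>
    dT \<gamma> \<otimes>\<^bsub>K2\<^esub> P2 c = \<one>\<^bsub>K2\<^esub>"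
proof -
  have bv: "b [n, n'] \<in> carrier M" if "n \<in> N" "n' \<in> N" for n n'
    using b that by (simp add: cochain2_iff)
  have cv: "c [t, t'] \<in> carrier M" if "t \<in> T" "t' \<in> T" for t t'
    using c that by (simp add: cochain2_iff)
  have \<gamma>v: "\<gamma> [t] [n] \<in> carrier M" if "t \<in> T" "n \<in> N" for t n
    using \<gamma> that by (simp add: cochain_T_cochain_N_iff)
  have \<gamma>C: "\<gamma> [t] \<in> carrier C1N" if "t \<in> T" for t
    using \<gamma> that by (simp add: cochain_closed)
  have 1: "dN (\<gamma> [t]) =
       conj2 t b \<otimes>\<^bsub>C2N\<^esub> inv\<^bsub>C2N\<^esub> b \<longleftrightarrow>
     (\<forall>n \<in> N. \<forall>n' \<in> N. act t (b [n, n']) \<otimes>\<^bsub>M\<^esub> \<gamma> [t] [cj t n \<otimes> cj t n'] =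
       b [cj t n, cj t n'] \<otimes>\<^bsub>M\<^esub> \<gamma> [t] [cj t n] \<otimes>\<^bsub>M\<^esub> act (cj t n) (\<gamma> [t] [cj t n']))" (is "?l \<longleftrightarrow> ?r")
    if t: "t \<in> T" for t
  proof -
    have "conj2 t b \<otimes>\<^bsub>C2N\<^esub> inv\<^bsub>C2N\<^esub> b \<in> carrier C2N"
      using b t by (intro TC2.A.m_closed TC2.A.inv_closed conj_act_cochain)
    then have "?l \<longleftrightarrow> (\<forall>ns \<in> tuples NG 2. dN (\<gamma> [t]) ns =
      (conj2 t b \<otimes>\<^bsub>C2N\<^esub> inv\<^bsub>C2N\<^esub> b) ns)"
      using cochain_eqI [OF dN.hom_closed [OF \<gamma>C [OF t]]] by metis
    also have "\<dots> \<longleftrightarrow> (\<forall>n \<in> N. \<forall>n' \<in> N. act n (\<gamma> [t] [n']) \<otimes>\<^bsub>M\<^esub> inv\<^bsub>M\<^esub> \<gamma> [t] [n \<otimes> n'] \<otimes>\<^bsub>M\<^esub> \<gamma> [t] [n] =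
        act t (b [cj (inv t) n, cj (inv t) n']) \<otimes>\<^bsub>M\<^esub> inv\<^bsub>M\<^esub> b [n, n'])"
      using t b \<gamma>C by (simp add: ball_tuples N.differential_1 conj_act_apply cochain_group_inv [OF A.comm_group_axioms])
    also have "\<dots> \<longleftrightarrow> (\<forall>n \<in> N. \<forall>n' \<in> N.
        act (cj t n) (\<gamma> [t] [cj t n']) \<otimes>\<^bsub>M\<^esub> inv\<^bsub>M\<^esub> \<gamma> [t] [cj t n \<otimes> cj t n'] \<otimes>\<^bsub>M\<^esub> \<gamma> [t] [cj t n] =
        act t (b [cj (inv t) (cj t n), cj (inv t) (cj t n')]) \<otimes>\<^bsub>M\<^esub> inv\<^bsub>M\<^esub> b [cj t n, cj t n'])"
      using ball_ball_cj [OF t, of "\<lambda>n n'. act n (\<gamma> [t] [n']) \<otimes>\<^bsub>M\<^esub> inv\<^bsub>M\<^esub> \<gamma> [t] [n \<otimes> n'] \<otimes>\<^bsub>M\<^esub> \<gamma> [t] [n] =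
        act t (b [cj (inv t) n, cj (inv t) n']) \<otimes>\<^bsub>M\<^esub> inv\<^bsub>M\<^esub> b [n, n']"] by (rule sym)
    also have "\<dots> \<longleftrightarrow> ?r"
    proof (rule ball_cong [OF refl], rule ball_cong [OF refl])
      fix n n' assume n: "n \<in> N" "n' \<in> N"
      define p p' where "p = cj t n" and "p' = cj t n'"
      have p: "p \<in> N" "p' \<in> N" "cj (inv t) p = n" "cj (inv t) p' = n'"
        using n t by (simp_all add: p_def p'_def)
      have v: "t \<in> T" "p \<in> N" "\<gamma> [t] [p'] \<in> carrier M" "\<gamma> [t] [p \<otimes> p'] \<in> carrier M" "\<gamma> [t] [p] \<in> carrier M"
        "b [n, n'] \<in> carrier M" "b [p, p'] \<in> carrier M"
        using t n p(1,2) \<gamma>v bv by simp_all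
      show "(act (cj t n) (\<gamma> [t] [cj t n']) \<otimes>\<^bsub>M\<^esub> inv\<^bsub>M\<^esub> \<gamma> [t] [cj t n \<otimes> cj t n'] \<otimes>\<^bsub>M\<^esub> \<gamma> [t] [cj t n] =
          act t (b [cj (inv t) (cj t n), cj (inv t) (cj t n')]) \<otimes>\<^bsub>M\<^esub> inv\<^bsub>M\<^esub> b [cj t n, cj t n']) \<longleftrightarrow>
        (act t (b [n, n']) \<otimes>\<^bsub>M\<^esub> \<gamma> [t] [cj t n \<otimes> cj t n'] =
          b [cj t n, cj t n'] \<otimes>\<^bsub>M\<^esub> \<gamma> [t] [cj t n] \<otimes>\<^bsub>M\<^esub> act (cj t n) (\<gamma> [t] [cj t n']))"
        unfolding p_def [symmetric] p'_def [symmetric] p(3,4) using v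
        by (simp only: sd_simps) (rule eq_commute)
    qed
    finally show ?thesis .
  qed
  let ?s = "dT \<gamma> \<otimes>\<^bsub>K2\<^esub> P2 c"
  have "?s = \<one>\<^bsub>K2\<^esub> \<longleftrightarrow>
      (\<forall>ts \<in> tuples TG 2. \<forall>ns \<in> tuples NG 1. ?s ts ns = \<one>\<^bsub>M\<^esub>)"
  proof
    assume s: "\<forall>ts \<in> tuples TG 2. \<forall>ns \<in> tuples NG 1. ?s ts ns = \<one>\<^bsub>M\<^esub>"
    show "?s = \<one>\<^bsub>K2\<^esub>"
    proof (rule extensional_tuples_eqI [of _ TG 2], simp, simp, rule ballI)
      fix ts assume ts: "ts \<in> tuples TG 2"
      show "?s ts = \<one>\<^bsub>K2\<^esub> ts"
        using s ts by (intro extensional_tuples_eqI [of _ NG 1]) simp_all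
    qed
  qed simp
  also have "\<dots> \<longleftrightarrow> (\<forall>t \<in> T. \<forall>t' \<in> T. \<forall>n \<in> N.
      act t (\<gamma> [t'] [cj (inv t) n]) \<otimes>\<^bsub>M\<^esub> inv\<^bsub>M\<^esub> \<gamma> [t \<otimes> t'] [n] \<otimes>\<^bsub>M\<^esub> \<gamma> [t] [n] \<otimes>\<^bsub>M\<^esub>
        (act n (c [t, t']) \<otimes>\<^bsub>M\<^esub> inv\<^bsub>M\<^esub> c [t, t']) = \<one>\<^bsub>M\<^esub>)"
    using \<gamma> \<gamma>C by (simp add: ball_tuples TC.differential_1 compose_def conj_act_apply principal_der_apply
        cochain_group_inv [OF A.comm_group_axioms])
  also have "\<dots> \<longleftrightarrow> (\<forall>t \<in> T. \<forall>t' \<in> T. \<forall>n \<in> N.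
       act t (\<gamma> [t'] [n]) \<otimes>\<^bsub>M\<^esub> \<gamma> [t] [cj t n] \<otimes>\<^bsub>M\<^esub> act (cj t n) (c [t, t']) =
       \<gamma> [t \<otimes> t'] [cj t n] \<otimes>\<^bsub>M\<^esub> c [t, t'])"
  proof (rule ball_cong [OF refl], rule ball_cong [OF refl])
    fix t t' assume t: "t \<in> T" "t' \<in> T"
    have "(\<forall>n \<in> N. act t (\<gamma> [t'] [cj (inv t) n]) \<otimes>\<^bsub>M\<^esub> inv\<^bsub>M\<^esub> \<gamma> [t \<otimes> t'] [n] \<otimes>\<^bsub>M\<^esub> \<gamma> [t] [n] \<otimes>\<^bsub>M\<^esub>
        (act n (c [t, t']) \<otimes>\<^bsub>M\<^esub> inv\<^bsub>M\<^esub> c [t, t']) = \<one>\<^bsub>M\<^esub>) \<longleftrightarrow>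
      (\<forall>n \<in> N. act t (\<gamma> [t'] [cj (inv t) (cj t n)]) \<otimes>\<^bsub>M\<^esub> inv\<^bsub>M\<^esub> \<gamma> [t \<otimes> t'] [cj t n] \<otimes>\<^bsub>M\<^esub> \<gamma> [t] [cj t n] \<otimes>\<^bsub>M\<^esub>
        (act (cj t n) (c [t, t']) \<otimes>\<^bsub>M\<^esub> inv\<^bsub>M\<^esub> c [t, t']) = \<one>\<^bsub>M\<^esub>)"
      using ball_cj [OF t(1), of "\<lambda>n. act t (\<gamma> [t'] [cj (inv t) n]) \<otimes>\<^bsub>M\<^esub> inv\<^bsub>M\<^esub> \<gamma> [t \<otimes> t'] [n] \<otimes>\<^bsub>M\<^esub> \<gamma> [t] [n] \<otimes>\<^bsub>M\<^esub>
        (act n (c [t, t']) \<otimes>\<^bsub>M\<^esub> inv\<^bsub>M\<^esub> c [t, t']) = \<one>\<^bsub>M\<^esub>"] by (rule sym)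
    also have "\<dots> \<longleftrightarrow> (\<forall>n \<in> N. act t (\<gamma> [t'] [n]) \<otimes>\<^bsub>M\<^esub> \<gamma> [t] [cj t n] \<otimes>\<^bsub>M\<^esub> act (cj t n) (c [t, t']) =
       \<gamma> [t \<otimes> t'] [cj t n] \<otimes>\<^bsub>M\<^esub> c [t, t'])"
    proof (rule ball_cong [OF refl])
      fix n assume n: "n \<in> N"
      have i: "cj (inv t) (cj t n) = n" using t n by simp
      have v: "t \<in> T" "cj t n \<in> N" "\<gamma> [t'] [n] \<in> carrier M" "\<gamma> [t] [cj t n] \<in> carrier M"
        "\<gamma> [t \<otimes> t'] [cj t n] \<in> carrier M" "c [t, t'] \<in> carrier M"
        using t n \<gamma>v cv by simp_all
      show "(act t (\<gamma> [t'] [cj (inv t) (cj t n)]) \<otimes>\<^bsub>M\<^esub> inv\<^bsub>M\<^esub> \<gamma> [t \<otimes> t'] [cj t n] \<otimes>\<^bsub>M\<^esub> \<gamma> [t] [cj t n] \<otimes>\<^bsub>M\<^esub>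
          (act (cj t n) (c [t, t']) \<otimes>\<^bsub>M\<^esub> inv\<^bsub>M\<^esub> c [t, t']) = \<one>\<^bsub>M\<^esub>) \<longleftrightarrow>
        (act t (\<gamma> [t'] [n]) \<otimes>\<^bsub>M\<^esub> \<gamma> [t] [cj t n] \<otimes>\<^bsub>M\<^esub> act (cj t n) (c [t, t']) =
          \<gamma> [t \<otimes> t'] [cj t n] \<otimes>\<^bsub>M\<^esub> c [t, t'])"
        unfolding i using v by (simp only: sd_simps)
    qed
    finally show "(\<forall>n \<in> N. act t (\<gamma> [t'] [cj (inv t) n]) \<otimes>\<^bsub>M\<^esub> inv\<^bsub>M\<^esub> \<gamma> [t \<otimes> t'] [n] \<otimes>\<^bsub>M\<^esub> \<gamma> [t] [n] \<otimes>\<^bsub>M\<^esub>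
        (act n (c [t, t']) \<otimes>\<^bsub>M\<^esub> inv\<^bsub>M\<^esub> c [t, t']) = \<one>\<^bsub>M\<^esub>) \<longleftrightarrow>
      (\<forall>n \<in> N. act t (\<gamma> [t'] [n]) \<otimes>\<^bsub>M\<^esub> \<gamma> [t] [cj t n] \<otimes>\<^bsub>M\<^esub> act (cj t n) (c [t, t']) =
       \<gamma> [t \<otimes> t'] [cj t n] \<otimes>\<^bsub>M\<^esub> c [t, t'])" .
  qed
  finally show ?thesis
    unfolding gluing_data_def lift_def using 1 \<gamma> by simp
qed

lemma conj_act_image_class:
  assumes t: "t \<in> T" and b: "b \<in> carrier Z2N"
  shows "conj2 t ` clsN b = clsN (conj2 t b)"
proof -
  have B: "\<sigma> \<in> carrier Z2N" if "\<sigma> \<in> coboundaries 2 NG M act" for \<sigma>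
    using that N.coboundaries_subset [of 2] by auto
  have cB: "conj2 s \<sigma> \<in> coboundaries 2 NG M act"
    if "s \<in> T" "\<sigma> \<in> coboundaries 2 NG M act" for s \<sigma>
    using that cochain_map.map_coboundary [OF conj_act_cochain_map, of s 2] by simp
  have tT: "t \<in> carrier TG" using t by simp
  have "conj2 t ` coboundaries 2 NG M act = coboundaries 2 NG M act"
  proof (intro equalityI subsetI)
    fix \<sigma> assume \<sigma>: "\<sigma> \<in> coboundaries 2 NG M act"
    have "conj2 t (conj2 (inv t) \<sigma>) = \<sigma>"
      using TZ.act_act [of t "inv t" \<sigma>] TZ.act_one_left [of \<sigma>] t B [OF \<sigma>] by simp
    then show "\<sigma> \<in> conj2 t ` coboundaries 2 NG M act"
      using cB [of "inv t" \<sigma>] \<sigma> t by (metis NT_closed(4) imageI)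
  qed (use cB t in auto)
  note image_B = this
  have mult: "conj2 t (\<sigma> \<otimes>\<^bsub>Z2N\<^esub> b) =
      conj2 t \<sigma> \<otimes>\<^bsub>Z2N\<^esub> conj2 t b"
    if "\<sigma> \<in> coboundaries 2 NG M act" for \<sigma>
    using TZ.act_mult [OF tT B [OF that] b] .
  have class_eq: "clsN b =
      (\<lambda>\<sigma>. \<sigma> \<otimes>\<^bsub>Z2N\<^esub> b) ` coboundaries 2 NG M act" for b
    by (auto simp: cohomology_class_def r_coset_def simp del: cocycle_group_mult)
  have "conj2 t ` clsN b =
      (\<lambda>\<sigma>. conj2 t \<sigma> \<otimes>\<^bsub>Z2N\<^esub> conj2 t b) ` coboundaries 2 NG M act"
    unfolding class_eq image_image by (rule image_cong [OF refl mult])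
  also have "\<dots> = (\<lambda>\<sigma>. \<sigma> \<otimes>\<^bsub>Z2N\<^esub> conj2 t b) `
      (conj2 t ` coboundaries 2 NG M act)"
    by (simp only: image_image)
  finally show ?thesis
    unfolding image_B class_eq .
qed

text \<open>Invariant classes are the common fixed points of the endomorphisms of \<open>H\<^sup>2(N, M)\<close> induced by conjugation.\<close>
lemma comm_group_invariant_cohomology: "comm_group H2NT"
proof -
  interpret H: comm_group "cohomology 2 NG M act" by (rule N.comm_group_cohomology) simp_all
  let ?\<phi> = "\<lambda>t. class_map 2 NG M act (conj2 t)"
  have \<phi>: "?\<phi> t X = conj2 t ` X" if t: "t \<in> T" and X: "X \<in> carrier (cohomology 2 NG M act)" for t X
  proof -
    obtain b where b: "X = clsN b" "b \<in> carrier Z2N"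
      using X unfolding N.carrier_cohomology by (rule imageE)
    show ?thesis
      unfolding b(1) conj_act_image_class [OF t b(2)]
      using b(2) cochain_map.class_map_eq [OF conj_act_cochain_map [OF t], of 2] by simp
  qed
  have hom: "group_hom (cohomology 2 NG M act) (cohomology 2 NG M act) (?\<phi> t)" if "t \<in> T" for t
    using cochain_map.class_map_in_hom [OF conj_act_cochain_map [OF that], of 2] H.is_group
    by (intro group_hom.intro group_hom_axioms.intro) simp_all
  have "subgroup {X \<in> carrier (cohomology 2 NG M act). \<forall>t \<in> T. ?\<phi> t X = X} (cohomology 2 NG M act)"
    using group_hom.hom_one [OF hom] group_hom.hom_mult [OF hom] group_hom.hom_inv [OF hom]
    by (intro H.subgroupI) auto
  moreover have "{X \<in> carrier (cohomology 2 NG M act). \<forall>t \<in> T. conj2 t ` X = X} =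
    {X \<in> carrier (cohomology 2 NG M act). \<forall>t \<in> T. ?\<phi> t X = X}"
    by (intro Collect_cong conj_cong refl ball_cong) (simp_all add: \<phi>)
  ultimately show ?thesis
    unfolding invariant_cohomology_def by (auto intro: H.comm_group_subgroup)
qed

text \<open>
  A class is invariant iff each \<open>t b - b\<close> is a coboundary; a lift chooses for every \<open>t\<close> a cochain that
  it is the coboundary of.
\<close>
lemma carrier_invariant_cohomology:
  "carrier H2NT =
     {clsN b | b. b \<in> carrier Z2N \<and> (\<exists>\<gamma>. lift b \<gamma>)}"
proof -
  have "(\<forall>t \<in> T. conj2 t ` clsN b = clsN b) \<longleftrightarrow>
    (\<exists>\<gamma>. lift b \<gamma>)" (is "?l \<longleftrightarrow> ?r") if b: "b \<in> carrier Z2N" for b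
  proof -
    have bC: "b \<in> carrier C2N" using b by (rule N.cocycle_cochain)
    let ?D = "\<lambda>t a. dN a =
        conj2 t b \<otimes>\<^bsub>C2N\<^esub> inv\<^bsub>C2N\<^esub> b"
    have "conj2 t ` clsN b = clsN b \<longleftrightarrow>
      (\<exists>a \<in> carrier C1N. ?D t a)" if t: "t \<in> T" for t
    proof -
      have cb: "conj2 t b \<in> carrier Z2N"
        using t b by (intro conj_act_cocycle) simp_all
      have "conj2 t ` clsN b = clsN b \<longleftrightarrow>
        (\<exists>\<sigma> \<in> coboundaries 2 NG M act. conj2 t b = \<sigma> \<otimes>\<^bsub>Z2N\<^esub> b)"
        unfolding conj_act_image_class [OF t b] using N.cohomology_class_eq_iff [of 2 b] b cb by auto
      also have "\<dots> \<longleftrightarrow> (\<exists>a \<in> carrier C1N.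
          conj2 t b = dN a \<otimes>\<^bsub>C2N\<^esub> b)"
        by (simp add: coboundaries_def One_nat_def)
      also have "\<dots> \<longleftrightarrow> (\<exists>a \<in> carrier C1N. ?D t a)"
        using bC dN.hom_closed TC2.A.inv_solve_right [OF _ N.cocycle_cochain [OF cb] bC]
        by (metis (no_types, lifting))
      finally show ?thesis .
    qed
    then have "?l \<longleftrightarrow> (\<forall>t \<in> T. \<exists>a \<in> carrier C1N. ?D t a)"
      by simp
    also have "\<dots> \<longleftrightarrow> ?r"
    proof
      assume "\<forall>t \<in> T. \<exists>a \<in> carrier C1N. ?D t a"
      then obtain f where f: "\<forall>t \<in> T. f t \<in> carrier C1N \<and> ?D t (f t)"
        by metis
      \<comment> \<open>The choice at \<open>t = 1\<close> is replaced by 0 to obtain a normalized cochain.\<close>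
      define \<gamma> where "\<gamma> = (\<lambda>ts \<in> tuples TG 1. if hd ts = \<one> then \<one>\<^bsub>C1N\<^esub> else f (hd ts))"
      have \<gamma>_one: "\<gamma> [\<one>] = \<one>\<^bsub>C1N\<^esub>"
        by (simp add: \<gamma>_def)
      have \<gamma>_t: "\<gamma> [t] = f t" if "t \<in> T" "t \<noteq> \<one>" for t
        using that by (simp add: \<gamma>_def)
      have \<gamma>C: "\<gamma> [t] \<in> carrier C1N" if "t \<in> T" for t
        using that f \<gamma>_one \<gamma>_t TC.A.one_closed by metis
      have "\<gamma> \<in> carrier K1"
      proof -
        have "\<gamma> \<in> extensional (tuples TG 1)" by (simp add: \<gamma>_def)
        then show ?thesis using \<gamma>C \<gamma>_one by (simp add: cochain1_iff [of \<gamma>])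
      qed
      moreover have "?D t (\<gamma> [t])" if t: "t \<in> T" for t
      proof (cases "t = \<one>")
        case True
        have "conj2 \<one> b = b" using TC2.act_one_left [OF bC] by simp
        then show ?thesis
          unfolding True \<gamma>_one dN.hom_one using TC2.A.r_inv [OF bC] by simp
      next
        case False
        then show ?thesis using f t \<gamma>_t by simp
      qed
      ultimately show ?r unfolding lift_def by blast
    next
      assume ?r
      then show "\<forall>t \<in> T. \<exists>a \<in> carrier C1N. ?D t a"
        unfolding lift_def using cochains_T_apply(3) by blast
    qed
    finally show ?thesis .
  qed
  then show ?thesis
    unfolding invariant_cohomology_def by (auto simp: N.carrier_cohomology)
qed

section \<open>The map tau\<close>

interpretation ZTD: comm_group Z2TD
  by (rule TD.comm_group_cocycle_group) simp
interpretation ZG: comm_group "cocycles 2"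
  by (rule comm_group_cocycle_group) simp
interpretation ZT: comm_group Z2T
  by (rule T.comm_group_cocycle_group) simp

lemma one_cocycle:
  "\<one>\<^bsub>Z2N\<^esub> \<in> carrier Z2N"
  "\<one>\<^bsub>Z2T\<^esub> \<in> carrier Z2T"
  by (rule TZ.A.one_closed, rule ZT.one_closed)

text \<open>The defining description has exactly one solution because factorizations \<open>g = nt\<close> are unique.\<close>
lemma tau_cocycle_eq_glue:
  "tau_cocycle G N T act d = glue \<one>\<^bsub>Z2N\<^esub> d \<one>\<^bsub>Z2T\<^esub>"
  if d: "d \<in> carrier Z1TD"
proof (rule extensional_tuples_eqI [of _ G 2])
  show "tau_cocycle G N T act d \<in> extensional (tuples G 2)" by (simp add: tau_cocycle_def)
  show "\<forall>gs \<in> tuples G 2. tau_cocycle G N T act d gs =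
      glue \<one>\<^bsub>Z2N\<^esub> d \<one>\<^bsub>Z2T\<^esub> gs"
    unfolding ball_tuples ball_semidirect
  proof (intro ballI)
    fix n t n' t' assume nt: "n \<in> N" "t \<in> T" "n' \<in> N" "t' \<in> T"
    have dv: "d [t] [cj t n'] \<in> carrier M"
      using d nt by (simp add: derivation_iff cochain_T_cochain_N_iff)
    have "tau_cocycle G N T act d [n \<otimes> t, n' \<otimes> t'] =
      (THE m. \<exists>n2 \<in> N. \<exists>t2 \<in> T. \<exists>n2' \<in> N. \<exists>t2' \<in> T.
         [n \<otimes> t, n' \<otimes> t'] = [n2 \<otimes> t2, n2' \<otimes> t2'] \<and> m = act n2 (d [t2] [cj t2 n2']))"
      using nt by (simp add: tau_cocycle_def cj_def)
    also have "\<dots> = act n (d [t] [cj t n'])"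
    proof (rule the_equality)
      fix m assume "\<exists>n2 \<in> N. \<exists>t2 \<in> T. \<exists>n2' \<in> N. \<exists>t2' \<in> T.
         [n \<otimes> t, n' \<otimes> t'] = [n2 \<otimes> t2, n2' \<otimes> t2'] \<and> m = act n2 (d [t2] [cj t2 n2'])"
      then obtain n2 t2 n2' t2' where *: "n2 \<in> N" "t2 \<in> T" "n2' \<in> N" "t2' \<in> T"
        "n \<otimes> t = n2 \<otimes> t2" "n' \<otimes> t' = n2' \<otimes> t2'" "m = act n2 (d [t2] [cj t2 n2'])"
        by (elim bexE conjE) simp
      then show "m = act n (d [t] [cj t n'])"
        using factors_unique [OF nt(1,2) *(1,2,5)] factors_unique [OF nt(3,4) *(3,4,6)] by simp
    qed (use nt in blast)
    also have "\<dots> = glue \<one>\<^bsub>Z2N\<^esub> d \<one>\<^bsub>Z2T\<^esub> [n \<otimes> t, n' \<otimes> t']"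
      using nt dv by (simp add: glue_apply)
    finally show "tau_cocycle G N T act d [n \<otimes> t, n' \<otimes> t'] =
      glue \<one>\<^bsub>Z2N\<^esub> d \<one>\<^bsub>Z2T\<^esub> [n \<otimes> t, n' \<otimes> t']" .
  qed
qed (rule glue_extensional)

lemma tau_cocycle_apply:
  assumes d: "d \<in> carrier Z1TD"
    and nt: "n \<in> N" "t \<in> T" "n' \<in> N" "t' \<in> T"
  shows "tau_cocycle G N T act d [n \<otimes> t, n' \<otimes> t'] = act n (d [t] [cj t n'])"
proof -
  have "d [t] [cj t n'] \<in> carrier M"
    using d nt by (simp add: derivation_iff cochain_T_cochain_N_iff)
  then show ?thesis
    using nt unfolding tau_cocycle_eq_glue [OF d] by (simp add: glue_apply)
qed

lemma tau_cocycle_cocycle: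
  assumes d: "d \<in> carrier Z1TD"
  shows "tau_cocycle G N T act d \<in> carrier (cocycles 2)"
proof -
  have dC: "d \<in> carrier K1"
    using d unfolding derivation_iff by (rule conjunct1)
  show ?thesis
    unfolding tau_cocycle_eq_glue [OF d]
    using one_cocycle dC d gluing_data_one_iff [OF dC] by (intro glue_cocycle) simp_all
qed

lemma tau_cocycle_hom:
  "tau_cocycle G N T act \<in> hom Z1TD (cocycles 2)"
proof (rule homI)
  interpret Z: comm_group Z1TD by (rule TD.comm_group_cocycle_group) simp
  show "tau_cocycle G N T act d \<in> carrier (cocycles 2)" if "d \<in> carrier Z1TD" for d
    using that by (rule tau_cocycle_cocycle)
  fix d d' assume d: "d \<in> carrier Z1TD" "d' \<in> carrier Z1TD"
  have dd: "d \<otimes>\<^bsub>Z1TD\<^esub> d' \<in> carrier Z1TD" using d by (rule Z.m_closed)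
  have v: "d [t] [n] \<in> carrier M" "d' [t] [n] \<in> carrier M" if "t \<in> T" "n \<in> N" for t n
    using d that by (simp_all add: derivation_iff cochain_T_cochain_N_iff)
  show "tau_cocycle G N T act (d \<otimes>\<^bsub>Z1TD\<^esub> d') =
      tau_cocycle G N T act d \<otimes>\<^bsub>cocycles 2\<^esub> tau_cocycle G N T act d'"
  proof (rule extensional_tuples_eqI [of _ G 2])
    show "\<forall>gs \<in> tuples G 2. tau_cocycle G N T act (d \<otimes>\<^bsub>Z1TD\<^esub> d') gs =
      (tau_cocycle G N T act d \<otimes>\<^bsub>cocycles 2\<^esub> tau_cocycle G N T act d') gs"
      unfolding ball_tuples ball_semidirect
    proof (intro ballI)
      fix n t n' t' assume nt: "n \<in> N" "t \<in> T" "n' \<in> N" "t' \<in> T"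
      show "tau_cocycle G N T act (d \<otimes>\<^bsub>Z1TD\<^esub> d') [n \<otimes> t, n' \<otimes> t'] =
        (tau_cocycle G N T act d \<otimes>\<^bsub>cocycles 2\<^esub> tau_cocycle G N T act d') [n \<otimes> t, n' \<otimes> t']"
        unfolding tau_cocycle_apply [OF dd nt] using nt v
        by (simp add: tau_cocycle_apply [OF d(1) nt] tau_cocycle_apply [OF d(2) nt])
    qed
  qed (simp_all add: tau_cocycle_def)
qed

text \<open>
  If \<open>\<beta>\<^sub>d = \<partial>h\<close>, the pairs in \<open>N \<times> N\<close>, \<open>T \<times> T\<close> and \<open>N \<times> T\<close>, where \<open>\<beta>\<^sub>d\<close> vanishes, show that \<open>h\<close> is a derivation
  on \<open>N\<close> and on \<open>T\<close> and that \<open>h(nt) = h(n) + n h(t)\<close>; the pairs in \<open>T \<times> N\<close> then give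
  \<open>d\<close> in terms of \<open>e = h|\<^sub>N\<close> and \<open>w = - h|\<^sub>T\<close>.  In the other direction \<open>h(nt) = e(n) - n w(t)\<close> works.

  The one statement covers both facts that are needed: with \<open>w = 0\<close> that \<open>\<tau>\<close> is well defined on
  classes, and in general the description of its kernel.
\<close>
lemma tau_cocycle_coboundary_iff:
  assumes d: "d \<in> carrier Z1TD"
  shows "tau_cocycle G N T act d \<in> cobounds 2 \<longleftrightarrow>
    (\<exists>w \<in> carrier (Der TG M act). \<exists>\<sigma> \<in> coboundaries 1 TG DerN conj1.
       d = \<sigma> \<otimes>\<^bsub>Z1TD\<^esub> P1 w)"
    (is "?l \<longleftrightarrow> ?r")
proof -
  have dv: "d [t] [n] \<in> carrier M" if "t \<in> T" "n \<in> N" for t n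
    using d that by (simp add: derivation_iff cochain_T_cochain_N_iff)
  have d1: "t \<in> T \<Longrightarrow> d [t] [\<one>] = \<one>\<^bsub>M\<^esub>" "n \<in> N \<Longrightarrow> d [\<one>] [n] = \<one>\<^bsub>M\<^esub>" for t n
    using d by (simp_all add: derivation_iff cochain_T_cochain_N_iff)
  \<comment> \<open>The equation between cochains, expressed in values, for the coboundary \<open>\<sigma>(t) = t e - e\<close>.\<close>
  have d_eq: "d = \<sigma> \<otimes>\<^bsub>Z1TD\<^esub> P1 w \<longleftrightarrow>
      (\<forall>t \<in> T. \<forall>n \<in> N. d [t] [n] =
        (act t (e [cj (inv t) n]) \<otimes>\<^bsub>M\<^esub> inv\<^bsub>M\<^esub> e [n]) \<otimes>\<^bsub>M\<^esub> (act n (w [t]) \<otimes>\<^bsub>M\<^esub> inv\<^bsub>M\<^esub> w [t]))"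
    if e: "e \<in> carrier DerN" and
      \<sigma>: "\<forall>t \<in> T. \<sigma> [t] = conj1 t e \<otimes>\<^bsub>DerN\<^esub> inv\<^bsub>DerN\<^esub> e"
    for \<sigma> e w
  proof -
    let ?s = "\<sigma> \<otimes>\<^bsub>Z1TD\<^esub> P1 w"
    have inv: "(inv\<^bsub>DerN\<^esub> e) [n] = inv\<^bsub>M\<^esub> e [n]" if "n \<in> N" for n
    proof -
      have "inv\<^bsub>DerN\<^esub> e = inv\<^bsub>C1N\<^esub> e"
        using group.m_inv_consistent [OF TC.A.is_group N.subgroup_cocycles [of 1]] e
        by (simp flip: cocycle_group_eq_submodule)
      then show ?thesis
        using that N.cocycle_cochain [OF e] by (simp add: cochain_group_inv [OF A.comm_group_axioms])
    qed
    have "d = ?s \<longleftrightarrow> (\<forall>t \<in> T. \<forall>n \<in> N. d [t] [n] = ?s [t] [n])"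
    proof
      assume s: "\<forall>t \<in> T. \<forall>n \<in> N. d [t] [n] = ?s [t] [n]"
      have dx: "d \<in> extensional (tuples TG 1)" "\<forall>t \<in> T. d [t] \<in> extensional (tuples NG 1)"
        using d by (simp_all add: derivation_iff cochain_T_cochain_N_iff)
      have "d [t] = ?s [t]" if t: "t \<in> T" for t
        using s t dx(2) by (intro extensional_tuples_eqI [of _ NG 1]) (simp_all add: ball_tuples)
      then show "d = ?s"
        using dx(1) by (intro extensional_tuples_eqI [of _ TG 1]) (simp_all add: ball_tuples)
    qed simp
    then show ?thesis
      using \<sigma> by (simp add: compose_def conj_act_apply principal_der_apply inv)
  qed
  show ?thesis
  proof
    assume ?l
    then obtain h where h: "h \<in> carrier (cochains 1)"
      and dh: "tau_cocycle G N T act d = diff 1 h"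
      by (auto simp: coboundary2_iff)
    have hv: "h [g] \<in> carrier M" if "g \<in> carrier G" for g
      using h that by (simp add: cochain1_iff)
    have h1: "h [\<one>] = \<one>\<^bsub>M\<^esub>" using h by (simp add: cochain1_iff)
    \<comment> \<open>The equation \<open>\<beta>\<^sub>d = \<partial>h\<close> with the negative term moved to the other side.\<close>
    have main: "act n (d [t] [cj t n']) \<otimes>\<^bsub>M\<^esub> h [n \<otimes> t \<otimes> (n' \<otimes> t')] =
        act (n \<otimes> t) (h [n' \<otimes> t']) \<otimes>\<^bsub>M\<^esub> h [n \<otimes> t]"
      if nt: "n \<in> N" "t \<in> T" "n' \<in> N" "t' \<in> T" for n t n' t'
    proof -
      have g: "n \<otimes> t \<in> carrier G" "n' \<otimes> t' \<in> carrier G" using nt by simp_all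
      have eq: "act n (d [t] [cj t n']) = act (n \<otimes> t) (h [n' \<otimes> t']) \<otimes>\<^bsub>M\<^esub>
          inv\<^bsub>M\<^esub> h [n \<otimes> t \<otimes> (n' \<otimes> t')] \<otimes>\<^bsub>M\<^esub> h [n \<otimes> t]"
        unfolding tau_cocycle_apply [OF d nt, symmetric] dh by (rule differential_1 [OF h g])
      have v: "h [n' \<otimes> t'] \<in> carrier M" "h [n \<otimes> t] \<in> carrier M"
        "h [n \<otimes> t \<otimes> (n' \<otimes> t')] \<in> carrier M"
        using g by (simp_all add: hv)
      show ?thesis
        unfolding eq using v g by (simp only: module_simps)
    qed
    have hN: "h [n \<otimes> n'] = h [n] \<otimes>\<^bsub>M\<^esub> act n (h [n'])" if "n \<in> N" "n' \<in> N" for n n'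
      using main [of n "\<one>" n' "\<one>"] that by (simp add: d1 hv A.m_comm)
    have hT: "h [t \<otimes> t'] = h [t] \<otimes>\<^bsub>M\<^esub> act t (h [t'])" if "t \<in> T" "t' \<in> T" for t t'
      using main [of "\<one>" t "\<one>" t'] that by (simp add: d1 hv A.m_comm)
    have hNT: "h [n \<otimes> t] = h [n] \<otimes>\<^bsub>M\<^esub> act n (h [t])" if "n \<in> N" "t \<in> T" for n t
      using main [of n "\<one>" "\<one>" t] that by (simp add: d1 hv A.m_comm)
    define e where "e = restrict h (tuples NG 1)"
    define w where "w = (\<lambda>ts \<in> tuples TG 1. inv\<^bsub>M\<^esub> (h ts))"
    have e_ext: "e \<in> extensional (tuples NG 1)" and w_ext: "w \<in> extensional (tuples TG 1)"
      by (simp_all add: e_def w_def)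
    have e: "e \<in> carrier DerN"
      using hv h1 hN e_ext unfolding N.cocycle1_iff cochain1_iff by (simp add: e_def)
    have "inv\<^bsub>M\<^esub> (h [t] \<otimes>\<^bsub>M\<^esub> act t (h [t'])) = inv\<^bsub>M\<^esub> h [t] \<otimes>\<^bsub>M\<^esub> act t (inv\<^bsub>M\<^esub> h [t'])" if "t \<in> T" "t' \<in> T" for t t'
      using that by (simp add: A.inv_mult hv)
    then have w: "w \<in> carrier (Der TG M act)"
      using hv h1 hT w_ext unfolding T.cocycle1_iff cochain1_iff by (simp add: w_def)
    define \<sigma> where "\<sigma> = (\<lambda>ts \<in> tuples TG 1.
      conj1 (hd ts) e \<otimes>\<^bsub>DerN\<^esub> inv\<^bsub>DerN\<^esub> e)"
    have \<sigma>_eq: "\<forall>t \<in> T. \<sigma> [t] = conj1 t e \<otimes>\<^bsub>DerN\<^esub> inv\<^bsub>DerN\<^esub> e"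
      by (simp add: \<sigma>_def)
    have "\<sigma> \<in> extensional (tuples TG 1)" by (simp add: \<sigma>_def)
    then have \<sigma>: "\<sigma> \<in> coboundaries 1 TG DerN conj1"
      unfolding TD.coboundary1_iff using e \<sigma>_eq by auto
    have "\<forall>t \<in> T. \<forall>n \<in> N. d [t] [n] =
        (act t (e [cj (inv t) n]) \<otimes>\<^bsub>M\<^esub> inv\<^bsub>M\<^esub> e [n]) \<otimes>\<^bsub>M\<^esub> (act n (w [t]) \<otimes>\<^bsub>M\<^esub> inv\<^bsub>M\<^esub> w [t])"
    proof (intro ballI)
      fix t p assume t: "t \<in> T" and p: "p \<in> N"
      define n where "n = cj (inv t) p"
      have n: "n \<in> N" "cj t n = p" "t \<otimes> n = p \<otimes> t"
        using t p move_past [of t n] by (simp_all add: n_def)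
      have "d [t] [p] \<otimes>\<^bsub>M\<^esub> (h [p] \<otimes>\<^bsub>M\<^esub> act p (h [t])) = act t (h [n]) \<otimes>\<^bsub>M\<^esub> h [t]"
        using main [of "\<one>" t n "\<one>"] t p n by (simp add: dv hNT)
      then have "d [t] [p] = act t (h [n]) \<otimes>\<^bsub>M\<^esub> h [t] \<otimes>\<^bsub>M\<^esub> inv\<^bsub>M\<^esub> (h [p] \<otimes>\<^bsub>M\<^esub> act p (h [t]))"
        using t p n(1) by (subst A.inv_solve_right) (simp_all add: dv hv)
      also have "\<dots> = (act t (h [n]) \<otimes>\<^bsub>M\<^esub> inv\<^bsub>M\<^esub> h [p]) \<otimes>\<^bsub>M\<^esub>
          (act p (inv\<^bsub>M\<^esub> h [t]) \<otimes>\<^bsub>M\<^esub> inv\<^bsub>M\<^esub> (inv\<^bsub>M\<^esub> h [t]))"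
        using t p n(1) hv [of n] hv [of p] hv [of t] by (simp only: sd_simps)
      finally show "d [t] [p] = (act t (e [cj (inv t) p]) \<otimes>\<^bsub>M\<^esub> inv\<^bsub>M\<^esub> e [p]) \<otimes>\<^bsub>M\<^esub>
          (act p (w [t]) \<otimes>\<^bsub>M\<^esub> inv\<^bsub>M\<^esub> w [t])"
        using t p n(1) by (simp add: e_def w_def n_def)
    qed
    then show ?r
      using w \<sigma> d_eq [OF e \<sigma>_eq] by blast
  next
    assume ?r
    then obtain w \<sigma> where w: "w \<in> carrier (Der TG M act)"
      and \<sigma>: "\<sigma> \<in> coboundaries 1 TG DerN conj1"
      and d\<sigma>: "d = \<sigma> \<otimes>\<^bsub>Z1TD\<^esub> P1 w"
      by blast
    obtain e where e: "e \<in> carrier DerN"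
      and \<sigma>_eq: "\<forall>t \<in> T. \<sigma> [t] = conj1 t e \<otimes>\<^bsub>DerN\<^esub> inv\<^bsub>DerN\<^esub> e"
      using \<sigma> by (auto simp: TD.coboundary1_iff simp del: cocycle_group_mult)
    have d_val: "d [t] [n] =
        (act t (e [cj (inv t) n]) \<otimes>\<^bsub>M\<^esub> inv\<^bsub>M\<^esub> e [n]) \<otimes>\<^bsub>M\<^esub> (act n (w [t]) \<otimes>\<^bsub>M\<^esub> inv\<^bsub>M\<^esub> w [t])"
      if "t \<in> T" "n \<in> N" for t n
      using d\<sigma> d_eq [OF e \<sigma>_eq] that by blast
    have ev: "e [n] \<in> carrier M" if "n \<in> N" for n
      using e that by (simp add: N.cocycle1_iff cochain1_iff)
    have wv: "w [t] \<in> carrier M" if "t \<in> T" for t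
      using w that by (simp add: T.cocycle1_iff cochain1_iff)
    have e_mult: "e [n \<otimes> n'] = e [n] \<otimes>\<^bsub>M\<^esub> act n (e [n'])" if "n \<in> N" "n' \<in> N" for n n'
      using e that by (simp add: N.cocycle1_iff)
    have w_mult: "w [t \<otimes> t'] = w [t] \<otimes>\<^bsub>M\<^esub> act t (w [t'])" if "t \<in> T" "t' \<in> T" for t t'
      using w that by (simp add: T.cocycle1_iff)
    have one: "e [\<one>] = \<one>\<^bsub>M\<^esub>" "w [\<one>] = \<one>\<^bsub>M\<^esub>"
      using e w by (simp_all add: N.cocycle1_iff T.cocycle1_iff cochain1_iff)
    define h where "h = cochain1 (\<lambda>n t. e [n] \<otimes>\<^bsub>M\<^esub> inv\<^bsub>M\<^esub> act n (w [t]))"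
    have h: "h \<in> carrier (cochains 1)"
      unfolding h_def using ev wv one by (intro cochain1_cochain) simp_all
    have h_apply: "h [n \<otimes> t] = e [n] \<otimes>\<^bsub>M\<^esub> inv\<^bsub>M\<^esub> act n (w [t])" if "n \<in> N" "t \<in> T" for n t
      using that by (simp add: h_def)
    have "\<forall>g \<in> carrier G. \<forall>g' \<in> carrier G. tau_cocycle G N T act d [g, g'] = diff 1 h [g, g']"
      unfolding ball_semidirect
    proof (intro ballI)
      fix n t n' t' assume nt: "n \<in> N" "t \<in> T" "n' \<in> N" "t' \<in> T"
      define p where "p = cj t n'"
      have p: "p \<in> N" "cj (inv t) p = n'" using nt by (simp_all add: p_def)
      have g: "n \<otimes> t \<in> carrier G" "n' \<otimes> t' \<in> carrier G" using nt by simp_all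
      have np: "n \<otimes> p \<in> N" "t \<otimes> t' \<in> T" using nt p by simp_all
      have v: "n \<in> N" "t \<in> T" "p \<in> N" "e [n] \<in> carrier M" "e [n'] \<in> carrier M" "e [p] \<in> carrier M"
        "w [t] \<in> carrier M" "w [t'] \<in> carrier M"
        using nt p ev wv by simp_all
      have moves: "act (n \<otimes> t) (e [n']) = act n (act t (e [n']))"
        "act (n \<otimes> t) (act n' (w [t'])) = act (n \<otimes> p) (act t (w [t']))"
        "act n (act p (w [t])) = act (n \<otimes> p) (w [t])"
        using nt p v by (simp_all add: act_act p_def cj_def \<Gamma>.word_simps)
      have n': "n' \<in> N" using nt by simp
      show "tau_cocycle G N T act d [n \<otimes> t, n' \<otimes> t'] = diff 1 h [n \<otimes> t, n' \<otimes> t']"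
        unfolding tau_cocycle_apply [OF d nt] p_def [symmetric] d_val [OF nt(2) p(1)] p(2)
          differential_1 [OF h g] semidirect_mult [OF nt, folded p_def]
          h_apply [OF nt(1,2)] h_apply [OF nt(3,4)] h_apply [OF np]
          e_mult [OF nt(1) p(1)] w_mult [OF nt(2,4)]
        using v n' by (simp only: sd_simps moves)
    qed
    then have "tau_cocycle G N T act d = diff 1 h"
      using differential_extensional [of 1 h]
      by (intro extensional_tuples_eqI [of _ G 2]) (simp_all add: ball_tuples tau_cocycle_def)
    then show ?l using h by (auto simp: coboundary2_iff)
  qed
qed

section \<open>The exact sequence\<close>

interpretation ZD: comm_group Z1TD
  by (rule TD.comm_group_cocycle_group) simp
interpretation HTD: comm_group H2TD
  by (rule TD.comm_group_cohomology) simp_all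
interpretation HN: comm_group H2NT
  by (rule comm_group_invariant_cohomology)
interpretation HT: comm_group H2T
  by (rule T.comm_group_cohomology) simp_all
interpretation HG: comm_group H2G
  by (rule comm_group_cohomology) simp_all

lemma principal_der_map_class:
  assumes "1 \<le> n" "n \<le> 2" "w \<in> carrier (cocycle_group n TG M act)"
  shows "principal_der_map n G N T M act (cohomology_class n TG M act w) =
    cohomology_class n TG DerN conj1 (compose (tuples TG n) (principal_der NG M act) w)"
  using P.class_map_eq [OF assms] by (simp add: principal_der_map_def coeff_map_def)

lemma principal_der_map_hom:
  assumes "1 \<le> n" "n \<le> 2"
  shows "principal_der_map n G N T M act \<in>
    hom (cohomology n TG M act) (cohomology n TG DerN conj1)"
  using P.class_map_in_hom [OF assms] by (simp add: principal_der_map_def coeff_map_def)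

text \<open>The case \<open>w = 0\<close> of \<open>tau_cocycle_coboundary_iff\<close>.\<close>
lemma tau_cocycle_coboundary:
  assumes \<sigma>: "\<sigma> \<in> coboundaries 1 TG DerN conj1"
  shows "tau_cocycle G N T act \<sigma> \<in> cobounds 2"
proof -
  interpret Z: comm_group "Der TG M act" by (rule T.comm_group_cocycle_group) simp
  have \<sigma>Z: "\<sigma> \<in> carrier Z1TD"
    using \<sigma> TD.coboundaries_subset [of 1] by auto
  have "P1 \<one>\<^bsub>Der TG M act\<^esub> = \<one>\<^bsub>Z1TD\<^esub>"
    using hom_one [OF P.map_cocycle_hom [of 1] Z.is_group ZD.is_group] by simp
  then have "\<sigma> = \<sigma> \<otimes>\<^bsub>Z1TD\<^esub>
      P1 \<one>\<^bsub>Der TG M act\<^esub>"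
    using ZD.r_one [OF \<sigma>Z] by simp
  then show ?thesis
    unfolding tau_cocycle_coboundary_iff [OF \<sigma>Z] using \<sigma> Z.one_closed by blast
qed

lemma tau_class:
  assumes d: "d \<in> carrier Z1TD"
  shows "tau G N T M act (cls1TD d) = cls 2 (tau_cocycle G N T act d)"
  unfolding tau_def
  using TD.group_module_axioms group_module_axioms tau_cocycle_hom tau_cocycle_coboundary d
  by (intro class_map_cohomology_class) simp_all

lemma tau_hom:
  "tau G N T M act \<in> hom H1TD H2G"
  unfolding tau_def
  using TD.group_module_axioms group_module_axioms tau_cocycle_hom tau_cocycle_coboundary
  by (intro class_map_hom) simp_all

lemma res_class:
  assumes "\<beta> \<in> carrier (cocycles 2)"
  shows "res G N T M act (cls 2 \<beta>) = (clsN (restrict \<beta> (tuples NG 2)),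
     clsT (restrict \<beta> (tuples TG 2)))"
  using rN.class_map_eq [of 2 \<beta>] rT.class_map_eq [of 2 \<beta>] assms
  by (simp add: res_def restriction_map_def)

text \<open>
  The content of \<open>\<phi> \<circ> res = 0\<close>: the functions \<open>\<gamma>\<close> of a cocycle of \<open>G\<close> form a lift for its
  restriction to \<open>N\<close>, and for this lift the representative of \<open>\<phi>\<close> vanishes identically.
\<close>
lemma cocycle_lift:
  assumes \<beta>: "\<beta> \<in> carrier (cocycles 2)"
  shows "lift (restrict \<beta> (tuples NG 2)) (transgress \<beta>)" (is ?lift)
    and "dT (transgress \<beta>) \<otimes>\<^bsub>K2\<^esub> P2 (restrict \<beta> (tuples TG 2)) = \<one>\<^bsub>K2\<^esub>" (is ?zero)
proof -
  have C: "restrict \<beta> (tuples NG 2) \<in> carrier C2N"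
    "restrict \<beta> (tuples TG 2) \<in> carrier (cochain_group 2 TG M)" "transgress \<beta> \<in> carrier K1"
    using cocycle_cochain [OF \<beta>] rN.map_cochain [of 2 \<beta>] rT.map_cochain [of 2 \<beta>]
    by (simp_all add: transgress_cochain)
  from cocycle_gluing_data [OF \<beta>] show ?lift and ?zero
    unfolding gluing_data_iff [OF C] by blast+
qed

lemma res_hom:
  "res G N T M act \<in> hom H2G (H2NT \<times>\<times> H2T)"
proof (rule homI)
  fix X assume X: "X \<in> carrier H2G"
  then obtain \<beta> where X_eq: "X = cls 2 \<beta>" and \<beta>: "\<beta> \<in> carrier (cocycles 2)"
    unfolding carrier_cohomology by (rule imageE)
  have "restrict \<beta> (tuples NG 2) \<in> carrier Z2N"
    "restrict \<beta> (tuples TG 2) \<in> carrier Z2T"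
    using \<beta> rN.map_cocycle [of 2 \<beta>] rT.map_cocycle [of 2 \<beta>] by simp_all
  then show "res G N T M act X \<in> carrier (H2NT \<times>\<times> H2T)"
    unfolding X_eq res_class [OF \<beta>] carrier_invariant_cohomology T.carrier_cohomology DirProd_def
    using cocycle_lift(1) [OF \<beta>] by auto
next
  fix X Y assume XY: "X \<in> carrier H2G" "Y \<in> carrier H2G"
  show "res G N T M act (X \<otimes>\<^bsub>H2G\<^esub> Y) = res G N T M act X
      \<otimes>\<^bsub>H2NT \<times>\<times> H2T\<^esub> res G N T M act Y"
    using hom_mult [OF rN.class_map_in_hom [of 2] XY] hom_mult [OF rT.class_map_in_hom [of 2] XY]
    by (simp add: res_def restriction_map_def invariant_cohomology_def)
qed

text \<open>Lifts add up, and the differential on \<open>T\<close> is additive.\<close>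
lemma omega_N_hom:
  "omega_N G N T M act \<in> hom H2NT H2TD"
proof (rule homI)
  fix X assume "X \<in> carrier H2NT"
  then obtain b \<gamma> where "X = clsN b" "b \<in> carrier Z2N" "lift b \<gamma>"
    unfolding carrier_invariant_cohomology by blast
  then show "omega_N G N T M act X \<in> carrier H2TD"
    by (simp add: omega_N_class TD.carrier_cohomology lift_differential)
next
  fix X Y assume X: "X \<in> carrier H2NT"
    and Y: "Y \<in> carrier H2NT"
  obtain b \<gamma> where b: "X = clsN b" "b \<in> carrier Z2N" "lift b \<gamma>"
    using X unfolding carrier_invariant_cohomology by blast
  obtain b' \<gamma>' where b': "Y = clsN b'" "b' \<in> carrier Z2N" "lift b' \<gamma>'"
    using Y unfolding carrier_invariant_cohomology by blast
  have K: "\<gamma> \<in> carrier K1" "\<gamma>' \<in> carrier K1"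
    using b(3) b'(3) by (simp_all add: lift_def)
  have XY: "X \<otimes>\<^bsub>H2NT\<^esub> Y = clsN (b \<otimes>\<^bsub>Z2N\<^esub> b')"
    using N.cohomology_class_mult [OF _ _ b(2) b'(2)] by (simp add: b(1) b'(1) invariant_cohomology_def)
  have l: "lift (b \<otimes>\<^bsub>Z2N\<^esub> b') (\<gamma> \<otimes>\<^bsub>K1\<^esub> \<gamma>')"
    using lift_mult [OF N.cocycle_cochain [OF b(2)] N.cocycle_cochain [OF b'(2)] b(3) b'(3)] by simp
  have d: "dT (\<gamma> \<otimes>\<^bsub>K1\<^esub> \<gamma>') = dT \<gamma>
      \<otimes>\<^bsub>Z2TD\<^esub> dT \<gamma>'"
    unfolding dT.hom_mult [OF K] by simp
  show "omega_N G N T M act (X \<otimes>\<^bsub>H2NT\<^esub> Y) =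
      omega_N G N T M act X \<otimes>\<^bsub>H2TD\<^esub> omega_N G N T M act Y"
    unfolding XY unfolding omega_N_class [OF TZ.A.m_closed [OF b(2) b'(2)] l] d
    unfolding b(1) b'(1) omega_N_class [OF b(2,3)] omega_N_class [OF b'(2,3)]
    by (rule TD.cohomology_class_mult [OF _ _ lift_differential [OF b(2,3)] lift_differential [OF b'(2,3)], symmetric]) simp_all
qed

lemma phi_hom:
  "phi G N T M act \<in> hom (H2NT \<times>\<times> H2T) H2TD"
proof -
  have P: "principal_der_map 2 G N T M act \<in> hom H2T H2TD"
    by (rule principal_der_map_hom) simp_all
  show ?thesis
  proof (rule homI)
    fix x assume "x \<in> carrier (H2NT \<times>\<times> H2T)"
    then show "phi G N T M act x \<in> carrier H2TD"
      using hom_in_carrier [OF omega_N_hom] hom_in_carrier [OF P] by (auto simp: phi_def)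
  next
    fix x y assume "x \<in> carrier (H2NT \<times>\<times> H2T)"
      "y \<in> carrier (H2NT \<times>\<times> H2T)"
    then obtain z w z' w' where xy: "x = (z, w)" "y = (z', w')"
      and c: "z \<in> carrier H2NT" "w \<in> carrier H2T"
        "z' \<in> carrier H2NT" "w' \<in> carrier H2T"
      by (auto simp: DirProd_def)
    show "phi G N T M act (x \<otimes>\<^bsub>H2NT \<times>\<times> H2T\<^esub> y) =
      phi G N T M act x \<otimes>\<^bsub>H2TD\<^esub> phi G N T M act y"
      using c hom_in_carrier [OF omega_N_hom] hom_in_carrier [OF P]
      by (simp add: xy phi_def hom_mult [OF omega_N_hom] hom_mult [OF P] HTD.m_ac)
  qed
qed

lemma phi_class:
  assumes b: "b \<in> carrier Z2N" and l: "lift b \<gamma>" and c: "c \<in> carrier Z2T"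
  shows "phi G N T M act (clsN b, clsT c) = clsTD (dT \<gamma> \<otimes>\<^bsub>K2\<^esub> P2 c)" (is ?eq)
    and "dT \<gamma> \<otimes>\<^bsub>K2\<^esub> P2 c \<in> carrier Z2TD" (is ?mem)
proof -
  have mult: "x \<otimes>\<^bsub>K2\<^esub> y = x \<otimes>\<^bsub>Z2TD\<^esub> y" for x y by simp
  have Pc: "P2 c \<in> carrier Z2TD"
    using P.map_cocycle [of 2 c] c by simp
  note d = lift_differential [OF b l]
  show ?eq
    unfolding mult
    using TD.cohomology_class_mult [OF _ _ d Pc] omega_N_class [OF b l] principal_der_map_class [of 2 c] c
    by (simp add: phi_def del: cocycle_group_mult)
  show ?mem
    unfolding mult using d Pc by (rule ZTD.m_closed)
qed

lemma exact_at_H1: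
  "principal_der_map 1 G N T M act ` carrier (cohomology 1 TG M act) =
    kernel H1TD H2G (tau G N T M act)" (is "?L = ?R")
proof -
  have P1: "P1 w \<in> carrier Z1TD" if "w \<in> carrier (Der TG M act)" for w
    using P.map_cocycle [of 1 w] that by simp
  have iff: "tau G N T M act (cls1TD d) = \<one>\<^bsub>H2G\<^esub> \<longleftrightarrow>
      (\<exists>w \<in> carrier (Der TG M act). cls1TD d = principal_der_map 1 G N T M act (cohomology_class 1 TG M act w))"
    if d: "d \<in> carrier Z1TD" for d
  proof -
    have "tau G N T M act (cls1TD d) = \<one>\<^bsub>H2G\<^esub> \<longleftrightarrow> tau_cocycle G N T act d \<in> cobounds 2"
      unfolding tau_class [OF d] using tau_cocycle_cocycle [OF d] by (simp add: cohomology_class_eq_one_iff)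
    also have "\<dots> \<longleftrightarrow> (\<exists>w \<in> carrier (Der TG M act). cls1TD (P1 w) = cls1TD d)"
      unfolding tau_cocycle_coboundary_iff [OF d]
      using TD.cohomology_class_eq_iff [of 1, OF _ _ P1 d] by simp
    also have "\<dots> \<longleftrightarrow> (\<exists>w \<in> carrier (Der TG M act). cls1TD d = principal_der_map 1 G N T M act (cohomology_class 1 TG M act w))"
      using principal_der_map_class [of 1] by (intro bex_cong refl) auto
    finally show ?thesis .
  qed
  show ?thesis
  proof (intro equalityI subsetI)
    fix x assume "x \<in> ?L"
    then obtain w where w: "w \<in> carrier (Der TG M act)" and x: "x = principal_der_map 1 G N T M act (cohomology_class 1 TG M act w)"
      by (auto simp: T.carrier_cohomology)
    have x': "x = cls1TD (P1 w)"
      unfolding x using principal_der_map_class [of 1 w] w by simp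
    then have "tau G N T M act x = \<one>\<^bsub>H2G\<^esub>"
      using iff [OF P1 [OF w]] w x by auto
    moreover have "x \<in> carrier H1TD"
      unfolding x' TD.carrier_cohomology using P1 [OF w] by (rule imageI)
    ultimately show "x \<in> ?R"
      by (simp add: kernel_def)
  next
    fix x assume "x \<in> ?R"
    then obtain d where d: "d \<in> carrier Z1TD" and x: "x = cls1TD d" and "tau G N T M act (cls1TD d) = \<one>\<^bsub>H2G\<^esub>"
      by (auto simp: kernel_def TD.carrier_cohomology)
    then obtain w where w: "w \<in> carrier (Der TG M act)"
      and "x = principal_der_map 1 G N T M act (cohomology_class 1 TG M act w)"
      using iff [OF d] by auto
    then show "x \<in> ?L"
      unfolding T.carrier_cohomology by simp
  qed
qed

lemma DirProd_one: "\<one>\<^bsub>H2NT \<times>\<times> H2T\<^esub> =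
    (\<one>\<^bsub>cohomology 2 NG M act\<^esub>, \<one>\<^bsub>H2T\<^esub>)"
  by (simp add: DirProd_def invariant_cohomology_def)

lemma exact_at_H2:
  "tau G N T M act ` carrier H1TD =
    kernel H2G (H2NT \<times>\<times> H2T) (res G N T M act)" (is "?L = ?R")
proof -
  let ?oN = "\<one>\<^bsub>Z2N\<^esub>" and ?oT = "\<one>\<^bsub>Z2T\<^esub>"
  note ones = TZ.A.one_closed ZT.one_closed
  have res_one: "res G N T M act (cls 2 \<beta>) =
      \<one>\<^bsub>H2NT \<times>\<times> H2T\<^esub> \<longleftrightarrow>
      restrict \<beta> (tuples NG 2) \<in> coboundaries 2 NG M act \<and> restrict \<beta> (tuples TG 2) \<in> coboundaries 2 TG M act"
    if "\<beta> \<in> carrier (cocycles 2)" for \<beta>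
    using that rN.map_cocycle [of 2 \<beta>] rT.map_cocycle [of 2 \<beta>]
    unfolding res_class [OF that] DirProd_one
    by (simp add: N.cohomology_class_eq_one_iff T.cohomology_class_eq_one_iff)
  show ?thesis
  proof (intro equalityI subsetI)
    fix x assume "x \<in> ?L"
    then obtain d where d: "d \<in> carrier Z1TD" and x: "x = tau G N T M act (cls1TD d)"
      by (auto simp: TD.carrier_cohomology)
    have dC: "d \<in> carrier K1"
      using d unfolding derivation_iff by (rule conjunct1)
    have x: "x = cls 2 (tau_cocycle G N T act d)"
      unfolding x by (rule tau_class [OF d])
    have r: "restrict (tau_cocycle G N T act d) (tuples NG 2) = ?oN" "restrict (tau_cocycle G N T act d) (tuples TG 2) = ?oT"
      unfolding tau_cocycle_eq_glue [OF d]
      by (rule restrict_glue [OF N.cocycle_cochain [OF ones(1)] T.cocycle_cochain [OF ones(2)] dC])+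
    have "res G N T M act x = \<one>\<^bsub>H2NT \<times>\<times> H2T\<^esub>"
      unfolding x res_one [OF tau_cocycle_cocycle [OF d]] r
      using subgroup.one_closed [OF N.subgroup_coboundaries [of 2]] subgroup.one_closed [OF T.subgroup_coboundaries [of 2]]
      by simp
    then show "x \<in> ?R"
      using tau_cocycle_cocycle [OF d] unfolding kernel_def carrier_cohomology x by blast
  next
    fix x assume "x \<in> ?R"
    then obtain \<beta> where \<beta>: "\<beta> \<in> carrier (cocycles 2)" and x: "x = cls 2 \<beta>"
      and B: "restrict \<beta> (tuples NG 2) \<in> coboundaries 2 NG M act" "restrict \<beta> (tuples TG 2) \<in> coboundaries 2 TG M act"
      using res_one by (auto simp: kernel_def carrier_cohomology)
    obtain a where a: "a \<in> carrier C1N" "restrict \<beta> (tuples NG 2) = dN a"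
      using B(1) unfolding N.coboundary2_iff by blast
    obtain e where e: "e \<in> carrier (cochain_group 1 TG M)" "restrict \<beta> (tuples TG 2) = differential 1 TG M act e"
      using B(2) unfolding T.coboundary2_iff by blast
    \<comment> \<open>Any normalized extension of \<open>- a\<close> and \<open>- e\<close> to \<open>G\<close> would do: \<open>\<beta> + \<partial>h\<close> restricts to 0 on \<open>N\<close> and on \<open>T\<close>.\<close>
    define h where "h = cochain1 (\<lambda>n t. inv\<^bsub>M\<^esub> (a [n] \<otimes>\<^bsub>M\<^esub> e [t]))"
    have h: "h \<in> carrier (cochains 1)"
      unfolding h_def using a(1) e(1) by (intro cochain1_cochain) (simp_all add: cochain1_iff)
    define \<sigma> where "\<sigma> = diff 1 h"
    define \<beta>' where "\<beta>' = \<sigma> \<otimes>\<^bsub>cocycles 2\<^esub> \<beta>"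
    have \<sigma>: "\<sigma> \<in> cobounds 2" using h by (auto simp: \<sigma>_def coboundary2_iff)
    then have \<sigma>Z: "\<sigma> \<in> carrier (cocycles 2)" using coboundaries_subset [of 2] by auto
    have \<beta>': "\<beta>' \<in> carrier (cocycles 2)"
      unfolding \<beta>'_def using \<sigma>Z \<beta> by (rule ZG.m_closed)
    have x': "x = cls 2 \<beta>'"
      using cohomology_class_eq_iff [OF _ _ \<beta> \<beta>'] \<sigma> unfolding x \<beta>'_def by auto
    have hN: "restrict h (tuples NG 1) = inv\<^bsub>C1N\<^esub> a"
      unfolding cochain_group_inv [OF A.comm_group_axioms a(1)] using a(1) e(1)
      by (intro extensional_tuples_eqI [of _ NG 1]) (simp_all add: ball_tuples h_def cochain1_iff)
    have hT: "restrict h (tuples TG 1) = inv\<^bsub>cochain_group 1 TG M\<^esub> e"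
      unfolding cochain_group_inv [OF A.comm_group_axioms e(1)] using a(1) e(1)
      by (intro extensional_tuples_eqI [of _ TG 1]) (simp_all add: ball_tuples h_def cochain1_iff)
    interpret dTM: group_hom "cochain_group 1 TG M" "cochain_group 2 TG M" "differential 1 TG M act"
      using T.differential_group_hom [of 1] by simp
    have "restrict \<sigma> (tuples NG 2) = inv\<^bsub>C2N\<^esub> (restrict \<beta> (tuples NG 2))"
      using rN.map_differential [of 1 h] h a by (simp add: hN \<sigma>_def dN.hom_inv)
    then have rN: "restrict \<beta>' (tuples NG 2) = ?oN"
      using hom_mult [OF rN.map_hom [of 2] cocycle_cochain [OF \<sigma>Z] cocycle_cochain [OF \<beta>]]
        TC2.A.l_inv [OF rN.map_cochain [of 2, OF _ cocycle_cochain [OF \<beta>]]]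
      by (simp add: \<beta>'_def)
    have "restrict \<sigma> (tuples TG 2) = inv\<^bsub>cochain_group 2 TG M\<^esub> (restrict \<beta> (tuples TG 2))"
      using rT.map_differential [of 1 h] h e by (simp add: hT \<sigma>_def dTM.hom_inv)
    then have rT: "restrict \<beta>' (tuples TG 2) = ?oT"
      using hom_mult [OF rT.map_hom [of 2] cocycle_cochain [OF \<sigma>Z] cocycle_cochain [OF \<beta>]]
        dTM.H.l_inv [OF rT.map_cochain [of 2, OF _ cocycle_cochain [OF \<beta>]]]
      by (simp add: \<beta>'_def)
    define d where "d = transgress \<beta>'"
    have dC: "d \<in> carrier K1"
      unfolding d_def using cocycle_cochain [OF \<beta>'] by (rule transgress_cochain)
    have d: "d \<in> carrier Z1TD"
      using cocycle_gluing_data [OF \<beta>'] unfolding rN rT d_def [symmetric] gluing_data_one_iff [OF dC] .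
    have "cls 2 (tau_cocycle G N T act d) = x"
      using cocycle_cohomologous_to_glue [OF \<beta>'] cohomology_class_eq_iff [OF _ _ \<beta>' tau_cocycle_cocycle [OF d]]
      unfolding x' rN rT d_def [symmetric] tau_cocycle_eq_glue [OF d, symmetric] by simp
    then have "x = tau G N T M act (cls1TD d)"
      unfolding tau_class [OF d] by (rule sym)
    then show "x \<in> ?L"
      unfolding TD.carrier_cohomology using d by blast
  qed
qed

lemma exact_at_product:
  "res G N T M act ` carrier H2G = kernel (H2NT \<times>\<times> H2T)
      H2TD (phi G N T M act)" (is "?L = ?R")
proof -
  show ?thesis
  proof (intro equalityI subsetI)
    fix x assume "x \<in> ?L"
    then obtain \<beta> where \<beta>: "\<beta> \<in> carrier (cocycles 2)"
      and x: "x = res G N T M act (cls 2 \<beta>)"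
      by (auto simp: carrier_cohomology)
    have r: "restrict \<beta> (tuples NG 2) \<in> carrier Z2N"
      "restrict \<beta> (tuples TG 2) \<in> carrier Z2T"
      using \<beta> rN.map_cocycle [of 2 \<beta>] rT.map_cocycle [of 2 \<beta>] by simp_all
    have "\<one>\<^bsub>K2\<^esub> = \<one>\<^bsub>Z2TD\<^esub>" by simp
    then have "phi G N T M act x = \<one>\<^bsub>H2TD\<^esub>"
      unfolding x res_class [OF \<beta>] phi_class(1) [OF r(1) cocycle_lift(1) [OF \<beta>] r(2)] cocycle_lift(2) [OF \<beta>]
      using TD.cohomology_class_eq_one_iff [OF _ _ ZTD.one_closed]
        subgroup.one_closed [OF TD.subgroup_coboundaries [of 2]] by simp
    moreover have "x \<in> carrier (H2NT \<times>\<times> H2T)"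
      unfolding x by (rule hom_in_carrier [OF res_hom]) (use \<beta> in \<open>simp add: carrier_cohomology\<close>)
    ultimately show "x \<in> ?R"
      by (simp add: kernel_def)
  next
    fix x assume "x \<in> ?R"
    then obtain z w where x: "x = (z, w)" and z: "z \<in> carrier H2NT"
      and w: "w \<in> carrier H2T" and phi: "phi G N T M act (z, w) = \<one>\<^bsub>H2TD\<^esub>"
      by (auto simp: kernel_def DirProd_def)
    obtain b \<gamma> where b: "z = clsN b" "b \<in> carrier Z2N" "lift b \<gamma>"
      using z unfolding carrier_invariant_cohomology by blast
    obtain c where c: "w = clsT c" "c \<in> carrier Z2T"
      using w unfolding T.carrier_cohomology by (rule imageE)
    have bC: "b \<in> carrier C2N" and cC: "c \<in> carrier (cochain_group 2 TG M)"
      using b(2) c(2) by (simp_all add: N.cocycle_cochain T.cocycle_cochain)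
    have \<gamma>K: "\<gamma> \<in> carrier K1" using b(3) by (simp add: lift_def)
    note ph = phi_class [OF b(2,3) c(2)]
    have "dT \<gamma> \<otimes>\<^bsub>K2\<^esub> P2 c \<in> coboundaries 2 TG DerN conj1"
      using phi TD.cohomology_class_eq_one_iff [OF _ _ ph(2)] unfolding b(1) c(1) ph(1) by simp
    then obtain e where e: "e \<in> carrier (cochain_group 1 TG DerN)" and "dT \<gamma> \<otimes>\<^bsub>K2\<^esub> P2 c =
        differential 1 TG DerN conj1 e"
      unfolding TD.coboundary2_iff by blast
    then have eq: "dT \<gamma> \<otimes>\<^bsub>K2\<^esub> P2 c = dT e"
      using Der_differential [of 1 e] by simp
    have eK: "e \<in> carrier K1" using e by (rule Der_cochain_cochain)
    have PcK: "P2 c \<in> carrier K2"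
      using P.map_cocycle [of 2 c] c(2) TD.cocycle_cochain Der_cochain_cochain by simp
    \<comment> \<open>Subtracting a \<open>Der(N, M)\<close>-valued cochain keeps (1) and turns (2), so far only true up to
  the coboundary of \<open>e\<close>, into an equation between cochains.\<close>
    define \<gamma>' where "\<gamma>' = inv\<^bsub>K1\<^esub> e \<otimes>\<^bsub>K1\<^esub> \<gamma>"
    have \<gamma>'K: "\<gamma>' \<in> carrier K1" unfolding \<gamma>'_def using eK \<gamma>K by (intro CC.m_closed CC.inv_closed)
    have "lift (inv\<^bsub>C2N\<^esub> \<one>\<^bsub>C2N\<^esub> \<otimes>\<^bsub>C2N\<^esub> b) \<gamma>'"
      unfolding \<gamma>'_def using e b(3) bC
      by (intro lift_mult lift_inv TC2.A.inv_closed TC2.A.one_closed) (simp_all only: lift_one_iff)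
    then have l: "lift b \<gamma>'"
      unfolding TC2.A.inv_one TC2.A.l_one [OF bC] .
    have "dT \<gamma>' \<otimes>\<^bsub>K2\<^esub> P2 c = inv\<^bsub>K2\<^esub> dT e \<otimes>\<^bsub>K2\<^esub> (dT \<gamma> \<otimes>\<^bsub>K2\<^esub> P2 c)"
      unfolding \<gamma>'_def dT.hom_mult [OF CC.inv_closed [OF eK] \<gamma>K] dT.hom_inv [OF eK]
      by (rule CC2.m_assoc [OF CC2.inv_closed [OF dT.hom_closed [OF eK]] dT.hom_closed [OF \<gamma>K] PcK])
    also have "\<dots> = \<one>\<^bsub>K2\<^esub>"
      unfolding eq by (rule CC2.l_inv [OF dT.hom_closed [OF eK]])
    finally have "gluing_data b \<gamma>' c"
      unfolding gluing_data_iff [OF bC cC \<gamma>'K] using l by blast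
    then have g: "glue b \<gamma>' c \<in> carrier (cocycles 2)"
      by (rule glue_cocycle [OF b(2) c(2) \<gamma>'K])
    have "x = res G N T M act (cls 2 (glue b \<gamma>' c))"
      unfolding res_class [OF g] restrict_glue [OF bC cC \<gamma>'K] x b(1) c(1) ..
    then show "x \<in> ?L"
      unfolding carrier_cohomology using g by blast
  qed
qed

lemma comm_group_product:
  "comm_group (H2NT \<times>\<times> H2T)"
proof -
  interpret D: group "H2NT \<times>\<times> H2T"
    by (rule DirProd_group) (rule HN.is_group, rule HT.is_group)
  show ?thesis
    by (rule D.group_comm_groupI) (auto simp: DirProd_def HN.m_comm HT.m_comm)
qed

lemmas comm_group_cohomologies =
  T.comm_group_cohomology TD.comm_group_cohomology comm_group_cohomology comm_group_product

end

text \<open>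
  Elements of the automorphism group are extensional functions, so its multiplication is composition
  restricted to the carrier.
\<close>
lemma group_module_AutoGroup:
  assumes "group G" "comm_group M" and act: "act \<in> hom G (AutoGroup M)"
  shows "group_module G M act"
proof -
  interpret G: group G by fact
  interpret M: comm_group M by fact
  have aut: "act g \<in> auto M" if "g \<in> carrier G" for g
    using hom_in_carrier [OF act that] by (simp add: AutoGroup_def)
  then have h: "act g \<in> hom M M" "act g \<in> Bij (carrier M)" if "g \<in> carrier G" for g
    using that by (auto simp: auto_def)
  show ?thesis
  proof unfold_locales
    fix g a assume g: "g \<in> carrier G" and a: "a \<in> carrier M"
    show "act g a \<in> carrier M" using hom_in_carrier [OF h(1) [OF g] a] .
    show "act g (a \<otimes>\<^bsub>M\<^esub> b) = act g a \<otimes>\<^bsub>M\<^esub> act g b" if "b \<in> carrier M" for b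
      using hom_mult [OF h(1) [OF g] a that] .
    show "act g (act h a) = act (g \<otimes>\<^bsub>G\<^esub> h) a" if "h \<in> carrier G" for h
      using hom_mult [OF act g that] h(2) [OF g] h(2) [OF that] a
      by (simp add: AutoGroup_def BijGroup_def compose_def)
  next
    fix a assume "a \<in> carrier M"
    then show "act \<one>\<^bsub>G\<^esub> a = a"
      using hom_one [OF act G.is_group M.AutoGroup] by (simp add: AutoGroup_def BijGroup_def)
  qed
qed

theorem theorem1p1:
  fixes G :: "('g, 'x) monoid_scheme" and N T :: "'g set"
    and M :: "('a, 'y) monoid_scheme" and act :: "'g \<Rightarrow> 'a \<Rightarrow> 'a"
  assumes "group G" and "N \<lhd> G" and "subgroup T G"
    and "N <#>\<^bsub>G\<^esub> T = carrier G" and "N \<inter> T = {\<one>\<^bsub>G\<^esub>}"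
    and "comm_group M" and "act \<in> hom G (AutoGroup M)"
  shows "let
      NG = G\<lparr>carrier := N\<rparr>;
      TG = G\<lparr>carrier := T\<rparr>;
      D = Der NG M act;
      Tact = conj_act 1 G N act;
      H1T = cohomology 1 TG M act;
      H1TD = cohomology 1 TG D Tact;
      H2G = cohomology 2 G M act;
      H2N_H2T = invariant_cohomology 2 G N T M act \<times>\<times> cohomology 2 TG M act;
      H2TD = cohomology 2 TG D Tact
    in
      comm_group H1T \<and> comm_group H1TD \<and> comm_group H2G \<and> comm_group H2N_H2T \<and> comm_group H2TD \<and>
      principal_der_map 1 G N T M act \<in> hom H1T H1TD \<and>
      tau G N T M act \<in> hom H1TD H2G \<and>
      res G N T M act \<in> hom H2G H2N_H2T \<and>
      phi G N T M act \<in> hom H2N_H2T H2TD \<and>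
      (\<forall>d \<in> carrier (Der TG D Tact).
         tau_cocycle G N T act d \<in> carrier (cocycle_group 2 G M act) \<and>
         tau G N T M act (cohomology_class 1 TG D Tact d)
           = cohomology_class 2 G M act (tau_cocycle G N T act d)) \<and>
      principal_der_map 1 G N T M act ` carrier H1T = kernel H1TD H2G (tau G N T M act) \<and>
      tau G N T M act ` carrier H1TD = kernel H2G H2N_H2T (res G N T M act) \<and>
      res G N T M act ` carrier H2G = kernel H2N_H2T H2TD (phi G N T M act)"
proof -
  interpret group_module G M act
    using \<open>group G\<close> \<open>comm_group M\<close> \<open>act \<in> hom G (AutoGroup M)\<close> by (rule group_module_AutoGroup)
  interpret semidirect_module G M act N T
    using group_module_axioms assms(2-5)
    by (intro semidirect_module.intro semidirect_module_axioms.intro)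
  show ?thesis
    unfolding Let_def
    using comm_group_cohomologies principal_der_map_hom [of 1] tau_hom res_hom phi_hom
      tau_cocycle_cocycle tau_class exact_at_H1 exact_at_H2 exact_at_product
    by (intro conjI ballI) simp_all
qed

end
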